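(* Let $\lambda>0$ and $d\ge1$ an integer, and let $p_{\mathfrak s}:=\lambda/(1+\lambda)$ and $p_{\mathfrak j}:=1-p_{\mathfrak s}$. Let $\rho_{\mathrm c}(\mathbb Z^d,\lambda)$ denote the critical density of activated random walk on $\mathbb Z^d$ with sleep rate $\lambda$, and let $\mathsf{Returns}(\mathbb Z^d)\in\{0,1,\dots,\infty\}$ be the number of returns to the origin of a simple symmetric random walk on $\mathbb Z^d$ started at the origin, not counting the initial occupation. Then $$p_{\mathfrak s}+\frac{p_{\mathfrak s}p_{\mathfrak j}}{2d}\left(1-\frac{p_{\mathfrak s}p_{\mathfrak j}}{2d}\right)\le\rho_{\mathrm c}(\mathbb Z^d,\lambda)\le p_{\mathfrak s}+p_{\mathfrak s}p_{\mathfrak j}\,\mathbf E[\mathsf{Returns}(\mathbb Z^d)].$$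
   Context: The expectation $\mathbf E[\mathsf{Returns}(\mathbb Z^d)]$ takes values in $[0,\infty]$. Activated random walk (ARW) on $\mathbb Z^d$ with sleep rate $\lambda>0$: active particles perform independent continuous-time simple symmetric random walks on $\mathbb Z^d$ at jump rate $1$, and each active particle falls asleep at rate $\lambda$. Sleeping particles do not move, but become active when they share a site with another particle (so a particle attempting to fall asleep at a site containing other particles is instantly reactivated). The fixed-energy system starts from a random configuration $\sigma:\mathbb Z^d\to\mathbb N=\{0,1,2,\dots\}$ of active particles whose law is invariant and ergodic under translations of $\mathbb Z^d$, with mean $\rho=\mathbf E[\sigma(\mathbf 0)]\in[0,\infty)$. The system fixates if every particle at some time falls asleep and is not woken up again; otherwise it stays active. Critical density: by a known theorem (Rolla–Sidoravicius–Zindy) there is a number $\rho_{\mathrm c}=\rho_{\mathrm c}(\mathbb Z^d,\lambda)$, depending only on $d$ and $\lambda$, such that for every translation-ergodic initial configuration of active particles with mean $\rho$, the system fixates almost surely if $\rho<\rho_{\mathrm c}$ and stays active almost surely if $\rho>\rho_{\mathrm c}$. Equivalent discrete description of fixation (known, Rolla–Tournier). Independently of $\sigma$, let $\mathcal I=(\mathcal I_x(k))_{x\in\mathbb Z^d,k\ge0}$ be independent instructions, with $\mathcal I_x(k)$ equal to the sleep instruction $\mathfrak s$ with probability $p_{\mathfrak s}$ and to the jump instruction $\mathfrak j_y$ with probability $p_{\mathfrak j}/(2d)$ for each nearest neighbor $y\sim x$. For finite $V\subset\mathbb Z^d$, stabilize $\sigma|_V$ on $V$ by repeatedly toppling sites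 of $V$ containing at least one active particle until there are none. Toppling $x$ executes the next unused instruction at $x$: $\mathfrak s$ turns a lone active particle at $x$ into a sleeping one and has no effect if there are at least two particles at $x$; $\mathfrak j_y$ moves one particle from $x$ to $y$, where it wakes any sleeping particle, and is killed if $y\notin V$. The number of instructions used at each site (the stabilizing odometer) almost surely does not depend on the toppling order and is nondecreasing in $V$; let $m_\sigma(x)\in\mathbb N\cup\{\infty\}$ be its limit at $x$ along $V_n=\{-n,\dots,n\}^d$. Then $\mathbf P(\sigma\text{ fixates})=\mathbf P(m_\sigma(\mathbf 0)<\infty)\in\{0,1\}$. *)

theory Defs
  imports "HOL-Probability.Probability"
begin

text \<open>
  The lattice \<open>\<int>\<^sup>d\<close> is the type \<^typ>\<open>int ^ 'd\<close>, so that \<open>d = CARD('d) \<ge> 1\<close>.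
\<close>

definition neighbors :: "int ^ 'd \<Rightarrow> (int ^ 'd) set" where
  "neighbors x = {y. (\<Sum>i\<in>UNIV. \<bar>y $ i - x $ i\<bar>) = 1}"

definition box :: "nat \<Rightarrow> (int ^ 'd) set" where
  "box n = {x. \<forall>i. \<bar>x $ i\<bar> \<le> int n}"


section \<open>Toppling and stabilization\<close>

datatype 's instruction = Sleep | Jump 's

text \<open>
  \<open>Active n\<close> stands for \<open>n\<close> active particles (so \<open>Active 0\<close> is an empty site) and \<open>Sleeping\<close>
  for exactly one sleeping particle; a sleeping particle never shares its site.
\<close>

datatype site_state = Sleeping | Active nat

fun add_particle :: "site_state \<Rightarrow> site_state" where
  "add_particle Sleeping = Active 2"
| "add_particle (Active n) = Active (Suc n)"

fun remove_particle :: "site_state \<Rightarrow> site_state" where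
  "remove_particle Sleeping = Sleeping"
| "remove_particle (Active n) = Active (n - 1)"

fun fall_asleep :: "site_state \<Rightarrow> site_state" where
  "fall_asleep Sleeping = Sleeping"
| "fall_asleep (Active n) = (if n = 1 then Sleeping else Active n)"

definition has_active :: "site_state \<Rightarrow> bool" where
  "has_active s \<longleftrightarrow> (\<exists>n\<ge>1. s = Active n)"

text \<open>A particle that jumps out of \<open>V\<close> is killed.\<close>

fun execute :: "'s set \<Rightarrow> 's \<Rightarrow> 's instruction \<Rightarrow> ('s \<Rightarrow> site_state) \<Rightarrow> ('s \<Rightarrow> site_state)" where
  "execute V x Sleep \<eta> = \<eta>(x := fall_asleep (\<eta> x))"
| "execute V x (Jump y) \<eta> =
     (let \<eta>' = \<eta>(x := remove_particle (\<eta> x))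
      in if y \<in> V then \<eta>'(y := add_particle (\<eta>' y)) else \<eta>')"

definition restrict_config :: "'s set \<Rightarrow> ('s \<Rightarrow> nat) \<Rightarrow> ('s \<Rightarrow> site_state)" where
  "restrict_config V \<sigma> = (\<lambda>x. if x \<in> V then Active (\<sigma> x) else Active 0)"

text \<open>
  \<open>topples_to V \<sigma> I \<eta> h\<close>: some finite sequence of topplings of sites of \<open>V\<close> containing an
  active particle leads from \<open>\<sigma>\<close> restricted to \<open>V\<close> to the state \<open>\<eta>\<close>, using \<open>h x\<close> instructions
  at each site \<open>x\<close>. The instruction \<open>\<I>\<^sub>x(k)\<close> is \<open>I (x, k)\<close>.
\<close>

inductive topples_to ::
  "'s set \<Rightarrow> ('s \<Rightarrow> nat) \<Rightarrow> ('s \<times> nat \<Rightarrow> 's instruction) \<Rightarrow>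
     ('s \<Rightarrow> site_state) \<Rightarrow> ('s \<Rightarrow> nat) \<Rightarrow> bool"
  for V :: "'s set" and \<sigma> :: "'s \<Rightarrow> nat" and I :: "'s \<times> nat \<Rightarrow> 's instruction"
where
  start: "topples_to V \<sigma> I (restrict_config V \<sigma>) (\<lambda>_. 0)"
| topple: "topples_to V \<sigma> I \<eta> h \<Longrightarrow> x \<in> V \<Longrightarrow> has_active (\<eta> x) \<Longrightarrow>
     topples_to V \<sigma> I (execute V x (I (x, h x)) \<eta>) (h(x := Suc (h x)))"

definition stabilizes_with ::
  "'s set \<Rightarrow> ('s \<Rightarrow> nat) \<Rightarrow> ('s \<times> nat \<Rightarrow> 's instruction) \<Rightarrow> ('s \<Rightarrow> nat) \<Rightarrow> bool" where
  "stabilizes_with V \<sigma> I h \<longleftrightarrow>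
     (\<exists>\<eta>. topples_to V \<sigma> I \<eta> h \<and> (\<forall>x\<in>V. \<not> has_active (\<eta> x)))"

text \<open>
  The description is unambiguous because the odometer does not depend on the toppling order.
  The value \<open>\<infinity>\<close> is used when stabilization on \<open>V\<close> never ends, which for finite \<open>V\<close> happens with
  probability 0 under the instruction law below.
\<close>

definition odometer ::
  "'s set \<Rightarrow> ('s \<Rightarrow> nat) \<Rightarrow> ('s \<times> nat \<Rightarrow> 's instruction) \<Rightarrow> 's \<Rightarrow> enat" where
  "odometer V \<sigma> I x =
     (if \<exists>h. stabilizes_with V \<sigma> I h
      then enat ((THE h. stabilizes_with V \<sigma> I h) x) else \<infinity>)"

definition limit_odometer ::
  "(int ^ 'd \<Rightarrow> nat) \<Rightarrow> ((int ^ 'd) \<times> nat \<Rightarrow> (int ^ 'd) instruction) \<Rightarrow> int ^ 'd \<Rightarrow> enat" where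
  "limit_odometer \<sigma> I x = lim (\<lambda>n. odometer (box n) \<sigma> I x)"


section \<open>Random instructions and initial configurations\<close>

definition sleep_prob :: "real \<Rightarrow> real" where
  "sleep_prob lam = lam / (1 + lam)"

definition jump_prob :: "real \<Rightarrow> real" where
  "jump_prob lam = 1 - sleep_prob lam"

definition instruction_pmf :: "real \<Rightarrow> int ^ 'd \<Rightarrow> (int ^ 'd) instruction pmf" where
  "instruction_pmf lam x =
     bind_pmf (bernoulli_pmf (sleep_prob lam))
       (\<lambda>b. if b then return_pmf Sleep else map_pmf Jump (pmf_of_set (neighbors x)))"

definition instruction_measure ::
  "real \<Rightarrow> ((int ^ 'd) \<times> nat \<Rightarrow> (int ^ 'd) instruction) measure" where
  "instruction_measure lam =
     PiM UNIV (\<lambda>(x, k). measure_pmf (instruction_pmf lam x))"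

definition config_space :: "(int ^ 'd \<Rightarrow> nat) measure" where
  "config_space = PiM UNIV (\<lambda>_. count_space UNIV)"

definition shift :: "int ^ 'd \<Rightarrow> (int ^ 'd \<Rightarrow> nat) \<Rightarrow> (int ^ 'd \<Rightarrow> nat)" where
  "shift v \<sigma> = (\<lambda>x. \<sigma> (x + v))"

definition translation_ergodic :: "(int ^ 'd \<Rightarrow> nat) measure \<Rightarrow> bool" where
  "translation_ergodic M \<longleftrightarrow>
     prob_space M \<and> sets M = sets config_space \<and>
     (\<forall>v. distr M config_space (shift v) = M) \<and>
     (\<forall>A\<in>sets M. (\<forall>v. shift v -` A = A) \<longrightarrow> measure M A = 0 \<or> measure M A = 1)"

definition has_density :: "(int ^ 'd \<Rightarrow> nat) measure \<Rightarrow> real \<Rightarrow> bool" where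
  "has_density M \<rho> \<longleftrightarrow>
     integrable M (\<lambda>\<sigma>. real (\<sigma> 0)) \<and> (\<integral>\<sigma>. real (\<sigma> 0) \<partial>M) = \<rho>"


section \<open>Fixation and critical density\<close>

text \<open>
  Fixation is expressed in the site-wise (Diaconis--Fulton) representation of activated random
  walk: by Rolla and Tournier, the continuous-time system with sleep rate \<open>lam\<close> started from an
  ergodic law \<open>M\<close> of active particles with finite mean fixates with the same probability as the
  odometer at the origin stays finite, and that probability is 0 or 1.
\<close>

definition fixates_as :: "real \<Rightarrow> (int ^ 'd \<Rightarrow> nat) measure \<Rightarrow> bool" where
  "fixates_as lam M \<longleftrightarrow>
     (AE (\<sigma>, I) in M \<Otimes>\<^sub>M instruction_measure lam. limit_odometer \<sigma> I 0 < \<infinity>)"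

definition stays_active_as :: "real \<Rightarrow> (int ^ 'd \<Rightarrow> nat) measure \<Rightarrow> bool" where
  "stays_active_as lam M \<longleftrightarrow>
     (AE (\<sigma>, I) in M \<Otimes>\<^sub>M instruction_measure lam. \<not> limit_odometer \<sigma> I 0 < \<infinity>)"

text \<open>
  The critical density depends on the lattice only through the dimension, which is passed as a
  type argument. The defining property determines it uniquely, since there are ergodic laws of
  every density in \<open>[0, \<infinity>)\<close> and the law of density 0 fixates. That such a number exists
  is the theorem of Rolla, Sidoravicius and Zindy.
\<close>

definition is_critical_density :: "'d::finite itself \<Rightarrow> real \<Rightarrow> real \<Rightarrow> bool" where
  "is_critical_density TYPE('d) lam \<rho>c \<longleftrightarrow>
     (\<forall>(M :: (int ^ 'd \<Rightarrow> nat) measure) \<rho>. translation_ergodic M \<longrightarrow> has_density M \<rho> \<longrightarrow>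
        (\<rho> < \<rho>c \<longrightarrow> fixates_as lam M) \<and> (\<rho> > \<rho>c \<longrightarrow> stays_active_as lam M))"


section \<open>Returns of simple random walk\<close>

definition srw_steps :: "(nat \<Rightarrow> int ^ 'd) measure" where
  "srw_steps = PiM UNIV (\<lambda>_. measure_pmf (pmf_of_set (neighbors 0)))"

definition walk :: "(nat \<Rightarrow> int ^ 'd) \<Rightarrow> nat \<Rightarrow> int ^ 'd" where
  "walk \<xi> n = (\<Sum>k<n. \<xi> k)"

definition returns :: "(nat \<Rightarrow> int ^ 'd) \<Rightarrow> enat" where
  "returns \<xi> =
     (if finite {n. n \<ge> 1 \<and> walk \<xi> n = 0} then enat (card {n. n \<ge> 1 \<and> walk \<xi> n = 0}) else \<infinity>)"

definition expected_returns :: "'d::finite itself \<Rightarrow> ennreal" where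
  "expected_returns TYPE('d) =
     (\<integral>\<^sup>+ \<xi>. ennreal_of_enat (returns \<xi>) \<partial>(srw_steps :: (nat \<Rightarrow> int ^ 'd) measure))"


section \<open>Consistency of the encoding\<close>

lemma neighbors_eq:
  "neighbors (x :: int ^ 'd) = (\<lambda>(i, s). x + axis i s) ` (UNIV \<times> {1, -1})"
proof (rule set_eqI)
  fix y :: "int ^ 'd"
  show "y \<in> neighbors x \<longleftrightarrow> y \<in> (\<lambda>(i, s). x + axis i s) ` (UNIV \<times> {1, -1})"
  proof
    assume "y \<in> neighbors x"
    then have s: "(\<Sum>i\<in>UNIV. \<bar>y $ i - x $ i\<bar>) = 1" by (simp add: neighbors_def)
    then obtain j where j: "\<bar>y $ j - x $ j\<bar> \<noteq> 0"
    proof -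
      have "\<exists>j. \<bar>y $ j - x $ j\<bar> \<noteq> 0"
      proof (rule ccontr)
        assume "\<not> (\<exists>j. \<bar>y $ j - x $ j\<bar> \<noteq> 0)"
        then have "(\<Sum>i\<in>UNIV. \<bar>y $ i - x $ i\<bar>) = 0" by simp
        with s show False by simp
      qed
      then show thesis using that by blast
    qed
    have e: "\<bar>y $ j - x $ j\<bar> + (\<Sum>i\<in>UNIV - {j}. \<bar>y $ i - x $ i\<bar>) = 1"
      using s sum.remove[of UNIV j "\<lambda>i. \<bar>y $ i - x $ i\<bar>"] by simp
    have nn: "(\<Sum>i\<in>UNIV - {j}. \<bar>y $ i - x $ i\<bar>) \<ge> 0" by (rule sum_nonneg) simp
    have z: "(\<Sum>i\<in>UNIV - {j}. \<bar>y $ i - x $ i\<bar>) = 0" using e nn j by linarith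
    then have z': "y $ i = x $ i" if "i \<noteq> j" for i
      using that by (subst (asm) sum_nonneg_eq_0_iff) auto
    have "y = x + axis j (y $ j - x $ j)"
      by (auto simp: vec_eq_iff axis_def z')
    moreover have "y $ j - x $ j \<in> {1, -1}" using e z by auto
    ultimately show "y \<in> (\<lambda>(i, s). x + axis i s) ` (UNIV \<times> {1, -1})" by force
  next
    assume "y \<in> (\<lambda>(i, s). x + axis i s) ` (UNIV \<times> {1, -1})"
    then obtain j s where s: "s = 1 \<or> s = -1" and y: "y = x + axis j s" by auto
    have "(\<Sum>i\<in>UNIV. \<bar>y $ i - x $ i\<bar>) = (\<Sum>i\<in>UNIV. if i = j then \<bar>s\<bar> else 0)"
      by (rule sum.cong) (auto simp: y axis_def)
    then show "y \<in> neighbors x" using s by (auto simp: neighbors_def)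
  qed
qed

lemma card_neighbors: "card (neighbors (x :: int ^ 'd)) = 2 * CARD('d)"
proof -
  have "inj_on (\<lambda>(i, s). x + axis i s) (UNIV \<times> {1, -1 :: int})"
    by (auto simp: inj_on_def axis_eq_axis)
  then show ?thesis
    by (simp add: neighbors_eq card_image card_cartesian_product)
qed

lemma finite_neighbors: "finite (neighbors x)"
  by (simp add: neighbors_eq)

lemma neighbors_nonempty: "neighbors x \<noteq> {}"
  by (auto simp: neighbors_eq)

lemma pmf_instruction:
  fixes x y :: "int ^ 'd"
  assumes "lam > 0"
  shows "pmf (instruction_pmf lam x) Sleep = sleep_prob lam"
    and "pmf (instruction_pmf lam x) (Jump y) =
      (if y \<in> neighbors x then jump_prob lam / (2 * real CARD('d)) else 0)"
proof -
  have p: "0 \<le> sleep_prob lam" "sleep_prob lam \<le> 1"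
    using assms by (auto simp: sleep_prob_def)
  have inj: "inj (Jump :: int ^ 'd \<Rightarrow> _)" by (auto simp: inj_def)
  have "Sleep \<notin> set_pmf (map_pmf Jump (pmf_of_set (neighbors x)))" by auto
  then have "pmf (map_pmf Jump (pmf_of_set (neighbors x))) Sleep = 0"
    by (simp add: pmf_eq_0_set_pmf)
  then show "pmf (instruction_pmf lam x) Sleep = sleep_prob lam"
    using p by (simp add: instruction_pmf_def pmf_bind)
  show "pmf (instruction_pmf lam x) (Jump y) =
      (if y \<in> neighbors x then jump_prob lam / (2 * real CARD('d)) else 0)"
    using p inj
    by (simp add: instruction_pmf_def pmf_bind pmf_map_inj' jump_prob_def
        finite_neighbors neighbors_nonempty card_neighbors)
qed

end

theory Submission
  imports Defs "HOL-Real_Asymp.Real_Asymp"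
begin

text \<open>
  By the abelian property a stabilization probability, as a function of the configuration, is
  harmonic along every legal toppling. A bounded function that is a submartingale along some
  toppling out of each unstable configuration and nonpositive at stable ones is nonpositive
  (maximum principle), so all comparisons below amount to choosing which site to topple. Since
  \<open>\<rho>\<^sub>c\<close> is the threshold for every ergodic law, it suffices to look at
  randomly shifted periodic configurations of rational density.

  Lower bound. Stabilize everything else while \<open>z\<close> keeps one particle. Toppling this lone
  particle puts it to sleep with probability \<open>p\<^sub>s\<close>; otherwise it jumps to a
  neighbor \<open>y\<close>, which was itself occupied with probability at least
  \<open>p\<^sub>s\<close>. If \<open>y\<close> was empty, the particle returns directly with
  probability \<open>p\<^sub>j / 2d\<close>. If \<open>y\<close> was occupied, one of the two
  particles jumps first, and if it misses \<open>z\<close> the other one still reaches it with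
  probability \<open>p\<^sub>j / 2d\<close>. If the system stays active, every site in the bulk is
  therefore finally occupied with probability at least the left side, and the number of occupied
  sites is at most the initial number of particles.

  Upper bound. From a configuration with a particle everywhere, adding one more particle does not
  change the law of the final state, because the extra particle may be moved alone until it leaves
  the box. Hence an extra particle held at \<open>y\<close> makes the expected number of jumps out of
  \<open>y\<close> grow by exactly the Green function \<open>G(y, y)\<close>, which bounds the final
  occupation by \<open>p\<^sub>s + p\<^sub>s p\<^sub>j (G(y, y) - 1)\<close>. Removing particles from the
  full configuration by letting them walk out shows that its final \<open>G\<close>-weighted mass is at
  least that of any sparser initial configuration. If the latter fixates, its odometer at the origin
  is tight and, by a second moment bound, uniformly integrable relative to
  \<open>\<Sum>\<^sub>x G(x, 0)\<close>, so that it loses no density.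
\<close>

section \<open>Topplings and the abelian property\<close>

text \<open>
  A site of the hold set \<open>H\<close> keeps its last particle: it may be toppled only while it
  contains at least two. The rule of the paper is \<open>H = {}\<close>.
\<close>

definition act :: "'s set \<Rightarrow> ('s \<Rightarrow> site_state) \<Rightarrow> 's \<Rightarrow> bool" where
  "act H \<eta> x \<longleftrightarrow> (\<exists>n. \<eta> x = Active n \<and> (if x \<in> H then 2 else 1) \<le> n)"

definition stable :: "'s set \<Rightarrow> 's set \<Rightarrow> ('s \<Rightarrow> site_state) \<Rightarrow> bool" where
  "stable V H \<eta> \<longleftrightarrow> (\<forall>x\<in>V. \<not> act H \<eta> x)"

text \<open>Used instructions are discarded, so the next one at every site always has index 0 and
  what remains is again a complete instruction field. By \<open>law_fresh\<close> it even has the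
  same law.\<close>

definition pop :: "'s \<Rightarrow> ('s \<times> nat \<Rightarrow> 'i) \<Rightarrow> 's \<times> nat \<Rightarrow> 'i" where
  "pop x I = (\<lambda>(z, k). I (z, if z = x then Suc k else k))"

fun after :: "'s set \<Rightarrow> ('s \<Rightarrow> site_state) \<Rightarrow> ('s \<times> nat \<Rightarrow> 's instruction) \<Rightarrow> 's list
    \<Rightarrow> 's \<Rightarrow> site_state" where
  "after V \<eta> I [] = \<eta>"
| "after V \<eta> I (x # xs) = after V (execute V x (I (x, 0)) \<eta>) (pop x I) xs"

fun legal :: "'s set \<Rightarrow> 's set \<Rightarrow> ('s \<Rightarrow> site_state) \<Rightarrow> ('s \<times> nat \<Rightarrow> 's instruction) \<Rightarrow> 's list
    \<Rightarrow> bool" where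
  "legal V H \<eta> I [] = True"
| "legal V H \<eta> I (x # xs) \<longleftrightarrow>
     x \<in> V \<and> act H \<eta> x \<and> legal V H (execute V x (I (x, 0)) \<eta>) (pop x I) xs"

definition ends :: "'s set \<Rightarrow> 's set \<Rightarrow> ('s \<Rightarrow> site_state) \<Rightarrow> ('s \<times> nat \<Rightarrow> 's instruction)
    \<Rightarrow> 's list \<Rightarrow> bool" where
  "ends V H \<eta> I xs \<longleftrightarrow> legal V H \<eta> I xs \<and> stable V H (after V \<eta> I xs)"

lemma act_mono_hold: "act H \<eta> x \<Longrightarrow> act {} \<eta> x"
  by (auto simp: act_def split: if_splits)

lemma pop_commute: "pop x (pop y I) = pop y (pop x I)"
  by (auto simp: pop_def fun_eq_iff)

lemma pop_other [simp]: "z \<noteq> x \<Longrightarrow> pop x I (z, k) = I (z, k)"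
  by (simp add: pop_def)

lemma pop_same [simp]: "pop x I (x, k) = I (x, Suc k)"
  by (simp add: pop_def)

lemma act_execute_other:
  assumes "act H \<eta> x" "x \<noteq> y"
  shows "act H (execute V y i \<eta>) x"
  using assms by (cases i) (auto simp: act_def Let_def)

text \<open>The delicate case is a sleep at a lone particle in \<open>x\<close> against a jump from
  \<open>y\<close> onto \<open>x\<close>: either the sleeper is woken or the sleep attempt fails,
  and both orders leave two active particles.\<close>

lemma execute_commute:
  assumes "act {} \<eta> x" "act {} \<eta> y" "x \<noteq> y"
  shows "execute V x i (execute V y j \<eta>) = execute V y j (execute V x i \<eta>)"
proof -
  obtain m n where m: "\<eta> x = Active m" "m \<ge> 1" and n: "\<eta> y = Active n" "n \<ge> 1"
    using assms by (auto simp: act_def)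
  obtain m' n' where m': "m = Suc m'" and n': "n = Suc n'"
    using m n by (metis Suc_le_D One_nat_def)
  show ?thesis
    using m n m' n' assms(3)
    by (cases i; cases j) (auto simp: Let_def fun_eq_iff)
qed

text \<open>Topplings elsewhere leave \<open>x\<close> active and do not touch its stack, so the
  first toppling of \<open>x\<close> executes the same instruction wherever it stands. It passes the
  earlier topplings one by one by \<open>execute_commute\<close>.\<close>

lemma exchange:
  assumes "legal V H \<eta> I (as @ x # bs)" "x \<notin> set as" "act H \<eta> x"
  shows "legal V H \<eta> I (x # as @ bs) \<and> after V \<eta> I (x # as @ bs) = after V \<eta> I (as @ x # bs)"
  using assms
proof (induction as arbitrary: \<eta> I)
  case Nil
  then show ?case by simp
next
  case (Cons a as)
  have ax: "a \<noteq> x" and a: "a \<in> V" "act H \<eta> a" using Cons.prems by auto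
  let ?\<eta> = "execute V a (I (a, 0)) \<eta>"
  have "act H ?\<eta> x" using Cons.prems ax act_execute_other by metis
  then have IH: "legal V H ?\<eta> (pop a I) (x # as @ bs)"
    "after V ?\<eta> (pop a I) (x # as @ bs) = after V ?\<eta> (pop a I) (as @ x # bs)"
    using Cons.IH[of ?\<eta> "pop a I"] Cons.prems by auto
  have c: "execute V x (I (x, 0)) ?\<eta> = execute V a (I (a, 0)) (execute V x (I (x, 0)) \<eta>)"
    using execute_commute[of \<eta> x a] a(2) Cons.prems(3) ax act_mono_hold by metis
  show ?case
    using IH ax a c Cons.prems(3) act_execute_other[of H \<eta> a x V]
    by (auto simp: pop_commute[of x a])
qed

lemma act_after_other:
  assumes "act H \<eta> x" "x \<notin> set xs"
  shows "act H (after V \<eta> I xs) x"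
  using assms
  by (induction xs arbitrary: \<eta> I) (auto simp: act_execute_other)

lemma ends_move_front:
  assumes "ends V H \<eta> I ys" "x \<in> V" "act H \<eta> x"
  obtains zs where "ends V H (execute V x (I (x, 0)) \<eta>) (pop x I) zs"
    "mset ys = mset (x # zs)" "after V (execute V x (I (x, 0)) \<eta>) (pop x I) zs = after V \<eta> I ys"
proof -
  have "x \<in> set ys"
    using assms act_after_other[of H \<eta> x ys V I] by (auto simp: ends_def stable_def)
  then obtain as bs where ys: "ys = as @ x # bs" "x \<notin> set as"
    by (meson split_list_first)
  have e: "legal V H \<eta> I (x # as @ bs)" "after V \<eta> I (x # as @ bs) = after V \<eta> I ys"
    using exchange[of V H \<eta> I as x bs] assms ys by (auto simp: ends_def)
  show thesis
    by (rule that[of "as @ bs"]) (use e assms ys in \<open>auto simp: ends_def\<close>)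
qed

lemma ends_Cons:
  "ends V H \<eta> I (x # xs) \<longleftrightarrow>
     x \<in> V \<and> act H \<eta> x \<and> ends V H (execute V x (I (x, 0)) \<eta>) (pop x I) xs"
  by (auto simp: ends_def)

lemma ends_stable:
  assumes "stable V H \<eta>"
  shows "ends V H \<eta> I xs \<longleftrightarrow> xs = []"
  using assms by (cases xs) (auto simp: ends_def stable_def)

section \<open>Monotonicity and the least action principle\<close>

text \<open>Orders the site states as empty, one sleeping particle, one active particle, two active
  particles, and so on. In this order activity is upward closed, and executing an instruction at an
  active site is monotone.\<close>

fun rank :: "site_state \<Rightarrow> nat" where
  "rank Sleeping = 1"
| "rank (Active n) = (if n = 0 then 0 else Suc n)"

definition below :: "('s \<Rightarrow> site_state) \<Rightarrow> ('s \<Rightarrow> site_state) \<Rightarrow> bool" where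
  "below \<eta> \<eta>' \<longleftrightarrow> (\<forall>x. rank (\<eta> x) \<le> rank (\<eta>' x))"

lemma rank_add_mono: "rank s \<le> rank t \<Longrightarrow> rank (add_particle s) \<le> rank (add_particle t)"
  by (cases s; cases t) (auto split: if_splits)

lemma rank_add: "rank s \<le> rank (add_particle s)"
  by (cases s) auto

lemma act_mono:
  assumes "below \<eta> \<eta>'" "act H \<eta> x"
  shows "act H \<eta>' x"
proof -
  obtain n where n: "\<eta> x = Active n" "(if x \<in> H then 2 else 1) \<le> n"
    using assms(2) by (auto simp: act_def)
  have "rank (\<eta> x) \<le> rank (\<eta>' x)" using assms(1) by (auto simp: below_def)
  then show ?thesis using n by (cases "\<eta>' x") (auto simp: act_def split: if_splits)
qed

lemma below_execute:
  assumes "below \<eta> \<eta>'" "act {} \<eta> x" "V \<subseteq> V'"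
  shows "below (execute V x i \<eta>) (execute V' x i \<eta>')"
proof -
  obtain n where n: "\<eta> x = Active n" "1 \<le> n" using assms(2) by (auto simp: act_def)
  obtain n' where n': "\<eta>' x = Active n'" "1 \<le> n'"
    using act_mono[OF assms(1,2)] by (auto simp: act_def)
  have nn: "n \<le> n'" using assms(1) n n' by (auto simp: below_def dest: spec[of _ x])
  have own: "rank (remove_particle (\<eta> x)) \<le> rank (remove_particle (\<eta>' x))"
    "rank (fall_asleep (\<eta> x)) \<le> rank (fall_asleep (\<eta>' x))"
    using n n' nn by auto
  have b: "rank (\<eta> z) \<le> rank (\<eta>' z)" for z using assms(1) by (auto simp: below_def)
  show ?thesis
  proof (cases i)
    case Sleep
    then show ?thesis using own b by (auto simp: below_def)
  next
    case (Jump y)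
    show ?thesis
      using own b assms(3) rank_add_mono[OF own(1)] rank_add_mono[OF b[of y]]
        order_trans[OF own(1) rank_add] order_trans[OF b[of y] rank_add]
      by (auto simp: below_def Let_def Jump)
  qed
qed

text \<open>Least action principle. Each toppling of \<open>xs\<close> is also legal in the larger
  system, where it may be moved to the front of \<open>ys\<close>; it is then removed from both
  sequences. Uniqueness of the odometer and its monotonicity in the volume follow.\<close>

lemma legal_least:
  assumes "legal V H \<eta> I xs" "ends V' H \<eta>' I ys" "below \<eta> \<eta>'" "V \<subseteq> V'"
  shows "mset xs \<subseteq># mset ys"
  using assms
proof (induction xs arbitrary: \<eta> \<eta>' I ys)
  case Nil
  then show ?case by simp
next
  case (Cons x xs)
  have x: "x \<in> V" "act H \<eta> x" using Cons.prems by auto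
  have x': "act H \<eta>' x" by (rule act_mono[OF Cons.prems(3) x(2)])
  obtain zs where zs: "ends V' H (execute V' x (I (x, 0)) \<eta>') (pop x I) zs"
    "mset ys = mset (x # zs)"
    using ends_move_front[OF Cons.prems(2) _ x'] Cons.prems(4) x(1) by blast
  have l: "legal V H (execute V x (I (x, 0)) \<eta>) (pop x I) xs" using Cons.prems(1) by simp
  have b: "below (execute V x (I (x, 0)) \<eta>) (execute V' x (I (x, 0)) \<eta>')"
    by (rule below_execute[OF Cons.prems(3) act_mono_hold[OF x(2)] Cons.prems(4)])
  have "mset xs \<subseteq># mset zs" by (rule Cons.IH[OF l zs(1) b Cons.prems(4)])
  then show ?case using zs(2) by simp
qed

lemma below_refl [simp]: "below \<eta> \<eta>" by (simp add: below_def)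

lemma count_list_mset: "count_list xs z = count (mset xs) z"
  by (induction xs) auto

lemma ends_unique_count:
  assumes "ends V H \<eta> I xs" "ends V H \<eta> I ys"
  shows "count_list xs = count_list ys"
proof -
  have "mset xs = mset ys"
    using legal_least[of V H \<eta> I xs V \<eta> ys] legal_least[of V H \<eta> I ys V \<eta> xs] assms
    by (auto simp: ends_def intro: subset_mset.antisym)
  then show ?thesis by (auto simp: count_list_mset)
qed

lemma ends_le:
  assumes "ends V H \<eta> I xs" "ends V' H \<eta>' I ys" "below \<eta> \<eta>'" "V \<subseteq> V'"
  shows "count_list xs z \<le> count_list ys z"
  using legal_least[of V H \<eta> I xs V' \<eta>' ys] assms
  by (auto simp: count_list_mset ends_def mset_subset_eq_count)

text \<open>Legal sequences in the smaller system are at most as long as \<open>ys\<close>, and a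
  longest one cannot be extended, so it has stabilized.\<close>

lemma finite_legal_extends:
  assumes "ends V' H \<eta>' I ys" "below \<eta> \<eta>'" "V \<subseteq> V'"
  shows "\<exists>xs. ends V H \<eta> I xs"
proof -
  let ?P = "\<lambda>xs. legal V H \<eta> I xs"
  have "length xs \<le> length ys" if "?P xs" for xs
    using legal_least[OF that assms] size_mset_mono by fastforce
  moreover have "?P []" by simp
  ultimately obtain xs where xs: "?P xs" "\<And>zs. ?P zs \<Longrightarrow> length zs \<le> length xs"
    using ex_has_greatest_nat[of ?P "[]" length "Suc (length ys)"] by (auto simp: less_Suc_eq_le)
  have snoc: "legal V H \<eta> I (xs @ [x])"
    if "legal V H \<eta> I xs" "x \<in> V" "act H (after V \<eta> I xs) x" for x \<eta> I and xs :: "'a list"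
    using that by (induction xs arbitrary: \<eta> I) auto
  have "stable V H (after V \<eta> I xs)"
    using snoc[OF xs(1)] xs(2) by (fastforce simp: stable_def)
  then show ?thesis using xs by (auto simp: ends_def)
qed

section \<open>Agreement with the toppling relation and the odometer of the model\<close>

fun popl :: "'s list \<Rightarrow> ('s \<times> nat \<Rightarrow> 'i) \<Rightarrow> 's \<times> nat \<Rightarrow> 'i" where
  "popl [] I = I"
| "popl (x # xs) I = popl xs (pop x I)"

lemma popl_eq: "popl xs I (z, k) = I (z, k + count_list xs z)"
  by (induction xs arbitrary: I k) (auto simp: pop_def)

lemma legal_snoc:
  "legal V H \<eta> I (xs @ [x]) \<longleftrightarrow> legal V H \<eta> I xs \<and> x \<in> V \<and> act H (after V \<eta> I xs) x"
  by (induction xs arbitrary: \<eta> I) auto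

lemma after_snoc:
  "after V \<eta> I (xs @ [x]) = execute V x (popl xs I (x, 0)) (after V \<eta> I xs)"
  by (induction xs arbitrary: \<eta> I) auto

lemma has_active_iff: "has_active (\<eta> x) \<longleftrightarrow> act {} \<eta> x"
  by (auto simp: has_active_def act_def)

text \<open>\<open>topples_to\<close> appends topplings at the end and addresses instructions by
  index, while \<open>legal\<close> and \<open>after\<close> consume them from the front. By
  \<open>popl_eq\<close> both read the same instruction.\<close>

lemma topples_to_iff:
  "topples_to V \<sigma> I \<eta> h \<longleftrightarrow>
     (\<exists>xs. legal V {} (restrict_config V \<sigma>) I xs \<and> \<eta> = after V (restrict_config V \<sigma>) I xs
        \<and> h = count_list xs)" (is "_ \<longleftrightarrow> ?R \<eta> h")
proof
  assume "topples_to V \<sigma> I \<eta> h"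
  then show "?R \<eta> h"
  proof induction
    case start
    show ?case by (rule exI[of _ "[]"]) auto
  next
    case (topple \<eta> h x)
    then obtain xs where xs: "legal V {} (restrict_config V \<sigma>) I xs"
      "\<eta> = after V (restrict_config V \<sigma>) I xs" "h = count_list xs" by auto
    have "count_list (xs @ [x]) = h(x := Suc (h x))" using xs(3) by (auto simp: fun_eq_iff)
    then show ?case
      using xs topple by (intro exI[of _ "xs @ [x]"])
        (auto simp: legal_snoc after_snoc popl_eq has_active_iff)
  qed
next
  have "topples_to V \<sigma> I (after V (restrict_config V \<sigma>) I xs) (count_list xs)"
    if "legal V {} (restrict_config V \<sigma>) I xs" for xs
    using that
  proof (induction xs rule: rev_induct)
    case Nil
    have "count_list ([] :: 'a list) = (\<lambda>_. 0)" by auto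
    then show ?case using start[of V \<sigma> I] by simp
  next
    case (snoc x xs)
    then have t: "topples_to V \<sigma> I (after V (restrict_config V \<sigma>) I xs) (count_list xs)"
      "x \<in> V" "act {} (after V (restrict_config V \<sigma>) I xs) x" by (auto simp: legal_snoc)
    have c: "count_list (xs @ [x]) = (count_list xs)(x := Suc (count_list xs x))"
      by (auto simp: fun_eq_iff)
    show ?case using topple[OF t(1,2)] t(3) unfolding has_active_iff c
      by (simp add: after_snoc popl_eq fun_upd_def)
  qed
  then show "?R \<eta> h \<Longrightarrow> topples_to V \<sigma> I \<eta> h" by auto
qed

lemma stabilizes_with_iff:
  "stabilizes_with V \<sigma> I h \<longleftrightarrow> (\<exists>xs. ends V {} (restrict_config V \<sigma>) I xs \<and> h = count_list xs)"
  by (auto simp: stabilizes_with_def topples_to_iff ends_def stable_def has_active_iff)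

lemma odometer_eq:
  assumes "ends V {} (restrict_config V \<sigma>) I xs"
  shows "odometer V \<sigma> I x = enat (count_list xs x)"
proof -
  have "stabilizes_with V \<sigma> I h \<longleftrightarrow> h = count_list xs" for h
    using assms ends_unique_count by (auto simp: stabilizes_with_iff)
  then have "stabilizes_with V \<sigma> I = (\<lambda>h. h = count_list xs)" by (intro ext)
  then show ?thesis by (simp add: odometer_def)
qed

lemma odometer_infinite:
  assumes "\<nexists>xs. ends V {} (restrict_config V \<sigma>) I xs"
  shows "odometer V \<sigma> I x = \<infinity>"
  using assms by (auto simp: odometer_def stabilizes_with_iff)

lemma below_restrict_config: "V \<subseteq> V' \<Longrightarrow> below (restrict_config V \<sigma>) (restrict_config V' \<sigma>)"
  by (auto simp: below_def restrict_config_def)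

lemma odometer_mono:
  assumes "V \<subseteq> V'"
  shows "odometer V \<sigma> I x \<le> odometer V' \<sigma> I x"
proof (cases "\<exists>ys. ends V' {} (restrict_config V' \<sigma>) I ys")
  case True
  then obtain ys where ys: "ends V' {} (restrict_config V' \<sigma>) I ys" by auto
  then obtain xs where xs: "ends V {} (restrict_config V \<sigma>) I xs"
    using finite_legal_extends below_restrict_config assms by blast
  show ?thesis
    using ends_le[OF xs ys below_restrict_config[OF assms] assms] xs ys by (simp add: odometer_eq)
next
  case False
  then show ?thesis by (simp add: odometer_infinite)
qed

section \<open>Laws of stabilization outcomes\<close>

text \<open>Countability allows conditioning on the value of the next instruction in the
  measurability proofs.\<close>

instance instruction :: (countable) countable
  by countable_datatype

definition avg :: "int ^ 'd::finite \<Rightarrow> (int ^ 'd \<Rightarrow> real) \<Rightarrow> real" where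
  "avg x f = (\<Sum>y\<in>neighbors x. f y) / (2 * real CARD('d))"

lemma avg_mono: "(\<And>y. y \<in> neighbors x \<Longrightarrow> f y \<le> g y) \<Longrightarrow> avg x f \<le> avg x g"
  by (auto simp: avg_def divide_right_mono sum_mono)

lemma avg_cong: "(\<And>y. y \<in> neighbors x \<Longrightarrow> f y = g y) \<Longrightarrow> avg x f = avg x g"
  by (auto simp: avg_def)

lemma avg_const [simp]: "avg x (\<lambda>_. c) = c"
  by (simp add: avg_def card_neighbors)

lemma avg_add: "avg x (\<lambda>y. f y + g y) = avg x f + avg x g"
  by (simp add: avg_def sum.distrib add_divide_distrib)

lemma avg_diff: "avg x (\<lambda>y. f y - g y) = avg x f - avg x g"
  by (simp add: avg_def sum_subtractf diff_divide_distrib)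

lemma avg_cmult: "avg x (\<lambda>y. c * f y) = c * avg x f"
  by (simp add: avg_def sum_distrib_left[symmetric])

lemma avg_sum: "avg x (\<lambda>y. \<Sum>z\<in>A. f z y) = (\<Sum>z\<in>A. avg x (f z))"
  unfolding avg_def by (subst sum.swap) (simp add: sum_divide_distrib)

lemma neighbors_sym: "y \<in> neighbors x \<longleftrightarrow> x \<in> neighbors y"
  by (simp add: neighbors_def abs_minus_commute)

lemma not_neighbor_self [simp]: "x \<notin> neighbors x"
  by (simp add: neighbors_def)

locale arw =
  fixes lam :: real
  assumes lam_pos: "lam > 0"
begin

abbreviation "ps \<equiv> sleep_prob lam"
abbreviation "pj \<equiv> jump_prob lam"

lemma ps_pos: "ps > 0" and pj_pos: "pj > 0" and ps_pj: "ps + pj = 1"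
  using lam_pos by (auto simp: sleep_prob_def jump_prob_def field_simps)

lemma pj_eq: "pj = 1 - ps" using ps_pj by simp

text \<open>Expectation of \<open>F\<close> under the law of one instruction at
  \<open>x\<close>.\<close>

definition ev :: "int ^ 'd::finite \<Rightarrow> ((int ^ 'd) instruction \<Rightarrow> real) \<Rightarrow> real" where
  "ev x F = ps * F Sleep + pj * avg x (\<lambda>y. F (Jump y))"

lemma ev_mono:
  assumes "F Sleep \<le> G Sleep" "\<And>y. y \<in> neighbors x \<Longrightarrow> F (Jump y) \<le> G (Jump y)"
  shows "ev x F \<le> ev x G"
  unfolding ev_def using assms ps_pos pj_pos by (intro add_mono mult_left_mono avg_mono) auto

lemma ev_cong:
  assumes "F Sleep = G Sleep" "\<And>y. y \<in> neighbors x \<Longrightarrow> F (Jump y) = G (Jump y)"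
  shows "ev x F = ev x G"
  unfolding ev_def using assms avg_cong by metis

lemma ev_const [simp]: "ev x (\<lambda>_. c) = c"
  using ps_pj by (simp add: ev_def flip: distrib_right)

lemma ev_add: "ev x (\<lambda>i. f i + g i) = ev x f + ev x g"
  by (simp add: ev_def avg_add algebra_simps)

lemma ev_diff: "ev x (\<lambda>i. f i - g i) = ev x f - ev x g"
  by (simp add: ev_def avg_diff algebra_simps)

lemma ev_cmult: "ev x (\<lambda>i. c * f i) = c * ev x f"
  by (simp add: ev_def avg_cmult algebra_simps)

lemma ev_sum: "ev x (\<lambda>i. \<Sum>z\<in>A. f z i) = (\<Sum>z\<in>A. ev x (f z))"
  by (simp add: ev_def avg_sum sum.distrib sum_distrib_left)

abbreviation law :: "((int ^ 'd::finite) \<times> nat \<Rightarrow> (int ^ 'd) instruction) measure" where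
  "law \<equiv> instruction_measure lam"

lemma space_law [simp]: "space law = UNIV"
  by (auto simp: instruction_measure_def space_PiM case_prod_beta)

lemma prob_space_law: "prob_space law"
  unfolding instruction_measure_def
  by (rule prob_space_PiM) (auto simp: prob_space_measure_pmf)

sublocale law: prob_space law by (rule prob_space_law)

lemma law_UNIV [simp]: "measure law UNIV = 1"
  using law.prob_space[unfolded space_law] .

lemma measurable_instruction [measurable]: "(\<lambda>I. I c) \<in> law \<rightarrow>\<^sub>M count_space UNIV"
proof -
  have "(\<lambda>I. I c) \<in> law \<rightarrow>\<^sub>M (\<lambda>(x, k). measure_pmf (instruction_pmf lam x)) c"
    unfolding instruction_measure_def by (rule measurable_component_singleton) simp
  also have "\<dots> = law \<rightarrow>\<^sub>M count_space UNIV"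
    by (rule measurable_cong_sets) (auto simp: case_prod_beta)
  finally show ?thesis .
qed

lemma measurable_law_iff:
  fixes f :: "'a \<Rightarrow> (int ^ 'd::finite) \<times> nat \<Rightarrow> (int ^ 'd) instruction"
  assumes "\<And>c. (\<lambda>\<omega>. f \<omega> c) \<in> M \<rightarrow>\<^sub>M count_space UNIV"
  shows "f \<in> M \<rightarrow>\<^sub>M law"
proof -
  have "(\<lambda>\<omega> c. f \<omega> c) \<in> M \<rightarrow>\<^sub>M law"
    unfolding instruction_measure_def
  proof (rule measurable_PiM_single')
    fix c :: "(int ^ 'd) \<times> nat"
    have "M \<rightarrow>\<^sub>M (case c of (x, k) \<Rightarrow> measure_pmf (instruction_pmf lam x)) = M \<rightarrow>\<^sub>M count_space UNIV"
      by (rule measurable_cong_sets) (auto simp: case_prod_beta)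
    then show "(\<lambda>\<omega>. f \<omega> c) \<in> M \<rightarrow>\<^sub>M (case c of (x, k) \<Rightarrow> measure_pmf (instruction_pmf lam x))"
      using assms by simp
  qed (auto simp: case_prod_beta)
  then show ?thesis by simp
qed

lemma measurable_pop [measurable]: "pop x \<in> law \<rightarrow>\<^sub>M law"
  by (rule measurable_law_iff) (auto simp: pop_def split: prod.splits)

text \<open>The instruction at \<open>(x, 0)\<close> is independent of the others, and popping it
  leaves a field with the original law. Thus one may execute the first instruction at
  \<open>x\<close> and start afresh.\<close>

lemma law_fresh:
  fixes x :: "int ^ 'd::finite"
  assumes A: "\<And>i. A i \<in> sets law"
  shows "measure law {I. pop x I \<in> A (I (x, 0))} = ev x (\<lambda>i. measure law (A i))"
proof -
  define \<mu> :: "(int ^ 'd) \<times> nat \<Rightarrow> (int ^ 'd) instruction measure"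
    where "\<mu> = (\<lambda>(x, k). measure_pmf (instruction_pmf lam x))"
  define K where "K = UNIV - {(x, 0 :: nat)}"
  define \<phi> where "\<phi> = (\<lambda>(z, k). (z :: int ^ 'd, if z = x then Suc k else k))"
  \<comment> \<open>\<open>\<phi>\<close> keeps the site and instruction laws depend on the site
    only. As \<open>\<phi>\<close> is also injective and avoids \<open>(x, 0)\<close>, reindexing
    along it preserves the product law.\<close>
  have mu_phi: "(\<lambda>c. \<mu> (\<phi> c)) = \<mu>" by (auto simp: \<mu>_def \<phi>_def)
  have law_eq: "law = PiM UNIV \<mu>" by (simp add: instruction_measure_def \<mu>_def)
  have ps: "prob_space (\<mu> c)" for c
    by (auto simp: \<mu>_def case_prod_beta prob_space_measure_pmf)
  interpret K: prob_space "PiM K \<mu>" by (rule prob_space_PiM) (rule ps)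
  interpret X: prob_space "\<mu> (x, 0)" by (rule ps)
  interpret XK: pair_prob_space "\<mu> (x, 0)" "PiM K \<mu>" ..
  have ins: "insert (x, 0) K = UNIV" by (auto simp: K_def)
  have D1: "distr (\<mu> (x, 0) \<Otimes>\<^sub>M PiM K \<mu>) law (\<lambda>(i, X). X((x, 0) := i)) = law"
    using distr_pair_PiM_eq_PiM[of K \<mu> "(x, 0)"] ps unfolding ins law_eq by blast
  have M1: "(\<lambda>(i, X). X((x, 0) := i)) \<in> \<mu> (x, 0) \<Otimes>\<^sub>M PiM K \<mu> \<rightarrow>\<^sub>M law"
    unfolding law_eq ins[symmetric] by measurable
  have "inj \<phi>" "\<phi> \<in> UNIV \<rightarrow> K" by (auto simp: inj_def \<phi>_def K_def split: if_splits)
  then have D2: "distr (PiM K \<mu>) law (\<lambda>\<omega>. \<omega> \<circ> \<phi>) = law"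
    using distr_PiM_reindex[of K \<mu> \<phi> UNIV] ps unfolding law_eq mu_phi by (simp add: comp_def restrict_def)
  have M2: "(\<lambda>\<omega>. \<omega> \<circ> \<phi>) \<in> PiM K \<mu> \<rightarrow>\<^sub>M law"
  proof (rule measurable_law_iff)
    fix c
    have "\<phi> c \<in> K" using \<open>\<phi> \<in> UNIV \<rightarrow> K\<close> by auto
    then have "(\<lambda>\<omega>. \<omega> (\<phi> c)) \<in> PiM K \<mu> \<rightarrow>\<^sub>M \<mu> (\<phi> c)"
      by (rule measurable_component_singleton)
    also have "\<dots> = PiM K \<mu> \<rightarrow>\<^sub>M count_space UNIV"
      by (rule measurable_cong_sets) (auto simp: case_prod_beta \<mu>_def)
    finally show "(\<lambda>\<omega>. (\<omega> \<circ> \<phi>) c) \<in> PiM K \<mu> \<rightarrow>\<^sub>M count_space UNIV" by simp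
  qed
  have S [measurable]: "{I. pop x I \<in> A (I (x, 0))} \<in> sets law"
  proof -
    have "(\<lambda>I. pop x I \<in> A (I (x, 0))) \<in> law \<rightarrow>\<^sub>M count_space UNIV"
    proof (rule measurable_compose_countable[where f = "\<lambda>i I. pop x I \<in> A i"])
      show "Measurable.pred law (\<lambda>I. pop x I \<in> A i)" for i using A by measurable
    qed measurable
    then show ?thesis by (simp add: pred_def)
  qed
  have pop_upd: "pop x (X((x, 0) := i)) = X \<circ> \<phi>" for X i
    by (auto simp: pop_def \<phi>_def fun_eq_iff)
  have "emeasure law {I. pop x I \<in> A (I (x, 0))}
      = emeasure (distr (\<mu> (x, 0) \<Otimes>\<^sub>M PiM K \<mu>) law (\<lambda>(i, X). X((x, 0) := i)))
          {I. pop x I \<in> A (I (x, 0))}"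
    by (simp add: D1)
  also have "\<dots> = emeasure (\<mu> (x, 0) \<Otimes>\<^sub>M PiM K \<mu>)
      ((\<lambda>(i, X). X((x, 0) := i)) -` {I. pop x I \<in> A (I (x, 0))} \<inter> space (\<mu> (x, 0) \<Otimes>\<^sub>M PiM K \<mu>))"
    using M1 S by (rule emeasure_distr)
  also have "\<dots> = (\<integral>\<^sup>+ i. emeasure (PiM K \<mu>) (Pair i -` ((\<lambda>(i, X). X((x, 0) := i)) -`
      {I. pop x I \<in> A (I (x, 0))} \<inter> space (\<mu> (x, 0) \<Otimes>\<^sub>M PiM K \<mu>))) \<partial>\<mu> (x, 0))"
    by (rule K.emeasure_pair_measure_alt[OF measurable_sets[OF M1 S]])
  also have "\<dots> = (\<integral>\<^sup>+ i. emeasure (PiM K \<mu>) ((\<lambda>\<omega>. \<omega> \<circ> \<phi>) -` A i \<inter> space (PiM K \<mu>)) \<partial>\<mu> (x, 0))"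
    by (intro nn_integral_cong arg_cong[where f = "emeasure _"])
      (auto simp: space_pair_measure pop_upd)
  also have "\<dots> = (\<integral>\<^sup>+ i. emeasure law (A i) \<partial>\<mu> (x, 0))"
    using emeasure_distr[OF M2 A] by (simp add: D2)
  also have "\<dots> = (\<integral>\<^sup>+ i. ennreal (measure law (A i)) \<partial>measure_pmf (instruction_pmf lam x))"
    by (simp add: law.emeasure_eq_measure \<mu>_def)
  also have "\<dots> = ennreal (\<integral> i. measure law (A i) \<partial>measure_pmf (instruction_pmf lam x))"
    by (intro nn_integral_eq_integral measure_pmf.integrable_const_bound[where B = 1]) auto
  finally have "measure law {I. pop x I \<in> A (I (x, 0))}
      = (\<integral> i. measure law (A i) \<partial>measure_pmf (instruction_pmf lam x))"
    by (simp add: law.emeasure_eq_measure)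
  also have "\<dots> = (\<Sum>i\<in>insert Sleep (Jump ` neighbors x).
      pmf (instruction_pmf lam x) i *\<^sub>R measure law (A i))"
  proof (rule integral_measure_pmf)
    fix i assume "i \<in> set_pmf (instruction_pmf lam x)"
    then have "pmf (instruction_pmf lam x) i \<noteq> 0" by (simp add: set_pmf_iff)
    then show "i \<in> insert Sleep (Jump ` neighbors x)"
      using pmf_instruction(2)[OF lam_pos, of x] by (cases i) (auto split: if_splits)
  qed (simp add: finite_neighbors)
  also have "\<dots> = ev x (\<lambda>i. measure law (A i))"
    by (subst sum.insert)
      (auto simp: finite_neighbors sum.reindex inj_on_def pmf_instruction[OF lam_pos] ev_def avg_def
        sum_distrib_left sum_divide_distrib)
  finally show ?thesis .
qed

text \<open>Instruction fields on which stabilization never ends belong to no outcome, whatever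
  \<open>Q\<close> is. Almost sure termination is not assumed; where it is needed it comes out of
  the maximum principle.\<close>

definition outcome :: "(int ^ 'd::finite) set \<Rightarrow> (int ^ 'd) set
    \<Rightarrow> ((int ^ 'd \<Rightarrow> nat) \<Rightarrow> (int ^ 'd \<Rightarrow> site_state) \<Rightarrow> bool) \<Rightarrow> (int ^ 'd \<Rightarrow> site_state)
    \<Rightarrow> ((int ^ 'd) \<times> nat \<Rightarrow> (int ^ 'd) instruction) set" where
  "outcome V H Q \<eta> = {I. \<exists>xs. ends V H \<eta> I xs \<and> Q (count_list xs) (after V \<eta> I xs)}"

definition pr :: "(int ^ 'd::finite) set \<Rightarrow> (int ^ 'd) set
    \<Rightarrow> ((int ^ 'd \<Rightarrow> nat) \<Rightarrow> (int ^ 'd \<Rightarrow> site_state) \<Rightarrow> bool) \<Rightarrow> (int ^ 'd \<Rightarrow> site_state) \<Rightarrow> real" where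
  "pr V H Q \<eta> = measure law (outcome V H Q \<eta>)"

lemma pred_ends: "Measurable.pred law (\<lambda>I. ends V H \<eta> I xs \<and> Q (after V \<eta> I xs))"
proof (induction xs arbitrary: \<eta>)
  case Nil
  then show ?case by (simp add: ends_def)
next
  case (Cons x xs)
  have "Measurable.pred law (\<lambda>I. ends V H (execute V x (I (x, 0)) \<eta>) (pop x I) xs
      \<and> Q (after V (execute V x (I (x, 0)) \<eta>) (pop x I) xs))"
  proof (rule measurable_compose_countable[where f = "\<lambda>i I. ends V H (execute V x i \<eta>) (pop x I) xs
      \<and> Q (after V (execute V x i \<eta>) (pop x I) xs)"])
    show "Measurable.pred law (\<lambda>I. ends V H (execute V x i \<eta>) (pop x I) xs
      \<and> Q (after V (execute V x i \<eta>) (pop x I) xs))" for i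
      using measurable_compose[OF measurable_pop Cons.IH[of "execute V x i \<eta>"]] .
  qed measurable
  then have "Measurable.pred law (\<lambda>I. (x \<in> V \<and> act H \<eta> x) \<and>
      (ends V H (execute V x (I (x, 0)) \<eta>) (pop x I) xs
      \<and> Q (after V (execute V x (I (x, 0)) \<eta>) (pop x I) xs)))"
    by measurable
  then show ?case by (simp add: ends_Cons conj_assoc)
qed

lemma sets_outcome [measurable]: "outcome V H Q \<eta> \<in> sets law"
proof -
  have "Measurable.pred law (\<lambda>I. \<exists>xs. ends V H \<eta> I xs \<and> Q (count_list xs) (after V \<eta> I xs))"
    using pred_ends[of V H \<eta> _ "Q _"] by measurable
  then show ?thesis by (simp add: pred_def outcome_def)
qed

lemma pr_nonneg [simp]: "0 \<le> pr V H Q \<eta>" and pr_le_1 [simp]: "pr V H Q \<eta> \<le> 1"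
  by (simp_all add: pr_def)

lemma pr_stable:
  fixes \<eta> :: "int ^ 'd::finite \<Rightarrow> site_state"
  assumes "stable V H \<eta>"
  shows "pr V H Q \<eta> = of_bool (Q (\<lambda>_. 0) \<eta>)"
proof -
  have "count_list ([] :: (int ^ 'd) list) = (\<lambda>_. 0)" by auto
  then have "outcome V H Q \<eta> = (if Q (\<lambda>_. 0) \<eta> then UNIV else {})"
    using assms by (auto simp: outcome_def ends_stable)
  then show ?thesis by (simp add: pr_def)
qed

text \<open>By the abelian property the sequence may be taken to begin with \<open>x\<close>, and by
  \<open>law_fresh\<close> the rest is a stabilization under fresh instructions. The shift of
  \<open>Q\<close> records the toppling already made.\<close>

lemma pr_step:
  assumes x: "x \<in> V" "act H \<eta> x"
  shows "pr V H Q \<eta> = ev x (\<lambda>i. pr V H (\<lambda>h. Q (h(x := Suc (h x)))) (execute V x i \<eta>))"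
proof -
  let ?Q = "\<lambda>h. Q (h(x := Suc (h x)))"
  have count: "(count_list xs)(x := Suc (count_list xs x)) = count_list (x # xs)" for xs
    by (auto simp: fun_eq_iff)
  have "outcome V H Q \<eta> = {I. pop x I \<in> outcome V H ?Q (execute V x (I (x, 0)) \<eta>)}"
  proof safe
    fix I assume "I \<in> outcome V H Q \<eta>"
    then obtain xs where xs: "ends V H \<eta> I xs" "Q (count_list xs) (after V \<eta> I xs)"
      by (auto simp: outcome_def)
    obtain zs where zs: "ends V H (execute V x (I (x, 0)) \<eta>) (pop x I) zs"
      "mset xs = mset (x # zs)" "after V (execute V x (I (x, 0)) \<eta>) (pop x I) zs = after V \<eta> I xs"
      using ends_move_front[OF xs(1) x] .
    have "count_list xs = count_list (x # zs)"
      using zs(2) by (simp only: count_list_mset fun_eq_iff) simp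
    then show "pop x I \<in> outcome V H ?Q (execute V x (I (x, 0)) \<eta>)"
      using zs xs(2) unfolding outcome_def count by auto
  next
    fix I assume "pop x I \<in> outcome V H ?Q (execute V x (I (x, 0)) \<eta>)"
    then obtain xs where "ends V H (execute V x (I (x, 0)) \<eta>) (pop x I) xs"
      "Q (count_list (x # xs)) (after V (execute V x (I (x, 0)) \<eta>) (pop x I) xs)"
      unfolding outcome_def count by auto
    then show "I \<in> outcome V H Q \<eta>"
      using x unfolding outcome_def
      by (intro CollectI exI[of _ "x # xs"]) (auto simp: ends_Cons)
  qed
  then show ?thesis
    using law_fresh[of "\<lambda>i. outcome V H ?Q (execute V x i \<eta>)" x] by (simp add: pr_def)
qed

end

section \<open>The maximum principle\<close>

fun cnt :: "site_state \<Rightarrow> nat" where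
  "cnt Sleeping = 1"
| "cnt (Active n) = n"

definition wt :: "'s set \<Rightarrow> ('s \<Rightarrow> real) \<Rightarrow> ('s \<Rightarrow> site_state) \<Rightarrow> real" where
  "wt V f \<eta> = (\<Sum>z\<in>V. f z * real (cnt (\<eta> z)))"

definition mass :: "'s set \<Rightarrow> ('s \<Rightarrow> site_state) \<Rightarrow> nat" where
  "mass V \<eta> = (\<Sum>z\<in>V. cnt (\<eta> z))"

lemma cnt_add [simp]: "cnt (add_particle s) = Suc (cnt s)"
  by (cases s) auto

lemma wt_upd:
  assumes "finite V" "x \<in> V"
  shows "wt V f (\<eta>(x := s)) = wt V f \<eta> - f x * cnt (\<eta> x) + f x * cnt s"
proof -
  have "wt V f (\<eta>(x := s)) = f x * cnt s + (\<Sum>z\<in>V - {x}. f z * cnt (\<eta> z))"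
    unfolding wt_def by (subst sum.remove[OF assms]) auto
  moreover have "wt V f \<eta> = f x * cnt (\<eta> x) + (\<Sum>z\<in>V - {x}. f z * cnt (\<eta> z))"
    unfolding wt_def by (subst sum.remove[OF assms]) auto
  ultimately show ?thesis by simp
qed

lemma wt_add_particle:
  assumes "finite V" "x \<in> V"
  shows "wt V f (\<eta>(x := add_particle (\<eta> x))) = wt V f \<eta> + f x"
  using assms by (simp add: wt_upd algebra_simps)

lemma wt_Sleep:
  assumes "finite V" "x \<in> V" "act {} \<eta> x"
  shows "wt V f (execute V x Sleep \<eta>) = wt V f \<eta>"
  using assms by (auto simp: wt_upd act_def split: if_splits)

lemma wt_Jump:
  assumes "finite V" "x \<in> V" "act {} \<eta> x" "\<And>z. z \<notin> V \<Longrightarrow> f z = 0"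
  shows "wt V f (execute V x (Jump y) \<eta>) = wt V f \<eta> - f x + f y"
proof -
  obtain n where n: "\<eta> x = Active n" "n \<ge> 1" using assms(3) by (auto simp: act_def)
  have r: "wt V f (\<eta>(x := remove_particle (\<eta> x))) = wt V f \<eta> - f x"
    using assms(1,2) n by (simp add: wt_upd of_nat_diff algebra_simps)
  show ?thesis
    using assms r wt_add_particle[OF assms(1), of y f "\<eta>(x := remove_particle (\<eta> x))"]
    by (auto simp: Let_def)
qed

lemma mass_execute:
  assumes "finite V" "x \<in> V" "act {} \<eta> x"
  shows "mass V (execute V x i \<eta>) \<le> mass V \<eta>"
proof -
  let ?f = "\<lambda>z. of_bool (z \<in> V) :: real"
  have m: "real (mass V \<zeta>) = wt V ?f \<zeta>" for \<zeta> by (simp add: mass_def wt_def)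
  have "wt V ?f (execute V x i \<eta>) \<le> wt V ?f \<eta>"
  proof (cases i)
    case Sleep
    then show ?thesis using wt_Sleep[OF assms, of ?f] by simp
  next
    case (Jump y)
    then show ?thesis using assms wt_Jump[of V x \<eta> ?f y] by simp
  qed
  then show ?thesis unfolding m[symmetric] by simp
qed

lemma cnt_le_mass: "finite V \<Longrightarrow> z \<in> V \<Longrightarrow> cnt (\<eta> z) \<le> mass V \<eta>"
  unfolding mass_def by (rule member_le_sum) auto

lemma wt_bound:
  assumes "finite V"
  shows "\<bar>wt V f \<eta>\<bar> \<le> (\<Sum>z\<in>V. \<bar>f z\<bar>) * mass V \<eta>"
proof -
  have "\<bar>wt V f \<eta>\<bar> \<le> (\<Sum>z\<in>V. \<bar>f z * cnt (\<eta> z)\<bar>)" unfolding wt_def by (rule sum_abs)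
  also have "\<dots> \<le> (\<Sum>z\<in>V. \<bar>f z\<bar> * mass V \<eta>)"
    using assms by (intro sum_mono) (auto simp: abs_mult intro!: mult_left_mono cnt_le_mass)
  finally show ?thesis by (simp add: sum_distrib_right)
qed

lemma wt_nonneg: "(\<And>z. z \<in> V \<Longrightarrow> 0 \<le> f z) \<Longrightarrow> 0 \<le> wt V f \<eta>"
  unfolding wt_def by (intro sum_nonneg) auto

lemma avg_eq:
  fixes x :: "int ^ 'd::finite"
  shows "avg x f = (\<Sum>i\<in>UNIV. f (x + axis i 1) + f (x + axis i (-1))) / (2 * real CARD('d))"
proof -
  have inj: "inj_on (\<lambda>(i, s). x + axis i s) (UNIV \<times> {1, -1 :: int})"
    by (auto simp: inj_on_def axis_eq_axis)
  show ?thesis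
    unfolding avg_def neighbors_eq
    by (subst sum.reindex[OF inj]) (simp add: sum.cartesian_product')
qed

text \<open>A quadratic in a single coordinate \<open>k\<close>: a step changes that coordinate with
  probability \<open>1 / d\<close>, and then its square grows by 1 on average, so the factor
  \<open>d\<close> gives a drop of exactly 1. Cutting off outside \<open>V\<close> only lowers the
  averages, because \<open>q\<close> is still nonnegative at neighbors of \<open>V\<close>.\<close>

lemma exit_potential:
  fixes V :: "(int ^ 'd::finite) set"
  assumes "finite V"
  obtains g :: "int ^ 'd \<Rightarrow> real" where "\<And>z. 0 \<le> g z" "\<And>z. z \<notin> V \<Longrightarrow> g z = 0"
    "\<And>x. x \<in> V \<Longrightarrow> avg x g \<le> g x - 1"
proof -
  define k :: 'd where "k = undefined"
  let ?d = "real CARD('d)"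
  define R :: int where "R = Max (insert 0 ((\<lambda>x. \<bar>x $ k\<bar>) ` V))"
  have R: "\<bar>x $ k\<bar> \<le> R" if "x \<in> V" for x using that assms by (auto simp: R_def)
  define q :: "int ^ 'd \<Rightarrow> real" where "q x = ?d * ((of_int R + 1)\<^sup>2 - (of_int (x $ k))\<^sup>2)" for x
  define g where "g x = (if x \<in> V then q x else 0)" for x
  have q0: "0 \<le> q x" if "\<bar>x $ k\<bar> \<le> R + 1" for x
  proof -
    have "\<bar>of_int (x $ k) :: real\<bar> \<le> of_int R + 1" using that by linarith
    then have "(of_int (x $ k) :: real)\<^sup>2 \<le> (of_int R + 1)\<^sup>2" by (simp add: abs_le_square_iff[symmetric])
    then show ?thesis by (simp add: q_def)
  qed
  have nb: "\<bar>y $ k\<bar> \<le> R + 1" if "y \<in> neighbors x" "x \<in> V" for x y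
    using that R[of x] by (auto simp: neighbors_eq axis_def)
  have avg_q: "avg x q = q x - 1" for x
  proof -
    have "q (x + axis i 1) + q (x + axis i (-1)) = 2 * q x - (if i = k then 2 * ?d else 0)" for i
      by (auto simp: q_def axis_def power2_eq_square algebra_simps)
    then have "avg x q = (\<Sum>i\<in>UNIV. 2 * q x - (if i = k then 2 * ?d else 0)) / (2 * ?d)"
      by (simp add: avg_eq)
    also have "\<dots> = (2 * ?d * q x - 2 * ?d) / (2 * ?d)" by (simp add: sum_subtractf)
    also have "\<dots> = q x - 1" by (simp add: field_simps)
    finally show ?thesis .
  qed
  show thesis
  proof (rule that)
    show "0 \<le> g z" for z using q0[of z] R[of z] by (auto simp: g_def)
    show "avg x g \<le> g x - 1" if "x \<in> V" for x
    proof -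
      have "avg x g \<le> avg x q"
        using nb[OF _ that] q0 by (intro avg_mono) (auto simp: g_def)
      then show ?thesis using that avg_q by (simp add: g_def)
    qed
  qed (simp add: g_def)
qed

context arw
begin

lemma ev_wt:
  assumes "finite V" "x \<in> V" "act {} \<eta> x" "\<And>z. z \<notin> V \<Longrightarrow> f z = 0"
  shows "ev x (\<lambda>i. wt V f (execute V x i \<eta>)) = wt V f \<eta> + pj * (avg x f - f x)"
proof -
  have J: "wt V f (execute V x (Jump y) \<eta>) = wt V f \<eta> - f x + f y" for y
    using assms by (rule wt_Jump)
  have "ev x (\<lambda>i. wt V f (execute V x i \<eta>)) =
      ps * wt V f \<eta> + pj * avg x (\<lambda>y. (wt V f \<eta> - f x) + f y)"
    unfolding ev_def by (simp only: wt_Sleep[OF assms(1-3)] J)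
  also have "avg x (\<lambda>y. (wt V f \<eta> - f x) + f y) = wt V f \<eta> - f x + avg x f"
    by (simp only: avg_add avg_const)
  finally show ?thesis by (simp add: pj_eq algebra_simps)
qed

text \<open>
  The expected exit time gives a potential that drops by at least 1 in expectation at every
  toppling, so a bounded \<open>F\<close> that is submartingale-like until it is nonpositive satisfies
  \<open>F \<le> B \<Phi> / N\<close> for every \<open>N\<close>. The argument \<open>h\<close> of \<open>F\<close> records the
  topplings made so far. Since each site to be toppled may be chosen freely, every strategy
  argument below is an application of this lemma.
\<close>

lemma maximum_principle:
  fixes F :: "(int ^ 'd::finite \<Rightarrow> site_state) \<Rightarrow> (int ^ 'd \<Rightarrow> nat) \<Rightarrow> real"
  assumes fin: "finite V"
    and bound: "\<And>C. \<exists>B. \<forall>\<eta> h. Inv \<eta> \<longrightarrow> mass V \<eta> \<le> C \<longrightarrow> F \<eta> h \<le> B"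
    and step: "\<And>\<eta> h. Inv \<eta> \<Longrightarrow> F \<eta> h \<le> 0 \<or> (\<exists>x\<in>V. act {} \<eta> x \<and>
      F \<eta> h \<le> ev x (\<lambda>i. if Inv (execute V x i \<eta>)
        then F (execute V x i \<eta>) (h(x := Suc (h x))) else 0))"
    and "Inv \<eta>"
  shows "F \<eta> h \<le> 0"
proof -
  obtain g :: "int ^ 'd \<Rightarrow> real" where g: "\<And>z. 0 \<le> g z" "\<And>z. z \<notin> V \<Longrightarrow> g z = 0"
    "\<And>x. x \<in> V \<Longrightarrow> avg x g \<le> g x - 1"
    using exit_potential[OF fin] by blast
  define \<Phi> where "\<Phi> \<zeta> = wt V g \<zeta> / pj" for \<zeta>
  have \<Phi>0: "0 \<le> \<Phi> \<zeta>" for \<zeta> using g(1) pj_pos by (simp add: \<Phi>_def wt_nonneg)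
  have \<Phi>1: "ev x (\<lambda>i. \<Phi> (execute V x i \<zeta>)) \<le> \<Phi> \<zeta> - 1" if "x \<in> V" "act {} \<zeta> x" for x \<zeta>
  proof -
    have "ev x (\<lambda>i. wt V g (execute V x i \<zeta>)) \<le> wt V g \<zeta> - pj"
      using g(3)[OF that(1)] pj_pos mult_left_mono[of "avg x g - g x" "-1" pj]
      by (simp add: ev_wt[OF fin that g(2)])
    moreover have "ev x (\<lambda>i. \<Phi> (execute V x i \<zeta>)) = ev x (\<lambda>i. wt V g (execute V x i \<zeta>)) / pj"
      using ev_cmult[of x "1 / pj"] by (simp add: \<Phi>_def)
    ultimately show ?thesis using pj_pos by (simp add: \<Phi>_def field_simps)
  qed
  \<comment> \<open>Nonnegativity and the expected drop force the potential to be at least 1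
    wherever a toppling is possible.\<close>
  have \<Phi>2: "1 \<le> \<Phi> \<zeta>" if "x \<in> V" "act {} \<zeta> x" for x \<zeta>
  proof -
    have "ev x (\<lambda>_. 0) \<le> ev x (\<lambda>i. \<Phi> (execute V x i \<zeta>))" using \<Phi>0 by (intro ev_mono) auto
    then show ?thesis using \<Phi>1[OF that] by simp
  qed
  \<comment> \<open>Topplings never increase the mass, so a bound on \<open>F\<close> up to the
    initial mass serves the whole evolution.\<close>
  define C where "C = mass V \<eta>"
  obtain B0 where B0: "\<And>\<zeta> h. Inv \<zeta> \<Longrightarrow> mass V \<zeta> \<le> C \<Longrightarrow> F \<zeta> h \<le> B0" using bound[of C] by blast
  define B where "B = max B0 0"
  have B: "F \<zeta> h \<le> B" "0 \<le> B" if "Inv \<zeta>" "mass V \<zeta> \<le> C" for \<zeta> h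
    using B0[OF that, of h] by (auto simp: B_def)
  have main: "F \<zeta> h \<le> B * \<Phi> \<zeta> / Suc N" if "Inv \<zeta>" "mass V \<zeta> \<le> C" for N \<zeta> h
    using that
  proof (induction N arbitrary: \<zeta> h)
    case 0
    show ?case
    proof (cases "F \<zeta> h \<le> 0")
      case True
      then show ?thesis using \<Phi>0 B[OF 0] by (simp add: order_trans)
    next
      case False
      then obtain x where "x \<in> V" "act {} \<zeta> x" using step[OF 0(1)] by blast
      then have "1 \<le> \<Phi> \<zeta>" by (rule \<Phi>2)
      then have "B * 1 \<le> B * \<Phi> \<zeta>" using B[OF 0] by (intro mult_left_mono)
      then show ?thesis using B(1)[OF 0, of h] by simp
    qed
  next
    case (Suc N)
    note BB = B[OF Suc.prems]
    show ?case
    proof (cases "F \<zeta> h \<le> 0")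
      case True
      have "0 \<le> B * \<Phi> \<zeta> / Suc (Suc N)" using \<Phi>0 BB by simp
      then show ?thesis using True by linarith
    next
      case False
      then obtain x where x: "x \<in> V" "act {} \<zeta> x" "F \<zeta> h \<le> ev x (\<lambda>i. if Inv (execute V x i \<zeta>)
        then F (execute V x i \<zeta>) (h(x := Suc (h x))) else 0)" using step[OF Suc.prems(1)] by blast
      define c where "c = B / Suc N"
      have c0: "0 \<le> c" using BB by (simp add: c_def)
      have pt: "(if Inv (execute V x i \<zeta>) then F (execute V x i \<zeta>) (h(x := Suc (h x))) else 0)
          \<le> c * \<Phi> (execute V x i \<zeta>)" for i
      proof (cases "Inv (execute V x i \<zeta>)")
        case True
        then show ?thesis
          using Suc.IH[OF True, of "h(x := Suc (h x))"] mass_execute[OF fin x(1,2), of i] Suc.prems(2)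
          by (simp add: c_def del: fun_upd_apply)
      next
        case False
        then show ?thesis using \<Phi>0 c0 by simp
      qed
      have "F \<zeta> h \<le> ev x (\<lambda>i. c * \<Phi> (execute V x i \<zeta>))"
        by (rule order_trans[OF x(3)]) (intro ev_mono pt)
      also have "\<dots> \<le> c * (\<Phi> \<zeta> - 1)"
        using \<Phi>1[OF x(1,2)] c0 by (simp add: ev_cmult mult_left_mono)
      finally have F: "F \<zeta> h \<le> c * (\<Phi> \<zeta> - 1)" .
      \<comment> \<open>\<open>(\<Phi> - 1) / (N + 1) \<le> \<Phi> / (N + 2)\<close> holds exactly
        when \<open>\<Phi> \<le> N + 2\<close>. Above that level the a priori bound \<open>B\<close>
        is enough.\<close>
      show ?thesis
      proof (cases "\<Phi> \<zeta> \<ge> Suc (Suc N)")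
        case True
        then have "B * Suc (Suc N) \<le> B * \<Phi> \<zeta>" using BB by (intro mult_left_mono) auto
        then have "B \<le> B * \<Phi> \<zeta> / Suc (Suc N)" by (simp add: field_simps)
        then show ?thesis using BB(1)[of h] by linarith
      next
        case False
        have "(\<Phi> \<zeta> - 1) * Suc (Suc N) \<le> \<Phi> \<zeta> * Suc N"
          using False by (simp add: algebra_simps)
        then have "(\<Phi> \<zeta> - 1) / Suc N \<le> \<Phi> \<zeta> / Suc (Suc N)"
          by (simp add: divide_le_eq pos_le_divide_eq mult.commute del: of_nat_Suc)
        then have "B * ((\<Phi> \<zeta> - 1) / Suc N) \<le> B * (\<Phi> \<zeta> / Suc (Suc N))"
          using BB(2) by (rule mult_left_mono)
        then show ?thesis using F by (simp add: c_def)
      qed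
    qed
  qed
  show ?thesis
  proof (rule ccontr)
    assume "\<not> F \<eta> h \<le> 0"
    then have pos: "0 < F \<eta> h" by simp
    obtain N :: nat where "B * \<Phi> \<eta> / F \<eta> h < real N" using reals_Archimedean2 by blast
    then have "B * \<Phi> \<eta> < F \<eta> h * real (Suc N)" using pos by (simp add: field_simps)
    moreover have "F \<eta> h * real (Suc N) \<le> B * \<Phi> \<eta>"
      using main[OF \<open>Inv \<eta>\<close>, of h N] by (simp add: C_def field_simps)
    ultimately show False by linarith
  qed
qed

lemma maximum_principle_config:
  fixes F :: "(int ^ 'd::finite \<Rightarrow> site_state) \<Rightarrow> real"
  assumes "finite V"
    and "\<And>C. \<exists>B. \<forall>\<eta>. Inv \<eta> \<longrightarrow> mass V \<eta> \<le> C \<longrightarrow> F \<eta> \<le> B"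
    and "\<And>\<eta>. Inv \<eta> \<Longrightarrow> F \<eta> \<le> 0 \<or> (\<exists>x\<in>V. act {} \<eta> x \<and>
      F \<eta> \<le> ev x (\<lambda>i. if Inv (execute V x i \<eta>) then F (execute V x i \<eta>) else 0))"
    and "Inv \<eta>"
  shows "F \<eta> \<le> 0"
  using maximum_principle[of V Inv "\<lambda>\<eta> _. F \<eta>" \<eta>] assms by blast

end

section \<open>Occupation probabilities and the lower bound\<close>

declare execute.simps [simp del]

lemma add_particle_nonempty [simp]: "add_particle s \<noteq> Active 0"
  by (cases s) auto

lemma add_particle_not_Sleeping [simp]: "add_particle s \<noteq> Sleeping"
  by (cases s) auto

lemma stableD: "stable V H \<eta> \<Longrightarrow> x \<in> V \<Longrightarrow> \<not> act H \<eta> x"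
  by (simp add: stable_def)

lemma not_stableE:
  assumes "\<not> stable V H \<eta>"
  obtains x where "x \<in> V" "act H \<eta> x"
  using assms by (auto simp: stable_def)

lemma act_not_empty: "\<eta> z = Active 0 \<Longrightarrow> \<not> act H \<eta> z"
  by (auto simp: act_def)

lemma act_single [simp]: "act {} \<eta> z \<longleftrightarrow> \<eta> z \<noteq> Sleeping \<and> \<eta> z \<noteq> Active 0"
  by (cases "\<eta> z") (auto simp: act_def)

text \<open>\<open>act {z} \<eta> z\<close> means at least two active particles at \<open>z\<close>,
  so that one stays behind.\<close>

lemma execute_nonempty:
  assumes "\<eta> z \<noteq> Active 0" "x \<noteq> z \<or> act {z} \<eta> z"
  shows "execute V x i \<eta> z \<noteq> Active 0"
  using assms by (cases i) (auto simp: execute.simps Let_def act_def)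

lemma execute_not_Sleeping:
  assumes "\<eta> z \<noteq> Sleeping" "x \<noteq> z \<or> act {z} \<eta> z"
  shows "execute V x i \<eta> z \<noteq> Sleeping"
  using assms by (cases i; cases "\<eta> z") (auto simp: execute.simps Let_def act_def)

lemma execute_Sleep_lone: "\<eta> z = Active 1 \<Longrightarrow> execute V z Sleep \<eta> = \<eta>(z := Sleeping)"
  by (simp add: execute.simps)

lemma avg_single:
  fixes y :: "int ^ 'd::finite"
  assumes "z \<in> neighbors y"
  shows "avg y (\<lambda>w. of_bool (w = z) * c) = c / (2 * real CARD('d))"
proof -
  have "(\<Sum>w\<in>neighbors y. of_bool (w = z) * c) = (\<Sum>w\<in>neighbors y. if w = z then c else 0)"
    by (rule sum.cong) auto
  also have "\<dots> = c" using assms by (simp add: finite_neighbors)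
  finally show ?thesis by (simp add: avg_def)
qed

context arw
begin

definition occ :: "(int ^ 'd::finite) set \<Rightarrow> (int ^ 'd) set \<Rightarrow> int ^ 'd
    \<Rightarrow> (int ^ 'd \<Rightarrow> site_state) \<Rightarrow> real" where
  "occ V H z \<eta> = pr V H (\<lambda>_ \<zeta>. \<zeta> z \<noteq> Active 0) \<eta>"

definition unused :: "(int ^ 'd::finite) set \<Rightarrow> (int ^ 'd) set \<Rightarrow> int ^ 'd
    \<Rightarrow> (int ^ 'd \<Rightarrow> site_state) \<Rightarrow> real" where
  "unused V H z \<eta> = pr V H (\<lambda>h _. h z = 0) \<eta>"

lemma occ_bounds [simp]: "0 \<le> occ V H z \<eta>" "occ V H z \<eta> \<le> 1"
  by (simp_all add: occ_def)

lemma unused_bounds [simp]: "0 \<le> unused V H z \<eta>" "unused V H z \<eta> \<le> 1"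
  by (simp_all add: unused_def)

lemma occ_step:
  assumes "x \<in> V" "act H \<eta> x"
  shows "occ V H z \<eta> = ev x (\<lambda>i. occ V H z (execute V x i \<eta>))"
  unfolding occ_def by (rule pr_step[OF assms])

lemma occ_step_hold:
  assumes "x \<in> V" "act H \<eta> x"
  shows "occ V {} z \<eta> = ev x (\<lambda>i. occ V {} z (execute V x i \<eta>))"
  by (rule occ_step[OF assms(1) act_mono_hold[OF assms(2)]])

lemma occ_stable: "stable V H \<eta> \<Longrightarrow> occ V H z \<eta> = of_bool (\<eta> z \<noteq> Active 0)"
  by (simp add: occ_def pr_stable)

lemma unused_step:
  assumes "x \<in> V" "act H \<eta> x" "x \<noteq> z"
  shows "unused V H z \<eta> = ev x (\<lambda>i. unused V H z (execute V x i \<eta>))"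
  unfolding unused_def by (subst pr_step[OF assms(1,2)]) (use assms(3) in simp)

lemma unused_step_hold:
  assumes "x \<in> V" "act H \<eta> x" "x \<noteq> z"
  shows "unused V {} z \<eta> = ev x (\<lambda>i. unused V {} z (execute V x i \<eta>))"
  by (rule unused_step[OF assms(1) act_mono_hold[OF assms(2)] assms(3)])

lemma unused_same:
  assumes "z \<in> V" "act H \<eta> z"
  shows "unused V H z \<eta> = 0"
  unfolding unused_def by (subst pr_step[OF assms]) (simp add: pr_def outcome_def)

lemma unused_stable: "stable V H \<eta> \<Longrightarrow> unused V H z \<eta> = 1"
  by (simp add: unused_def pr_stable)

lemma ev_ge_Sleep:
  assumes "\<And>i. 0 \<le> F i"
  shows "ps * F Sleep \<le> ev x F"
proof -
  have "avg x (\<lambda>_. 0) \<le> avg x (\<lambda>y. F (Jump y))" using assms by (intro avg_mono)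
  then show ?thesis using pj_pos by (simp add: ev_def)
qed

lemma ev_avg:
  fixes x z :: "int ^ 'd::finite"
  shows "ev x (\<lambda>i. avg z (\<lambda>y. f y i)) = avg z (\<lambda>y. ev x (f y))"
proof -
  have "ev x (\<lambda>i. avg z (\<lambda>y. f y i)) = (1 / (2 * real CARD('d))) * ev x (\<lambda>i. \<Sum>y\<in>neighbors z. f y i)"
    by (subst ev_cmult[symmetric]) (simp add: avg_def)
  then show ?thesis by (simp add: ev_sum avg_def)
qed

text \<open>The form in which \<open>maximum_principle_config\<close> is fed when the toppling
  preserves the invariant for every instruction.\<close>

lemma submartingale_step:
  assumes "x \<in> V" "act H \<eta> x" "\<And>i. Inv (execute V x i \<eta>)"
    and "F \<eta> \<le> ev x (\<lambda>i. F (execute V x i \<eta>))"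
  shows "F \<eta> \<le> 0 \<or> (\<exists>x\<in>V. act {} \<eta> x \<and> F \<eta> \<le>
    ev x (\<lambda>i. if Inv (execute V x i \<eta>) then F (execute V x i \<eta>) else 0))"
proof -
  have "act {} \<eta> x \<and> F \<eta> \<le>
      ev x (\<lambda>i. if Inv (execute V x i \<eta>) then F (execute V x i \<eta>) else 0)"
    by (simp only: assms(3,4) if_True act_mono_hold[OF assms(2)] simp_thms)
  then show ?thesis using assms(1) by blast
qed

text \<open>As long as another site, or one of several particles at \<open>z\<close>, can be
  toppled, do so; \<open>z\<close> stays occupied. When only a lone active particle at
  \<open>z\<close> is left to topple, it falls asleep at once with probability \<open>ps\<close>,
  which ends the process.\<close>

lemma occ_ge_ps:
  assumes "finite V" "z \<in> V" "z \<notin> H" "\<eta> z \<noteq> Active 0"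
  shows "ps \<le> occ V H z \<eta>"
proof -
  have "ps - occ V H z \<eta> \<le> 0"
  proof (rule maximum_principle_config[where Inv = "\<lambda>\<eta>. \<eta> z \<noteq> Active 0"
        and F = "\<lambda>\<eta>. ps - occ V H z \<eta>", OF assms(1)])
    show "\<exists>B. \<forall>\<eta>. \<eta> z \<noteq> Active 0 \<longrightarrow> mass V \<eta> \<le> C \<longrightarrow> ps - occ V H z \<eta> \<le> B" for C
      by (rule exI[of _ ps]) simp
    fix \<eta> :: "int ^ 'a \<Rightarrow> site_state"
    assume ne: "\<eta> z \<noteq> Active 0"
    consider (a) x where "x \<in> V" "act H \<eta> x" "x \<noteq> z \<or> act {z} \<eta> z"
      | (b) "\<eta> z = Active 1" "\<And>x. x \<in> V \<Longrightarrow> act H \<eta> x \<Longrightarrow> x = z"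
      | (c) "stable V H \<eta>"
    proof goal_cases
      case 1
      note a = 1(1) and b = 1(2) and c = 1(3)
      have one: "\<eta> z = Active 1" if "act H \<eta> z" "\<not> act {z} \<eta> z"
        using that assms(3) by (auto simp: act_def)
      show thesis
      proof (cases "stable V H \<eta>")
        case True
        then show thesis by (rule c)
      next
        case False
        then obtain x where x: "x \<in> V" "act H \<eta> x" by (rule not_stableE)
        show thesis
        proof (cases "\<exists>x\<in>V. act H \<eta> x \<and> (x \<noteq> z \<or> act {z} \<eta> z)")
          case True
          then show thesis using a by blast
        next
          case False
          then show thesis using b one x by blast
        qed
      qed
    qed
    then show "ps - occ V H z \<eta> \<le> 0 \<or> (\<exists>x\<in>V. act {} \<eta> x \<and> ps - occ V H z \<eta> \<le>
        ev x (\<lambda>i. if execute V x i \<eta> z \<noteq> Active 0 then ps - occ V H z (execute V x i \<eta>) else 0))"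
    proof cases
      case a
      have "\<And>i. execute V x i \<eta> z \<noteq> Active 0" using execute_nonempty[of \<eta> z x V] ne a by blast
      moreover have "ps - occ V H z \<eta> \<le> ev x (\<lambda>i. ps - occ V H z (execute V x i \<eta>))"
        by (simp only: ev_diff ev_const occ_step[OF a(1,2), symmetric] order_refl)
      ultimately show ?thesis
        by (rule submartingale_step[OF a(1,2), where F = "\<lambda>\<eta>. ps - occ V H z \<eta>"
              and Inv = "\<lambda>\<eta>. \<eta> z \<noteq> Active 0"])
    next
      case b
      have "act H \<eta> z" using b(1) assms(3) by (auto simp: act_def)
      then have "occ V H z \<eta> = ev z (\<lambda>i. occ V H z (execute V z i \<eta>))"
        by (rule occ_step[OF assms(2)])
      also have "\<dots> \<ge> ps * occ V H z (execute V z Sleep \<eta>)" by (rule ev_ge_Sleep) simp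
      finally have "ps * occ V H z (\<eta>(z := Sleeping)) \<le> occ V H z \<eta>"
        unfolding execute_Sleep_lone[of \<eta> z, OF b(1)] .
      moreover have "stable V H (\<eta>(z := Sleeping))"
        unfolding stable_def
      proof
        fix w assume w: "w \<in> V"
        show "\<not> act H (\<eta>(z := Sleeping)) w"
          using b(2)[OF w] by (cases "w = z") (auto simp: act_def)
      qed
      ultimately show ?thesis by (simp add: occ_stable)
    next
      case c
      then show ?thesis using ne ps_pj pj_pos by (simp add: occ_stable)
    qed
  qed (use assms in auto)
  then show ?thesis by simp
qed

text \<open>A held site is never emptied. The content is that stabilization ends almost surely,
  since an endless one would count as not occupied.\<close>

lemma occ_hold:
  assumes "finite V" "z \<in> V" "z \<in> H" "\<eta> z \<noteq> Active 0"
  shows "occ V H z \<eta> = 1"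
proof -
  have "1 - occ V H z \<eta> \<le> 0"
  proof (rule maximum_principle_config[where Inv = "\<lambda>\<eta>. \<eta> z \<noteq> Active 0"
        and F = "\<lambda>\<eta>. 1 - occ V H z \<eta>", OF assms(1)])
    show "\<exists>B. \<forall>\<eta>. \<eta> z \<noteq> Active 0 \<longrightarrow> mass V \<eta> \<le> C \<longrightarrow> 1 - occ V H z \<eta> \<le> B" for C
      by (rule exI[of _ 1]) simp
    fix \<eta> :: "int ^ 'a \<Rightarrow> site_state"
    assume ne: "\<eta> z \<noteq> Active 0"
    show "1 - occ V H z \<eta> \<le> 0 \<or> (\<exists>x\<in>V. act {} \<eta> x \<and> 1 - occ V H z \<eta> \<le>
        ev x (\<lambda>i. if execute V x i \<eta> z \<noteq> Active 0 then 1 - occ V H z (execute V x i \<eta>) else 0))"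
    proof (cases "stable V H \<eta>")
      case True
      then show ?thesis using ne by (simp add: occ_stable)
    next
      case False
      then obtain x where x: "x \<in> V" "act H \<eta> x" by (rule not_stableE)
      then have "x \<noteq> z \<or> act {z} \<eta> z" using assms(3) by (auto simp: act_def)
      then have "\<And>i. execute V x i \<eta> z \<noteq> Active 0" using execute_nonempty[of \<eta> z x V] ne by blast
      moreover have "1 - occ V H z \<eta> \<le> ev x (\<lambda>i. 1 - occ V H z (execute V x i \<eta>))"
        by (simp only: ev_diff ev_const occ_step[OF x, symmetric] order_refl)
      ultimately show ?thesis
        by (rule submartingale_step[OF x, where F = "\<lambda>\<eta>. 1 - occ V H z \<eta>"
              and Inv = "\<lambda>\<eta>. \<eta> z \<noteq> Active 0"])
    qed
  qed (use assms in auto)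
  then show ?thesis using occ_bounds(2)[of V H z \<eta>] by linarith
qed

lemma occ_ge_used:
  assumes "finite V" "z \<in> V" "z \<notin> H"
  shows "ps * (1 - unused V H z \<eta>) \<le> occ V H z \<eta>"
proof -
  have "ps * (1 - unused V H z \<eta>) - occ V H z \<eta> \<le> 0"
  proof (rule maximum_principle_config[where Inv = "\<lambda>_. True"
        and F = "\<lambda>\<eta>. ps * (1 - unused V H z \<eta>) - occ V H z \<eta>", OF assms(1)])
    have "ps * (1 - unused V H z \<eta>) - occ V H z \<eta> \<le> ps * 1 - 0" for \<eta>
      using ps_pos by (intro diff_mono mult_left_mono) auto
    then show "\<exists>B. \<forall>\<eta>. True \<longrightarrow> mass V \<eta> \<le> C \<longrightarrow> ps * (1 - unused V H z \<eta>) - occ V H z \<eta> \<le> B" for C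
      by blast
    fix \<eta> :: "int ^ 'a \<Rightarrow> site_state"
    show "ps * (1 - unused V H z \<eta>) - occ V H z \<eta> \<le> 0 \<or> (\<exists>x\<in>V. act {} \<eta> x \<and>
        ps * (1 - unused V H z \<eta>) - occ V H z \<eta> \<le>
        ev x (\<lambda>i. if True then ps * (1 - unused V H z (execute V x i \<eta>))
          - occ V H z (execute V x i \<eta>) else 0))"
    proof (cases "\<eta> z = Active 0")
      case True
      show ?thesis
      proof (cases "stable V H \<eta>")
        case True
        then show ?thesis using \<open>\<eta> z = Active 0\<close> by (simp add: unused_stable)
      next
        case False
        then obtain x where x: "x \<in> V" "act H \<eta> x" by (rule not_stableE)
        then have xz: "x \<noteq> z" using True act_not_empty by metis
        have "ps * (1 - unused V H z \<eta>) - occ V H z \<eta> \<le>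
            ev x (\<lambda>i. ps * (1 - unused V H z (execute V x i \<eta>)) - occ V H z (execute V x i \<eta>))"
          by (simp only: ev_diff ev_cmult ev_const occ_step[OF x, symmetric]
              unused_step[OF x xz, symmetric] order_refl)
        then show ?thesis
          by (rule submartingale_step[OF x TrueI,
                where F = "\<lambda>\<eta>. ps * (1 - unused V H z \<eta>) - occ V H z \<eta>"])
      qed
    next
      case False
      have "ps * (1 - unused V H z \<eta>) \<le> ps * 1" using ps_pos by (intro mult_left_mono) auto
      then show ?thesis using occ_ge_ps[of V z H \<eta>] assms False by simp
    qed
  qed auto
  then show ?thesis by simp
qed

text \<open>The only obstruction is a lone active particle at \<open>z\<close>, so a single sleep
  instruction there completes the stabilization. All arguments with a held site continue from this
  configuration.\<close>

lemma stable_hold_cases: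
  assumes "stable V {z} \<eta>" "\<not> stable V {} \<eta>"
  shows "z \<in> V" "\<eta> z = Active 1" "stable V {} (\<eta>(z := Sleeping))"
proof -
  obtain x where x: "x \<in> V" "act {} \<eta> x" using assms(2) by (rule not_stableE)
  have n: "\<not> act {z} \<eta> w" if "w \<in> V" for w using assms(1) that by (simp add: stable_def)
  have *: "w = z \<and> \<eta> w = Active 1" if w: "w \<in> V" "act {} \<eta> w" for w
  proof -
    obtain k where k: "\<eta> w = Active k" "1 \<le> k"
      using w(2) by (auto simp only: act_def empty_iff if_False)
    then show ?thesis using n[OF w(1)] by (auto simp: act_def split: if_splits)
  qed
  show "z \<in> V" "\<eta> z = Active 1" using *[OF x] x(1) by auto
  show "stable V {} (\<eta>(z := Sleeping))"
    unfolding stable_def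
  proof
    fix w assume "w \<in> V"
    then show "\<not> act {} (\<eta>(z := Sleeping)) w" using *[of w] by auto
  qed
qed

lemma unused_hold:
  assumes "finite V" "y \<noteq> z"
  shows "ps * unused V {z} y \<eta> \<le> unused V {} y \<eta>"
proof -
  have "ps * unused V {z} y \<eta> - unused V {} y \<eta> \<le> 0"
  proof (rule maximum_principle_config[where Inv = "\<lambda>_. True"
        and F = "\<lambda>\<eta>. ps * unused V {z} y \<eta> - unused V {} y \<eta>", OF assms(1)])
    have "ps * unused V {z} y \<eta> - unused V {} y \<eta> \<le> ps * 1 - 0" for \<eta>
      using ps_pos by (intro diff_mono mult_left_mono) auto
    then show "\<exists>B. \<forall>\<eta>. True \<longrightarrow> mass V \<eta> \<le> C \<longrightarrow> ps * unused V {z} y \<eta> - unused V {} y \<eta> \<le> B" for C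
      by blast
    fix \<eta> :: "int ^ 'a \<Rightarrow> site_state"
    show "ps * unused V {z} y \<eta> - unused V {} y \<eta> \<le> 0 \<or> (\<exists>x\<in>V. act {} \<eta> x \<and>
        ps * unused V {z} y \<eta> - unused V {} y \<eta> \<le> ev x (\<lambda>i. if True then
          ps * unused V {z} y (execute V x i \<eta>) - unused V {} y (execute V x i \<eta>) else 0))"
    proof (cases "stable V {z} \<eta>")
      case True
      show ?thesis
      proof (cases "stable V {} \<eta>")
        case True
        then show ?thesis
          using \<open>stable V {z} \<eta>\<close> ps_pj pj_pos by (simp add: unused_stable)
      next
        case False
        note z = stable_hold_cases[OF \<open>stable V {z} \<eta>\<close> False]
        have "act {} \<eta> z" using z(2) by simp
        then have "unused V {} y \<eta> = ev z (\<lambda>i. unused V {} y (execute V z i \<eta>))"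
          using assms(2) by (intro unused_step[OF z(1)]) auto
        also have "\<dots> \<ge> ps * unused V {} y (execute V z Sleep \<eta>)" by (rule ev_ge_Sleep) simp
        finally have "ps * unused V {} y (\<eta>(z := Sleeping)) \<le> unused V {} y \<eta>"
          unfolding execute_Sleep_lone[of \<eta> z, OF z(2)] .
        then show ?thesis using z(3) True by (simp add: unused_stable)
      qed
    next
      case False
      then obtain x where x: "x \<in> V" "act {z} \<eta> x" by (rule not_stableE)
      show ?thesis
      proof (cases "x = y")
        case True
        then show ?thesis using unused_same[of y V "{z}" \<eta>] x by simp
      next
        case False
        have "ps * unused V {z} y \<eta> - unused V {} y \<eta> \<le> ev x (\<lambda>i.
          ps * unused V {z} y (execute V x i \<eta>) - unused V {} y (execute V x i \<eta>))"
          by (simp only: ev_diff ev_cmult unused_step[OF x False, symmetric]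
              unused_step_hold[OF x False, symmetric] order_refl)
        then show ?thesis
          by (rule submartingale_step[OF x TrueI,
                where F = "\<lambda>\<eta>. ps * unused V {z} y \<eta> - unused V {} y \<eta>"])
      qed
    qed
  qed auto
  then show ?thesis by simp
qed

lemma occ_hold_ge_used:
  assumes "finite V" "z \<in> V"
  shows "1 - unused V {} z \<eta> \<le> occ V {z} z \<eta>"
proof -
  have "1 - unused V {} z \<eta> - occ V {z} z \<eta> \<le> 0"
  proof (rule maximum_principle_config[where Inv = "\<lambda>_. True"
        and F = "\<lambda>\<eta>. 1 - unused V {} z \<eta> - occ V {z} z \<eta>", OF assms(1)])
    have "1 - unused V {} z \<eta> - occ V {z} z \<eta> \<le> 1 - 0 - 0" for \<eta>
      by (intro diff_mono) auto
    then show "\<exists>B. \<forall>\<eta>. True \<longrightarrow> mass V \<eta> \<le> C \<longrightarrow> 1 - unused V {} z \<eta> - occ V {z} z \<eta> \<le> B" for C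
      by blast
    fix \<eta> :: "int ^ 'a \<Rightarrow> site_state"
    show "1 - unused V {} z \<eta> - occ V {z} z \<eta> \<le> 0 \<or> (\<exists>x\<in>V. act {} \<eta> x \<and>
        1 - unused V {} z \<eta> - occ V {z} z \<eta> \<le> ev x (\<lambda>i. if True then
          1 - unused V {} z (execute V x i \<eta>) - occ V {z} z (execute V x i \<eta>) else 0))"
    proof (cases "\<eta> z = Active 0")
      case True
      show ?thesis
      proof (cases "stable V {z} \<eta>")
        case True
        then have "stable V {} \<eta>"
          using stable_hold_cases(2)[OF True] \<open>\<eta> z = Active 0\<close> by fastforce
        then show ?thesis by (simp add: unused_stable)
      next
        case False
        then obtain x where x: "x \<in> V" "act {z} \<eta> x" by (rule not_stableE)
        then have xz: "x \<noteq> z" using True act_not_empty by metis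
        have "1 - unused V {} z \<eta> - occ V {z} z \<eta> \<le> ev x (\<lambda>i.
          1 - unused V {} z (execute V x i \<eta>) - occ V {z} z (execute V x i \<eta>))"
          by (simp only: ev_diff ev_const occ_step[OF x, symmetric]
              unused_step_hold[OF x xz, symmetric] order_refl)
        then show ?thesis
          by (rule submartingale_step[OF x TrueI,
                where F = "\<lambda>\<eta>. 1 - unused V {} z \<eta> - occ V {z} z \<eta>"])
      qed
    next
      case False
      then show ?thesis using occ_hold[OF assms, of "{z}" \<eta>] by simp
    qed
  qed auto
  then show ?thesis by simp
qed

lemma occ_sum_le_mass:
  assumes "finite V"
  shows "(\<Sum>z\<in>V. occ V {} z \<eta>) \<le> mass V \<eta>"
proof -
  have "(\<Sum>z\<in>V. occ V {} z \<eta>) - mass V \<eta> \<le> 0"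
  proof (rule maximum_principle_config[where Inv = "\<lambda>_. True"
        and F = "\<lambda>\<eta>. (\<Sum>z\<in>V. occ V {} z \<eta>) - mass V \<eta>", OF assms(1)])
    have "(\<Sum>z\<in>V. occ V {} z \<eta>) - mass V \<eta> \<le> (\<Sum>z\<in>V. 1) - 0" for \<eta>
      by (intro diff_mono sum_mono) auto
    then show "\<exists>B. \<forall>\<eta>. True \<longrightarrow> mass V \<eta> \<le> C \<longrightarrow> (\<Sum>z\<in>V. occ V {} z \<eta>) - mass V \<eta> \<le> B" for C
      by blast
    fix \<eta> :: "int ^ 'a \<Rightarrow> site_state"
    show "(\<Sum>z\<in>V. occ V {} z \<eta>) - mass V \<eta> \<le> 0 \<or> (\<exists>x\<in>V. act {} \<eta> x \<and>
        (\<Sum>z\<in>V. occ V {} z \<eta>) - mass V \<eta> \<le> ev x (\<lambda>i. if True then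
          (\<Sum>z\<in>V. occ V {} z (execute V x i \<eta>)) - mass V (execute V x i \<eta>) else 0))"
    proof (cases "stable V {} \<eta>")
      case True
      have "of_bool (\<eta> z \<noteq> Active 0) \<le> real (cnt (\<eta> z))" for z by (cases "\<eta> z") auto
      then show ?thesis using True by (auto simp: occ_stable mass_def sum_mono)
    next
      case False
      then obtain x where x: "x \<in> V" "act {} \<eta> x" by (rule not_stableE)
      have "(\<Sum>z\<in>V. occ V {} z \<eta>) - mass V \<eta>
          = ev x (\<lambda>i. (\<Sum>z\<in>V. occ V {} z (execute V x i \<eta>)) - mass V \<eta>)"
        by (simp only: ev_diff ev_sum ev_const occ_step[OF x, symmetric])
      also have "\<dots> \<le> ev x (\<lambda>i. (\<Sum>z\<in>V. occ V {} z (execute V x i \<eta>)) - mass V (execute V x i \<eta>))"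
        using mass_execute[OF assms x] by (intro ev_mono diff_mono) auto
      finally show ?thesis
        by (rule submartingale_step[OF x TrueI,
              where F = "\<lambda>\<eta>. (\<Sum>z\<in>V. occ V {} z \<eta>) - mass V \<eta>"])
    qed
  qed auto
  then show ?thesis by simp
qed

section \<open>Return of a particle that has jumped to a neighbor\<close>

lemma occ_ge_neighbor:
  fixes y z :: "int ^ 'd::finite"
  assumes "finite V" "z \<in> V" "y \<in> V" "z \<in> neighbors y" "act {} \<eta> y"
  shows "pj / (2 * real CARD('d)) * ps \<le> occ V {} z \<eta>"
proof -
  have zy: "z \<noteq> y" using assms(4) by auto
  have "execute V y (Jump z) \<eta> z \<noteq> Active 0" using assms(2) zy by (simp add: execute.simps Let_def)
  then have z: "ps \<le> occ V {} z (execute V y (Jump z) \<eta>)"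
    by (intro occ_ge_ps assms(1,2)) auto
  have "ps / (2 * real CARD('d)) = avg y (\<lambda>w. of_bool (w = z) * ps)"
    by (rule avg_single[OF assms(4), symmetric])
  also have "\<dots> \<le> avg y (\<lambda>w. occ V {} z (execute V y (Jump w) \<eta>))"
    using z by (intro avg_mono) auto
  finally have "pj * (ps / (2 * real CARD('d)))
      \<le> pj * avg y (\<lambda>w. occ V {} z (execute V y (Jump w) \<eta>))"
    using pj_pos by (intro mult_left_mono) auto
  also have "\<dots> \<le> ev y (\<lambda>i. occ V {} z (execute V y i \<eta>))"
    using ps_pos by (simp add: ev_def)
  also have "\<dots> = occ V {} z \<eta>" by (rule occ_step[OF assms(3,5), symmetric])
  finally show ?thesis by simp
qed

text \<open>After the jump, \<open>y\<close> has one or two active particles. A lone one jumps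
  directly to \<open>z\<close> with probability \<open>pj / D\<close>. Of two, the first to move
  reaches \<open>z\<close> with probability \<open>1 / D\<close>, and otherwise the one left behind
  still has its chance \<open>pj / D\<close>. The factor \<open>ps\<close> is the price of staying,
  by \<open>occ_ge_ps\<close>.\<close>

lemma occ_return:
  fixes y z :: "int ^ 'd::finite"
  assumes "finite V" "z \<in> V" "y \<in> V" "y \<in> neighbors z" "stable V {z} \<eta>" "\<eta> z = Active 1"
  shows "ps / (2 * real CARD('d)) * (pj + (1 - pj / (2 * real CARD('d))) * of_bool (\<eta> y \<noteq> Active 0))
    \<le> occ V {} z (execute V z (Jump y) \<eta>)"
proof -
  let ?D = "2 * real CARD('d)"
  let ?\<zeta> = "execute V z (Jump y) \<eta>"
  have zy: "z \<noteq> y" using assms(4) by auto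
  have zn: "z \<in> neighbors y" using assms(4) neighbors_sym by metis
  have y\<zeta>: "?\<zeta> y = add_particle (\<eta> y)" using assms(3) zy by (simp add: execute.simps Let_def)
  show ?thesis
  proof (cases "\<eta> y = Active 0")
    case True
    have "act {} ?\<zeta> y" by (simp only: act_single y\<zeta>) simp
    then show ?thesis using occ_ge_neighbor[OF assms(1-3) zn, of ?\<zeta>] True by (simp add: mult.commute)
  next
    case False
    have "\<not> act {z} \<eta> y" using assms(3,5) by (rule stableD[rotated])
    then have "\<eta> y = Sleeping" using False zy by (cases "\<eta> y") (auto simp: act_def)
    then have y2: "?\<zeta> y = Active 2" using y\<zeta> by simp
    then have ay: "act {} ?\<zeta> y" by simp
    \<comment> \<open>Two particles make the sleep instruction void, so the equation for the first
      toppling of \<open>y\<close> can be solved in terms of the average over jumps.\<close>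
    have sl: "execute V y Sleep ?\<zeta> = ?\<zeta>"
      using y2 by (simp add: execute.simps fun_upd_idem)
    let ?o = "\<lambda>w. occ V {} z (execute V y (Jump w) ?\<zeta>)"
    have "occ V {} z ?\<zeta> = ev y (\<lambda>i. occ V {} z (execute V y i ?\<zeta>))"
      by (rule occ_step[OF assms(3) ay])
    also have "\<dots> = ps * occ V {} z ?\<zeta> + pj * avg y ?o"
      unfolding ev_def sl ..
    finally have "pj * occ V {} z ?\<zeta> = pj * avg y ?o"
      by (simp add: pj_eq algebra_simps)
    then have e: "occ V {} z ?\<zeta> = avg y ?o" using pj_pos by simp
    have w: "pj / ?D * ps + of_bool (w = z) * (ps - pj / ?D * ps) \<le> ?o w"
      if "w \<in> neighbors y" for w
    proof (cases "w = z")
      case True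
      have "execute V y (Jump z) ?\<zeta> z \<noteq> Active 0"
        using assms(2) zy by (simp add: execute.simps(2)[of V y] Let_def)
      then have "ps \<le> occ V {} z (execute V y (Jump z) ?\<zeta>)"
        by (intro occ_ge_ps assms(1,2)) auto
      then show ?thesis using True by simp
    next
      case False
      have wy: "w \<noteq> y" using that by auto
      have "execute V y (Jump w) ?\<zeta> y = Active 1"
        using y2 wy by (simp add: execute.simps(2)[of V y] Let_def)
      then have "act {} (execute V y (Jump w) ?\<zeta>) y" by simp
      then show ?thesis using occ_ge_neighbor[OF assms(1-3) zn] False by simp
    qed
    have "avg y (\<lambda>w. pj / ?D * ps + of_bool (w = z) * (ps - pj / ?D * ps)) \<le> avg y ?o"
      using w by (intro avg_mono)
    then have "pj / ?D * ps + (ps - pj / ?D * ps) / ?D \<le> occ V {} z ?\<zeta>"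
      unfolding e avg_add avg_const avg_single[OF zn] .
    moreover have "pj / ?D * ps + (ps - pj / ?D * ps) / ?D
        = ps / ?D * (pj + (1 - pj / ?D))"
      by (simp add: field_simps)
    ultimately show ?thesis using False by simp
  qed
qed

text \<open>The left side is affine in the occupation probabilities with \<open>z\<close> held, so
  it is harmonic along topplings legal under the hold and need only be checked once these are
  exhausted. This is why the probability that \<open>y\<close> and \<open>z\<close> are both
  occupied is replaced by the lower bound
  \<open>occ V {z} y \<eta> + occ V {z} z \<eta> - 1\<close>.\<close>

lemma occ_lower_hold:
  fixes z :: "int ^ 'd::finite"
  assumes "finite V" "z \<in> V" "neighbors z \<subseteq> V" "\<eta> z \<noteq> Sleeping"
  defines "D \<equiv> 2 * real CARD('d)"
  shows "ps * occ V {z} z \<eta> + ps * pj / D * (pj * occ V {z} z \<eta>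
      + (1 - pj / D) * avg z (\<lambda>y. occ V {z} y \<eta> + occ V {z} z \<eta> - 1)) \<le> occ V {} z \<eta>"
proof -
  define R where "R \<eta> = ps * occ V {z} z \<eta> + ps * pj / D * (pj * occ V {z} z \<eta>
      + (1 - pj / D) * avg z (\<lambda>y. occ V {z} y \<eta> + occ V {z} z \<eta> - 1))" for \<eta>
  have D: "2 \<le> D" by (simp add: D_def Suc_le_eq)
  have pD: "0 \<le> 1 - pj / D" using D ps_pos pj_pos ps_pj by (simp add: field_simps)
  have c: "0 \<le> ps * pj / D" using D ps_pos pj_pos by simp
  have "R \<eta> - occ V {} z \<eta> \<le> 0"
  proof (rule maximum_principle_config[where Inv = "\<lambda>\<eta>. \<eta> z \<noteq> Sleeping"
        and F = "\<lambda>\<eta>. R \<eta> - occ V {} z \<eta>", OF assms(1)])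
    have "R \<eta> - occ V {} z \<eta> \<le> ps * 1 + ps * pj / D * (pj * 1
      + (1 - pj / D) * avg z (\<lambda>y. 1)) - 0" for \<eta>
    proof -
      have "occ V {z} y \<eta> + occ V {z} z \<eta> - 1 \<le> 1" for y
        using occ_bounds(2)[of V "{z}" y \<eta>] occ_bounds(2)[of V "{z}" z \<eta>] by linarith
      then show ?thesis
        unfolding R_def using ps_pos pj_pos pD c
        by (intro diff_mono add_mono mult_left_mono avg_mono) auto
    qed
    then show "\<exists>B. \<forall>\<eta>. \<eta> z \<noteq> Sleeping \<longrightarrow> mass V \<eta> \<le> C \<longrightarrow> R \<eta> - occ V {} z \<eta> \<le> B" for C
      by blast
    fix \<eta> :: "int ^ 'd \<Rightarrow> site_state"
    assume ns: "\<eta> z \<noteq> Sleeping"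
    show "R \<eta> - occ V {} z \<eta> \<le> 0 \<or> (\<exists>x\<in>V. act {} \<eta> x \<and>
        R \<eta> - occ V {} z \<eta> \<le> ev x (\<lambda>i. if execute V x i \<eta> z \<noteq> Sleeping then
          R (execute V x i \<eta>) - occ V {} z (execute V x i \<eta>) else 0))"
    proof (cases "stable V {z} \<eta>")
      case True
      show ?thesis
      proof (cases "stable V {} \<eta>")
        case True
        have "\<eta> z = Active 0"
          using stableD[OF True assms(2)] ns by simp
        then have a: "occ V {z} z \<eta> = 0" using \<open>stable V {z} \<eta>\<close> by (simp add: occ_stable)
        have "avg z (\<lambda>y. occ V {z} y \<eta> + 0 - 1) \<le> avg z (\<lambda>_. 0)" by (intro avg_mono) simp
        then have "(1 - pj / D) * avg z (\<lambda>y. occ V {z} y \<eta> + 0 - 1) \<le> 0"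
          using pD by (simp add: mult_nonneg_nonpos)
        then have "R \<eta> \<le> 0"
          unfolding R_def a using mult_nonneg_nonpos[OF c] by simp
        then show ?thesis using occ_bounds(1)[of V "{}" z \<eta>] by linarith
      next
        case False
        note z = stable_hold_cases[OF \<open>stable V {z} \<eta>\<close> False]
        let ?b = "\<lambda>y. of_bool (\<eta> y \<noteq> Active 0) :: real"
        have Rz: "R \<eta> = ps + ps * pj / D * (pj + (1 - pj / D) * avg z ?b)"
          using z(2) by (simp add: R_def occ_stable[OF \<open>stable V {z} \<eta>\<close>])
        have r: "ps / D * (pj + (1 - pj / D) * ?b y) \<le> occ V {} z (execute V z (Jump y) \<eta>)"
          if "y \<in> neighbors z" for y
          unfolding D_def using that assms(3)
          by (intro occ_return[OF assms(1) z(1) _ _ \<open>stable V {z} \<eta>\<close> z(2)]) auto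
        \<comment> \<open>Sleep ends the process with \<open>z\<close> occupied; a jump to
          \<open>y\<close> is handled by \<open>occ_return\<close>.\<close>
        have "occ V {} z \<eta> = ev z (\<lambda>i. occ V {} z (execute V z i \<eta>))"
          using z(2) by (intro occ_step[OF z(1)]) simp
        also have "\<dots> = ps * 1 + pj * avg z (\<lambda>y. occ V {} z (execute V z (Jump y) \<eta>))"
          unfolding ev_def execute_Sleep_lone[of \<eta> z, OF z(2)] using z(3) by (simp add: occ_stable)
        also have "\<dots> \<ge> ps * 1 + pj * avg z (\<lambda>y. ps / D * (pj + (1 - pj / D) * ?b y))"
          using pj_pos r by (intro add_left_mono mult_left_mono avg_mono) auto
        also have "avg z (\<lambda>y. ps / D * (pj + (1 - pj / D) * ?b y))
            = ps / D * (pj + (1 - pj / D) * avg z ?b)"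
          by (simp only: avg_cmult avg_add avg_const)
        finally show ?thesis unfolding Rz by (simp add: algebra_simps)
      qed
    next
      case False
      then obtain x where x: "x \<in> V" "act {z} \<eta> x" by (rule not_stableE)
      then have "x \<noteq> z \<or> act {z} \<eta> z" by auto
      then have n: "\<And>i. execute V x i \<eta> z \<noteq> Sleeping"
        using execute_not_Sleeping[of \<eta> z x V] ns by blast
      have "R \<eta> = ev x (\<lambda>i. R (execute V x i \<eta>))"
        unfolding R_def
        by (simp only: ev_add ev_cmult ev_avg ev_diff ev_const occ_step[OF x, symmetric])
      then have "R \<eta> - occ V {} z \<eta> \<le> ev x (\<lambda>i. R (execute V x i \<eta>) - occ V {} z (execute V x i \<eta>))"
        by (simp only: ev_diff occ_step_hold[OF x, of z, symmetric] order_refl)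
      with n show ?thesis
        by (rule submartingale_step[OF x, where F = "\<lambda>\<eta>. R \<eta> - occ V {} z \<eta>"
              and Inv = "\<lambda>\<eta>. \<eta> z \<noteq> Sleeping"])
    qed
  qed (use assms in auto)
  then show ?thesis by (simp add: R_def)
qed

text \<open>For small \<open>\<delta>\<close>, holding \<open>z\<close> makes \<open>z\<close>
  itself occupied with probability near 1 and each neighbor with probability at least about
  \<open>ps\<close>. These values are inserted into \<open>occ_lower_hold\<close>.\<close>

lemma occ_lower:
  fixes z :: "int ^ 'd::finite"
  assumes "finite V" "z \<in> V" "neighbors z \<subseteq> V" "\<eta> z \<noteq> Sleeping"
    and un: "\<And>y. y \<in> insert z (neighbors z) \<Longrightarrow> unused V {} y \<eta> \<le> \<delta>"
  shows "ps + ps * pj / (2 * real CARD('d)) * (1 - ps * pj / (2 * real CARD('d))) - 4 * \<delta>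
    \<le> occ V {} z \<eta>"
proof -
  define D where "D = 2 * real CARD('d)"
  define a where "a = occ V {z} z \<eta>"
  have D: "2 \<le> D" by (simp add: D_def Suc_le_eq)
  have pD: "0 \<le> 1 - pj / D" using D ps_pos pj_pos ps_pj by (simp add: field_simps)
  have pD1: "1 - pj / D \<le> 1" using D pj_pos by simp
  have c: "0 \<le> ps * pj / D" using D ps_pos pj_pos by simp
  have "ps * pj \<le> 1 * 1" using ps_pos pj_pos ps_pj by (intro mult_mono) auto
  then have c1: "ps * pj / D \<le> 1" using D by (simp add: field_simps)
  have d0: "0 \<le> \<delta>" using un[of z] unused_bounds(1)[of V "{}" z \<eta>] by (meson insertI1 order_trans)
  have a1: "1 - \<delta> \<le> a"
    using occ_hold_ge_used[OF assms(1,2), of \<eta>] un[of z] by (simp add: a_def)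
  \<comment> \<open>One \<open>\<delta>\<close> is lost at \<open>y\<close>, through
    \<open>unused_hold\<close>, and one at \<open>z\<close>.\<close>
  have y1: "ps - 2 * \<delta> \<le> occ V {z} y \<eta> + a - 1" if "y \<in> neighbors z" for y
  proof -
    have yz: "y \<noteq> z" "y \<in> V" using that assms(3) by auto
    have "ps * (1 - unused V {z} y \<eta>) \<le> occ V {z} y \<eta>"
      using yz by (intro occ_ge_used assms(1)) auto
    moreover have "ps * unused V {z} y \<eta> \<le> \<delta>"
      using unused_hold[OF assms(1) yz(1), of \<eta>] un[of y] that by simp
    ultimately show ?thesis using a1 by (simp add: algebra_simps)
  qed
  have "avg z (\<lambda>_. ps - 2 * \<delta>) \<le> avg z (\<lambda>y. occ V {z} y \<eta> + a - 1)"
    using y1 by (intro avg_mono)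
  then have A: "ps - 2 * \<delta> \<le> avg z (\<lambda>y. occ V {z} y \<eta> + a - 1)" by simp
  have "ps * (1 - \<delta>) + ps * pj / D * (pj * (1 - \<delta>) + (1 - pj / D) * (ps - 2 * \<delta>))
      \<le> ps * a + ps * pj / D * (pj * a + (1 - pj / D) * avg z (\<lambda>y. occ V {z} y \<eta> + a - 1))"
    using a1 A ps_pos pj_pos pD c by (intro add_mono mult_left_mono) auto
  also have "\<dots> \<le> occ V {} z \<eta>"
    using occ_lower_hold[of V z \<eta>, OF assms(1-4)] by (simp add: a_def D_def)
  finally have main: "ps * (1 - \<delta>) + ps * pj / D * (pj * (1 - \<delta>) + (1 - pj / D) * (ps - 2 * \<delta>))
      \<le> occ V {} z \<eta>" .
  \<comment> \<open>All coefficients are at most 1, which leaves a total error of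
    \<open>\<delta> + (\<delta> + 2 * \<delta>)\<close>.\<close>
  have small: "ps * \<delta> + ps * pj / D * (pj * \<delta> + (1 - pj / D) * (2 * \<delta>))
      \<le> 1 * \<delta> + 1 * (1 * \<delta> + 1 * (2 * \<delta>))"
    using d0 c c1 pD pD1 ps_pj ps_pos pj_pos by (intro add_mono mult_mono add_nonneg_nonneg mult_nonneg_nonneg) auto
  have e: "1 - ps * pj / D = pj + (1 - pj / D) * ps"
    using ps_pj by (simp add: algebra_simps)
  have "ps + ps * pj / D * (1 - ps * pj / D) - (1 * \<delta> + 1 * (1 * \<delta> + 1 * (2 * \<delta>)))
      \<le> ps + ps * pj / D * (1 - ps * pj / D)
        - (ps * \<delta> + ps * pj / D * (pj * \<delta> + (1 - pj / D) * (2 * \<delta>)))"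
    using small by (rule diff_left_mono)
  also have "\<dots> = ps * (1 - \<delta>) + ps * pj / D * (pj * (1 - \<delta>) + (1 - pj / D) * (ps - 2 * \<delta>))"
    unfolding e by (simp add: algebra_simps add_divide_distrib)
  also note main
  finally have "ps + ps * pj / D * (1 - ps * pj / D) - 4 * \<delta> \<le> occ V {} z \<eta>" by simp
  then show ?thesis by (simp add: D_def)
qed

end

section \<open>Green functions of the killed random walk\<close>

text \<open>The probability that simple random walk from \<open>x\<close>, killed on leaving
  \<open>V\<close>, is at \<open>w\<close> after \<open>k\<close> steps.\<close>

fun kill :: "(int ^ 'd::finite) set \<Rightarrow> int ^ 'd \<Rightarrow> nat \<Rightarrow> int ^ 'd \<Rightarrow> real" where
  "kill V w 0 x = of_bool (x = w \<and> x \<in> V)"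
| "kill V w (Suc k) x = (if x \<in> V then avg x (kill V w k) else 0)"

definition green :: "(int ^ 'd::finite) set \<Rightarrow> int ^ 'd \<Rightarrow> int ^ 'd \<Rightarrow> real" where
  "green V w x = (\<Sum>k. kill V w k x)"

lemma avg_nonneg: "(\<And>y. 0 \<le> f y) \<Longrightarrow> 0 \<le> avg x f"
  using avg_mono[of x "\<lambda>_. 0" f] by simp

lemma kill_nonneg: "0 \<le> kill V w k x"
  by (induction k arbitrary: x) (auto intro: avg_nonneg)

lemma kill_outside: "x \<notin> V \<Longrightarrow> kill V w k x = 0"
  by (cases k) auto

text \<open>The exit potential dominates all partial sums, since
  \<open>1 + avg x g \<le> g x\<close> on \<open>V\<close>.\<close>

lemma summable_kill:
  assumes "finite V"
  shows "summable (\<lambda>k. kill V w k x)"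
proof -
  obtain g :: "int ^ 'a \<Rightarrow> real" where g: "\<And>z. 0 \<le> g z" "\<And>z. z \<notin> V \<Longrightarrow> g z = 0"
    "\<And>x. x \<in> V \<Longrightarrow> avg x g \<le> g x - 1"
    using exit_potential[OF assms] by blast
  have "(\<Sum>k<n. kill V w k x) \<le> g x" for n
  proof (induction n arbitrary: x)
    case 0
    then show ?case using g(1) by simp
  next
    case (Suc n)
    show ?case
    proof (cases "x \<in> V")
      case True
      have "(\<Sum>k<Suc n. kill V w k x) = kill V w 0 x + (\<Sum>k<n. kill V w (Suc k) x)"
        by (rule sum.lessThan_Suc_shift)
      also have "\<dots> \<le> 1 + avg x (\<lambda>y. \<Sum>k<n. kill V w k y)"
        using True by (simp add: avg_sum)
      also have "\<dots> \<le> 1 + avg x g" using Suc.IH by (intro add_left_mono avg_mono)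
      finally show ?thesis using g(3)[OF True] by simp
    next
      case False
      then show ?thesis using g(1) kill_outside[OF False] by simp
    qed
  qed
  then show ?thesis by (intro summableI_nonneg_bounded kill_nonneg)
qed

lemma green_nonneg: "finite V \<Longrightarrow> 0 \<le> green V w x"
  unfolding green_def by (intro suminf_nonneg summable_kill kill_nonneg)

lemma green_outside: "x \<notin> V \<Longrightarrow> green V w x = 0"
  by (simp add: green_def kill_outside)

lemma green_eq:
  assumes "finite V" "x \<in> V"
  shows "green V w x = of_bool (x = w) + avg x (green V w)"
proof -
  have "green V w x = kill V w 0 x + (\<Sum>k. kill V w (Suc k) x)"
    unfolding green_def using suminf_split_head[OF summable_kill[OF assms(1), of w x]] by simp
  also have "(\<Sum>k. kill V w (Suc k) x) = avg x (green V w)"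
    unfolding green_def avg_def using assms
    by (simp add: avg_def suminf_divide summable_sum summable_kill suminf_sum)
  finally show ?thesis using assms(2) by simp
qed

lemma green_avg_diff:
  "finite V \<Longrightarrow> x \<in> V \<Longrightarrow> avg x (green V w) - green V w x = - of_bool (x = w)"
  using green_eq[of V x w] by simp

text \<open>Compare with the exit potential \<open>g\<close> at a point \<open>z\<close> where
  \<open>E / g\<close> is largest. If the maximum \<open>c\<close> were positive, averaging would
  give \<open>E z \<le> c * (g z - 1) < E z\<close>.\<close>

lemma walk_maximum_principle:
  fixes E :: "int ^ 'd::finite \<Rightarrow> real"
  assumes fin: "finite V" and out: "\<And>x. x \<notin> V \<Longrightarrow> E x = 0"
    and sub: "\<And>x. x \<in> V \<Longrightarrow> E x \<le> avg x E"
  shows "E x \<le> 0"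
proof (rule ccontr)
  assume pos: "\<not> E x \<le> 0"
  obtain g :: "int ^ 'd \<Rightarrow> real" where g: "\<And>z. 0 \<le> g z" "\<And>z. z \<notin> V \<Longrightarrow> g z = 0"
    "\<And>x. x \<in> V \<Longrightarrow> avg x g \<le> g x - 1"
    using exit_potential[OF fin] by blast
  have g1: "1 \<le> g z" if "z \<in> V" for z using g(3)[OF that] avg_nonneg[of g z] g(1) by auto
  have xV: "x \<in> V" using pos out[of x] by auto
  have "Max ((\<lambda>z. E z / g z) ` V) \<in> (\<lambda>z. E z / g z) ` V" using fin xV by (intro Max_in) auto
  then obtain z where z: "z \<in> V" "Max ((\<lambda>z. E z / g z) ` V) = E z / g z" by blast
  have max: "E y / g y \<le> E z / g z" if "y \<in> V" for y
    unfolding z(2)[symmetric] using fin that by (intro Max_ge) auto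
  define c where "c = E z / g z"
  have "0 < E x / g x" using pos g1[OF xV] by simp
  then have c0: "0 < c" using max[OF xV] unfolding c_def by linarith
  have Ec: "E y \<le> c * g y" for y
  proof (cases "y \<in> V")
    case True
    have "E y / g y \<le> c" using max[OF True] by (simp add: c_def)
    then show ?thesis using g1[OF True] by (simp add: pos_divide_le_eq)
  next
    case False
    then show ?thesis using out g(2) by simp
  qed
  have "E z \<le> avg z (\<lambda>y. c * g y)" using sub[OF z(1)] avg_mono[of z E "\<lambda>y. c * g y"] Ec
    by (meson order_trans)
  also have "\<dots> \<le> c * (g z - 1)" using g(3)[OF z(1)] c0 by (simp add: avg_cmult)
  also have "\<dots> < c * g z" using c0 by simp
  also have "c * g z = E z" using g1[OF z(1)] by (simp add: c_def)
  finally show False by simp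
qed

lemma neighbors_translate: "neighbors x = (+) x ` neighbors (0 :: int ^ 'd::finite)"
  by (auto simp: neighbors_eq image_iff)

lemma avg_translate: "avg x f = avg 0 (\<lambda>e. f (x + e))"
proof -
  have "sum f (neighbors x) = (\<Sum>e\<in>neighbors 0. f (x + e))"
    unfolding neighbors_translate[of x] by (subst sum.reindex) auto
  then show ?thesis by (simp add: avg_def)
qed

section \<open>Return probabilities of simple random walk\<close>

definition hit :: "nat \<Rightarrow> int ^ 'd::finite \<Rightarrow> real" where
  "hit k z = measure (srw_steps :: (nat \<Rightarrow> int ^ 'd) measure) {\<xi>. walk \<xi> k = z}"

lemma space_srw [simp]: "space (srw_steps :: (nat \<Rightarrow> int ^ 'd::finite) measure) = UNIV"
  by (auto simp: srw_steps_def space_PiM)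

lemma prob_space_srw: "prob_space (srw_steps :: (nat \<Rightarrow> int ^ 'd::finite) measure)"
  unfolding srw_steps_def by (rule prob_space_PiM) (rule prob_space_measure_pmf)

lemma measurable_step [measurable]:
  "(\<lambda>\<xi>. \<xi> n) \<in> (srw_steps :: (nat \<Rightarrow> int ^ 'd::finite) measure) \<rightarrow>\<^sub>M count_space UNIV"
proof -
  have "(\<lambda>\<xi>. \<xi> n) \<in> (srw_steps :: (nat \<Rightarrow> int ^ 'd) measure) \<rightarrow>\<^sub>M
      measure_pmf (pmf_of_set (neighbors 0))"
    unfolding srw_steps_def by (rule measurable_component_singleton) simp
  then show ?thesis by simp
qed

lemma measurable_walk [measurable]:
  "(\<lambda>\<xi>. walk \<xi> n) \<in> (srw_steps :: (nat \<Rightarrow> int ^ 'd::finite) measure) \<rightarrow>\<^sub>M count_space UNIV"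
proof (induction n)
  case 0
  then show ?case by (simp add: walk_def)
next
  case (Suc n)
  have "(\<lambda>\<xi>. walk \<xi> n + \<xi> n) \<in> (srw_steps :: (nat \<Rightarrow> int ^ 'd) measure) \<rightarrow>\<^sub>M count_space UNIV"
  proof (rule measurable_compose_countable[where f = "\<lambda>a \<xi>. a + \<xi> n"])
    show "(\<lambda>\<xi>. a + \<xi> n) \<in> (srw_steps :: (nat \<Rightarrow> int ^ 'd) measure) \<rightarrow>\<^sub>M count_space UNIV" for a
      by (rule measurable_compose[OF measurable_step]) simp
  qed (rule Suc.IH)
  then show ?case by (simp add: walk_def)
qed

lemma sets_hit [measurable]:
  "{\<xi>. walk \<xi> k = z} \<in> sets (srw_steps :: (nat \<Rightarrow> int ^ 'd::finite) measure)"
proof -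
  have "Measurable.pred (srw_steps :: (nat \<Rightarrow> int ^ 'd) measure) (\<lambda>\<xi>. walk \<xi> k = z)"
    by measurable
  then show ?thesis by (simp add: pred_def)
qed

text \<open>Splits off the first step: prepending an independent step to a sequence of steps does
  not change its law.\<close>

lemma hit_Suc: "hit (Suc k) z = avg 0 (\<lambda>e :: int ^ 'd::finite. hit k (z - e))"
proof -
  let ?S = "srw_steps :: (nat \<Rightarrow> int ^ 'd) measure"
  let ?M = "measure_pmf (pmf_of_set (neighbors (0 :: int ^ 'd)))"
  interpret prob_space ?S by (rule prob_space_srw)
  interpret M: prob_space ?M by (rule prob_space_measure_pmf)
  interpret Q: sequence_space ?M ..
  have S: "Q.S = ?S" by (simp add: srw_steps_def)
  have D: "distr (?M \<Otimes>\<^sub>M ?S) ?S (\<lambda>(s, \<omega>). case_nat s \<omega>) = ?S"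
    using Q.PiM_iter by (simp add: S)
  have M1: "(\<lambda>(s, \<omega>). case_nat s \<omega>) \<in> ?M \<Otimes>\<^sub>M ?S \<rightarrow>\<^sub>M ?S"
    unfolding S[symmetric] by measurable
  have w: "walk (case_nat e \<omega>) (Suc k) = e + walk \<omega> k" for e :: "int ^ 'd" and \<omega>
    by (simp add: walk_def sum.lessThan_Suc_shift del: sum.lessThan_Suc)
  have "emeasure ?S {\<xi>. walk \<xi> (Suc k) = z}
      = emeasure (distr (?M \<Otimes>\<^sub>M ?S) ?S (\<lambda>(s, \<omega>). case_nat s \<omega>)) {\<xi>. walk \<xi> (Suc k) = z}"
    by (simp add: D)
  also have "\<dots> = emeasure (?M \<Otimes>\<^sub>M ?S)
      ((\<lambda>(s, \<omega>). case_nat s \<omega>) -` {\<xi>. walk \<xi> (Suc k) = z} \<inter> space (?M \<Otimes>\<^sub>M ?S))"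
    by (rule emeasure_distr[OF M1 sets_hit])
  also have "\<dots> = (\<integral>\<^sup>+ e. emeasure ?S (Pair e -` ((\<lambda>(s, \<omega>). case_nat s \<omega>) -`
      {\<xi>. walk \<xi> (Suc k) = z} \<inter> space (?M \<Otimes>\<^sub>M ?S))) \<partial>?M)"
    by (rule emeasure_pair_measure_alt[OF measurable_sets[OF M1 sets_hit]])
  also have "\<dots> = (\<integral>\<^sup>+ e. emeasure ?S {\<xi>. walk \<xi> k = z - e} \<partial>?M)"
    by (intro nn_integral_cong arg_cong[where f = "emeasure _"])
      (auto simp: space_pair_measure w algebra_simps)
  also have "\<dots> = (\<integral>\<^sup>+ e. ennreal (hit k (z - e)) \<partial>?M)"
    by (simp add: hit_def emeasure_eq_measure)
  also have "\<dots> = ennreal (\<integral> e. hit k (z - e) \<partial>?M)"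
    by (intro nn_integral_eq_integral measure_pmf.integrable_const_bound[where B = 1])
      (auto simp: hit_def)
  finally have "hit (Suc k) z = (\<integral> e. hit k (z - e) \<partial>?M)"
    by (simp add: hit_def emeasure_eq_measure)
  also have "\<dots> = avg 0 (\<lambda>e. hit k (z - e))"
    by (subst integral_pmf_of_set)
      (auto simp: finite_neighbors neighbors_nonempty avg_def card_neighbors)
  finally show ?thesis .
qed

lemma hit_nonneg: "0 \<le> hit k z"
  by (simp add: hit_def)

lemma kill_le_hit: "kill V w k x \<le> hit k (w - x)"
proof (induction k arbitrary: x)
  case 0
  have "hit 0 (0 :: int ^ 'a) = 1"
    using prob_space.prob_space[OF prob_space_srw] by (simp add: hit_def walk_def)
  then show ?case using hit_nonneg[of 0 "w - x"] by auto
next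
  case (Suc k)
  have "avg x (kill V w k) \<le> avg x (\<lambda>y. hit k (w - y))" by (intro avg_mono Suc.IH)
  also have "\<dots> = hit (Suc k) (w - x)"
    by (simp add: hit_Suc avg_translate[of x] diff_diff_eq)
  finally show ?case using hit_nonneg[of "Suc k" "w - x"] by simp
qed

lemma expected_returns_eq:
  "expected_returns TYPE('d::finite) = (\<Sum>n. ennreal (hit (Suc n) (0 :: int ^ 'd)))"
proof -
  let ?S = "srw_steps :: (nat \<Rightarrow> int ^ 'd) measure"
  interpret prob_space ?S by (rule prob_space_srw)
  have "ennreal_of_enat (returns \<xi>) = (\<Sum>n. indicator {\<xi>. walk \<xi> (Suc n) = 0} \<xi>)"
    for \<xi> :: "nat \<Rightarrow> int ^ 'd"
  proof -
    let ?A = "{n. n \<ge> 1 \<and> walk \<xi> n = 0}"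
    let ?B = "{n. walk \<xi> (Suc n) = 0}"
    have A: "?A = Suc ` ?B" by (auto simp: image_iff) (metis Suc_pred One_nat_def Suc_le_lessD)
    then have "finite ?A = finite ?B" "card ?A = card ?B"
      by (simp_all add: finite_image_iff card_image)
    \<comment> \<open>Counting measure is infinite on infinite sets, which matches the convention in
      \<open>returns\<close>.\<close>
    then have "ennreal_of_enat (returns \<xi>) = emeasure (count_space UNIV) ?B"
      by (auto simp: returns_def emeasure_count_space ennreal_of_nat_eq_real_of_nat
          ennreal_of_enat_def)
    also have "\<dots> = (\<integral>\<^sup>+ n. indicator ?B n \<partial>count_space UNIV)" by simp
    also have "\<dots> = (\<Sum>n. indicator ?B n)" by (rule nn_integral_count_space_nat)
    also have "\<dots> = (\<Sum>n. indicator {\<xi>. walk \<xi> (Suc n) = 0} \<xi>)"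
      by (intro suminf_cong) (auto simp: indicator_def)
    finally show ?thesis .
  qed
  then have "expected_returns TYPE('d) = (\<integral>\<^sup>+ \<xi>. (\<Sum>n. indicator {\<xi>. walk \<xi> (Suc n) = 0} \<xi>) \<partial>?S)"
    by (simp add: expected_returns_def)
  also have "\<dots> = (\<Sum>n. \<integral>\<^sup>+ \<xi>. indicator {\<xi>. walk \<xi> (Suc n) = 0} \<xi> \<partial>?S)"
    by (rule nn_integral_suminf) (auto intro!: borel_measurable_indicator)
  also have "\<dots> = (\<Sum>n. ennreal (hit (Suc n) (0 :: int ^ 'd)))"
    by (simp add: hit_def emeasure_eq_measure)
  finally show ?thesis .
qed

text \<open>Time 0 contributes at most 1, and at each later time the killed walk is at
  \<open>w\<close> with at most the return probability of the free walk.\<close>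

lemma green_le_expected_returns:
  fixes w :: "int ^ 'd::finite"
  assumes "finite V"
  shows "ennreal (green V w w) \<le> 1 + expected_returns TYPE('d)"
proof -
  have sm: "summable (\<lambda>k. kill V w (Suc k) w)"
    by (subst summable_Suc_iff) (rule summable_kill[OF assms])
  have "green V w w = kill V w 0 w + (\<Sum>k. kill V w (Suc k) w)"
    unfolding green_def using suminf_split_head[OF summable_kill[OF assms, of w w]] by simp
  also have "\<dots> \<le> 1 + (\<Sum>k. kill V w (Suc k) w)" by simp
  finally have "ennreal (green V w w) \<le> ennreal (1 + (\<Sum>k. kill V w (Suc k) w))"
    by (rule ennreal_leI)
  also have "\<dots> = 1 + ennreal (\<Sum>k. kill V w (Suc k) w)"
    using sm by (subst ennreal_plus) (auto intro!: suminf_nonneg kill_nonneg simp del: kill.simps)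
  also have "ennreal (\<Sum>k. kill V w (Suc k) w) = (\<Sum>k. ennreal (kill V w (Suc k) w))"
    using sm by (intro suminf_ennreal2[symmetric]) (auto intro!: kill_nonneg simp del: kill.simps)
  also have "\<dots> \<le> expected_returns TYPE('d)"
    unfolding expected_returns_eq
    using kill_le_hit[of V w _ w] by (intro suminf_le ennreal_leI) (auto simp del: kill.simps)
  finally show ?thesis by simp
qed

section \<open>Boxes and the total mass of the Green function\<close>

lemma finite_box [simp]: "finite (box n :: (int ^ 'd::finite) set)"
proof -
  have "box n \<subseteq> vec_lambda ` (PiE (UNIV :: 'd set) (\<lambda>_. {- int n..int n}))"
  proof
    fix x :: "int ^ 'd" assume "x \<in> box n"
    then have "x = vec_lambda (\<lambda>i. x $ i)" "(\<lambda>i. x $ i) \<in> PiE UNIV (\<lambda>_. {- int n..int n})"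
      by (auto simp: box_def abs_le_iff minus_le_iff)
    then show "x \<in> vec_lambda ` (PiE (UNIV :: 'd set) (\<lambda>_. {- int n..int n}))" by blast
  qed
  then show ?thesis by (rule finite_subset) (auto intro!: finite_imageI finite_PiE)
qed

lemma zero_in_box [simp]: "0 \<in> box n"
  by (simp add: box_def)

lemma box_mono: "m \<le> n \<Longrightarrow> box m \<subseteq> (box n :: (int ^ 'd::finite) set)"
proof
  fix x :: "int ^ 'd" assume mn: "m \<le> n" and x: "x \<in> box m"
  have "\<bar>x $ i\<bar> \<le> int n" for i
  proof -
    have "\<bar>x $ i\<bar> \<le> int m" using x by (simp add: box_def)
    then show ?thesis using mn by linarith
  qed
  then show "x \<in> box n" by (simp add: box_def)
qed

lemma neighbor_box: "x \<in> box k \<Longrightarrow> y \<in> neighbors x \<Longrightarrow> y \<in> box (Suc k)"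
proof -
  assume x: "x \<in> box k" and y: "y \<in> neighbors x"
  have "\<bar>y $ i\<bar> \<le> int (Suc k)" for i
  proof -
    have "\<bar>x $ i\<bar> \<le> int k" using x by (simp add: box_def)
    moreover have "\<bar>y $ i - x $ i\<bar> \<le> 1" using y by (auto simp: neighbors_eq axis_def)
    ultimately show ?thesis by linarith
  qed
  then show ?thesis by (simp add: box_def)
qed

text \<open>Before time \<open>n\<close> the walk started at the origin has not left the box of radius \<open>n\<close>.\<close>

lemma sum_green_ge: "real n \<le> (\<Sum>x\<in>box n. green (box n) (0 :: int ^ 'd::finite) x)"
proof -
  let ?V = "box n :: (int ^ 'd) set"
  let ?k = "kill ?V 0"
  have supp: "x \<in> box k" if "?k k x \<noteq> 0" for k x
    using that
  proof (induction k arbitrary: x)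
    case 0
    then show ?case by (auto split: if_splits)
  next
    case (Suc k)
    have "\<exists>y\<in>neighbors x. ?k k y \<noteq> 0"
    proof (rule ccontr)
      assume "\<not> (\<exists>y\<in>neighbors x. ?k k y \<noteq> 0)"
      then have "avg x (?k k) = 0" by (simp add: avg_def)
      then show False using Suc.prems by (simp split: if_splits)
    qed
    then obtain y where "y \<in> neighbors x" "?k k y \<noteq> 0" by blast
    then show ?case using Suc.IH neighbor_box neighbors_sym by metis
  qed
  \<comment> \<open>Summing over the starting point preserves mass because the step is symmetric:
    each value at \<open>y\<close> is shared among its neighbors, all of which lie in the box while
    \<open>k < n\<close>.\<close>
  have one: "(\<Sum>x\<in>?V. ?k k x) = 1" if "k \<le> n" for k
    using that
  proof (induction k)
    case 0
    have "(\<Sum>x\<in>?V. ?k 0 x) = (\<Sum>x\<in>?V. if x = 0 then 1 else 0)" by (rule sum.cong) auto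
    then show ?case by simp
  next
    case (Suc k)
    let ?c = "2 * real CARD('d)"
    have "(\<Sum>x\<in>?V. ?k (Suc k) x) = (\<Sum>x\<in>?V. (\<Sum>y\<in>?V. if y \<in> neighbors x then ?k k y else 0) / ?c)"
    proof (rule sum.cong[OF refl])
      fix x assume "x \<in> ?V"
      have "(\<Sum>y\<in>?V. if y \<in> neighbors x then ?k k y else 0) = (\<Sum>y\<in>?V \<inter> neighbors x. ?k k y)"
        by (simp add: sum.inter_restrict)
      also have "\<dots> = (\<Sum>y\<in>neighbors x. ?k k y)"
        using kill_outside[of _ ?V 0 k] finite_neighbors[of x]
        by (intro sum.mono_neutral_left) blast+
      finally show "?k (Suc k) x = (\<Sum>y\<in>?V. if y \<in> neighbors x then ?k k y else 0) / ?c"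
        using \<open>x \<in> ?V\<close> by (simp add: avg_def)
    qed
    also have "\<dots> = (\<Sum>y\<in>?V. (\<Sum>x\<in>?V. if y \<in> neighbors x then ?k k y else 0)) / ?c"
      unfolding sum_divide_distrib[symmetric] by (subst sum.swap) simp
    also have "\<dots> = (\<Sum>y\<in>?V. ?c * ?k k y) / ?c"
    proof -
      have "(\<Sum>x\<in>?V. if y \<in> neighbors x then ?k k y else 0) = ?c * ?k k y" for y
      proof (cases "?k k y = 0")
        case False
        then have "y \<in> box k" by (rule supp)
        then have "neighbors y \<subseteq> ?V"
          using neighbor_box[of y k] box_mono[of "Suc k" n] Suc.prems by blast
        then have "{x \<in> ?V. y \<in> neighbors x} = neighbors y" using neighbors_sym by blast
        then have "(\<Sum>x\<in>?V. if y \<in> neighbors x then ?k k y else 0) = (\<Sum>x\<in>neighbors y. ?k k y)"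
          by (simp add: sum.inter_filter[symmetric])
        then show ?thesis by (simp add: card_neighbors)
      qed (simp cong: if_cong)
      then show ?thesis by simp
    qed
    also have "\<dots> = 1" using Suc by (simp add: sum_distrib_left[symmetric])
    finally show ?case .
  qed
  have "real n = (\<Sum>k<n. \<Sum>x\<in>?V. ?k k x)" using one by simp
  also have "\<dots> = (\<Sum>x\<in>?V. \<Sum>k<n. ?k k x)" by (rule sum.swap)
  also have "\<dots> \<le> (\<Sum>x\<in>?V. green ?V 0 x)"
    unfolding green_def by (intro sum_mono sum_le_suminf summable_kill) (auto intro: kill_nonneg)
  finally show ?thesis .
qed

section \<open>Mass balance and the upper bound\<close>

definition add_at :: "'s \<Rightarrow> ('s \<Rightarrow> site_state) \<Rightarrow> 's \<Rightarrow> site_state" where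
  "add_at x \<eta> = \<eta>(x := add_particle (\<eta> x))"

lemma add_at_same [simp]: "add_at x \<eta> x = add_particle (\<eta> x)"
  by (simp add: add_at_def)

lemma add_at_other [simp]: "z \<noteq> x \<Longrightarrow> add_at x \<eta> z = \<eta> z"
  by (simp add: add_at_def)

lemma execute_add_at_other:
  assumes "x \<noteq> y"
  shows "execute V x i (add_at y \<eta>) = add_at y (execute V x i \<eta>)"
  using assms by (cases i) (auto simp: execute.simps add_at_def Let_def fun_eq_iff)

lemma execute_Jump_add_at:
  assumes "act {} \<eta> y" "z \<noteq> y"
  shows "execute V y (Jump z) (add_at y \<eta>) = add_at y (execute V y (Jump z) \<eta>)"
proof -
  obtain n where "\<eta> y = Active (Suc n)"
    using assms(1) by (cases "\<eta> y") (auto simp: gr0_conv_Suc)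
  then show ?thesis using assms(2) by (auto simp: execute.simps add_at_def Let_def fun_eq_iff)
qed

lemma execute_Sleep_many:
  assumes "act {y} \<eta> y"
  shows "execute V y Sleep \<eta> = \<eta>"
  using assms by (auto simp: execute.simps act_def fun_eq_iff)

lemma act_add_at_same: "act {} \<eta> y \<Longrightarrow> act {y} (add_at y \<eta>) y"
  by (cases "\<eta> y") (auto simp: act_def)

context arw
begin

definition loss :: "(int ^ 'd::finite) set \<Rightarrow> (int ^ 'd) set \<Rightarrow> int ^ 'd
    \<Rightarrow> (int ^ 'd \<Rightarrow> site_state) \<Rightarrow> real" where
  "loss V H w \<eta> = wt V (green V w) \<eta> - (\<Sum>z\<in>V. green V w z * occ V H z \<eta>)"

text \<open>Thus \<open>loss\<close> is the expected number of particles jumping out of \<open>w\<close>.\<close>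

lemma loss_step:
  assumes "finite V" "x \<in> V" "act H \<eta> x"
  shows "loss V H w \<eta> = ev x (\<lambda>i. loss V H w (execute V x i \<eta>)) + pj * of_bool (x = w)"
proof -
  have "ev x (\<lambda>i. wt V (green V w) (execute V x i \<eta>)) = wt V (green V w) \<eta> - pj * of_bool (x = w)"
    by (subst ev_wt[OF assms(1,2) act_mono_hold[OF assms(3)] green_outside])
      (simp_all add: green_avg_diff[OF assms(1,2)])
  then show ?thesis
    by (simp only: loss_def ev_diff ev_sum ev_cmult occ_step[OF assms(2,3), symmetric])
qed

text \<open>In a stable configuration a site of \<open>V\<close> holds at most one particle, so its
  count is its occupation indicator.\<close>

lemma loss_stable:
  assumes "stable V H \<eta>"
  shows "loss V H w \<eta> = 0"
proof -
  have "real (cnt (\<eta> z)) = occ V H z \<eta>" if "z \<in> V" for z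
    using stableD[OF assms that]
    by (cases "\<eta> z") (auto simp: occ_stable[OF assms] act_def split: if_splits)
  then show ?thesis by (simp add: loss_def wt_def)
qed

lemma loss_le_wt: "finite V \<Longrightarrow> loss V H w \<eta> \<le> wt V (green V w) \<eta>"
  unfolding loss_def by (simp add: sum_nonneg green_nonneg)

lemma loss_le_mass:
  assumes "finite V" "mass V \<eta> \<le> C"
  shows "loss V H w \<eta> \<le> (\<Sum>z\<in>V. \<bar>green V w z\<bar>) * real C"
proof -
  have "loss V H w \<eta> \<le> (\<Sum>z\<in>V. \<bar>green V w z\<bar>) * mass V \<eta>"
    using loss_le_wt[OF assms(1), of H w \<eta>] wt_bound[OF assms(1), of "green V w" \<eta>] by linarith
  also have "\<dots> \<le> (\<Sum>z\<in>V. \<bar>green V w z\<bar>) * real C"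
    using assms(2) by (intro mult_left_mono sum_nonneg) auto
  finally show ?thesis .
qed

lemma loss_nonneg:
  assumes "finite V"
  shows "0 \<le> loss V H w \<eta>"
proof -
  have "- loss V H w \<eta> \<le> 0"
  proof (rule maximum_principle_config[where Inv = "\<lambda>_. True"
        and F = "\<lambda>\<eta>. - loss V H w \<eta>", OF assms])
    have "- loss V H w \<eta> \<le> (\<Sum>z\<in>V. green V w z * 1)" for \<eta>
    proof -
      have "- loss V H w \<eta> \<le> (\<Sum>z\<in>V. green V w z * occ V H z \<eta>)"
        using wt_nonneg[of V "green V w" \<eta>] green_nonneg[OF assms] by (simp add: loss_def)
      also have "\<dots> \<le> (\<Sum>z\<in>V. green V w z * 1)"
        using green_nonneg[OF assms] by (intro sum_mono mult_left_mono) auto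
      finally show ?thesis .
    qed
    then show "\<exists>B. \<forall>\<eta>. True \<longrightarrow> mass V \<eta> \<le> C \<longrightarrow> - loss V H w \<eta> \<le> B" for C by blast
    fix \<eta> :: "int ^ 'a \<Rightarrow> site_state"
    show "- loss V H w \<eta> \<le> 0 \<or> (\<exists>x\<in>V. act {} \<eta> x \<and>
        - loss V H w \<eta> \<le> ev x (\<lambda>i. if True then - loss V H w (execute V x i \<eta>) else 0))"
    proof (cases "stable V H \<eta>")
      case True
      then show ?thesis by (simp add: loss_stable)
    next
      case False
      then obtain x where x: "x \<in> V" "act H \<eta> x" by (rule not_stableE)
      have "- loss V H w \<eta> = ev x (\<lambda>i. - 1 * loss V H w (execute V x i \<eta>)) - pj * of_bool (x = w)"
        unfolding ev_cmult by (subst loss_step[OF assms x]) simp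
      also have "\<dots> \<le> ev x (\<lambda>i. - loss V H w (execute V x i \<eta>))" using pj_pos by simp
      finally show ?thesis
        by (rule submartingale_step[OF x TrueI, where F = "\<lambda>\<eta>. - loss V H w \<eta>"])
    qed
  qed auto
  then show ?thesis by simp
qed

lemma wt_add_at: "finite V \<Longrightarrow> x \<in> V \<Longrightarrow> wt V f (add_at x \<eta>) = wt V f \<eta> + f x"
  unfolding add_at_def by (rule wt_add_particle)

section \<open>An extra particle held at one site\<close>

text \<open>The extra particle would make a difference by preventing a lone particle at
  \<open>y\<close> from falling asleep; the last assumption excludes that toppling.\<close>

lemma step_add_at:
  assumes "x \<in> V" "act {} \<eta> x" "x \<noteq> y \<or> act {y} \<eta> y"
  shows "act {y} (add_at y \<eta>) x" "\<And>i. i = Sleep \<or> (\<exists>z\<in>neighbors x. i = Jump z) \<Longrightarrow>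
    execute V x i (add_at y \<eta>) = add_at y (execute V x i \<eta>)"
proof -
  show "act {y} (add_at y \<eta>) x"
    using assms(2) act_add_at_same[of \<eta> y] by (cases "x = y") (auto simp: act_def)
  fix i assume i: "i = Sleep \<or> (\<exists>z\<in>neighbors x. i = Jump z)"
  show "execute V x i (add_at y \<eta>) = add_at y (execute V x i \<eta>)"
  proof (cases "x = y")
    case False
    then show ?thesis by (rule execute_add_at_other)
  next
    case True
    then have y: "act {y} \<eta> y" using assms(3) by simp
    have y': "act {y} (add_at y \<eta>) y" using assms(2) True act_add_at_same by metis
    have J: "execute V y (Jump z) (add_at y \<eta>) = add_at y (execute V y (Jump z) \<eta>)"
      if "z \<in> neighbors y" for z
      using that assms(2) True by (intro execute_Jump_add_at) auto
    show ?thesis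
      using i J unfolding True by (auto simp: execute_Sleep_many[OF y] execute_Sleep_many[OF y'])
  qed
qed

lemma loss_step_add_at:
  assumes "finite V" "x \<in> V" "act {} \<eta> x" "x \<noteq> y \<or> act {y} \<eta> y"
  shows "loss V {y} y (add_at y \<eta>)
    = ev x (\<lambda>i. loss V {y} y (add_at y (execute V x i \<eta>))) + pj * of_bool (x = y)"
proof -
  note s = step_add_at[OF assms(2,3,4)]
  have "ev x (\<lambda>i. loss V {y} y (execute V x i (add_at y \<eta>)))
      = ev x (\<lambda>i. loss V {y} y (add_at y (execute V x i \<eta>)))"
    using s(2) by (intro ev_cong) auto
  then show ?thesis using loss_step[OF assms(1,2) s(1), of y] by simp
qed

text \<open>With two particles at \<open>y\<close> sleep instructions are void, so one of them is
  forced to jump, which counts 1, and the other stays as the held one.\<close>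

lemma loss_add_at_lone:
  assumes "finite V" "y \<in> V" "\<eta> y = Active 1"
  shows "loss V {y} y (add_at y \<eta>)
    = 1 + avg y (\<lambda>z. loss V {y} y (add_at y (execute V y (Jump z) \<eta>)))"
proof -
  let ?L = "loss V {y} y"
  have a: "act {} \<eta> y" using assms(3) by simp
  have y2: "act {y} (add_at y \<eta>) y" by (rule act_add_at_same[OF a])
  have "?L (add_at y \<eta>) = ev y (\<lambda>i. ?L (execute V y i (add_at y \<eta>))) + pj"
    using loss_step[OF assms(1,2) y2, of y] by simp
  also have "ev y (\<lambda>i. ?L (execute V y i (add_at y \<eta>)))
      = ps * ?L (add_at y \<eta>) + pj * avg y (\<lambda>z. ?L (add_at y (execute V y (Jump z) \<eta>)))"
  proof -
    have "avg y (\<lambda>z. ?L (execute V y (Jump z) (add_at y \<eta>)))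
        = avg y (\<lambda>z. ?L (add_at y (execute V y (Jump z) \<eta>)))"
      using execute_Jump_add_at[OF a] by (intro avg_cong) (metis not_neighbor_self)
    then show ?thesis by (simp only: ev_def execute_Sleep_many[OF y2])
  qed
  finally have "pj * ?L (add_at y \<eta>) = pj * (1 + avg y (\<lambda>z. ?L (add_at y (execute V y (Jump z) \<eta>))))"
    by (simp add: pj_eq algebra_simps)
  then show ?thesis using pj_pos by simp
qed

lemma occ_step_lone:
  assumes "y \<in> V" "\<eta> y = Active 1" "stable V {} (\<eta>(y := Sleeping))"
  shows "occ V {} y \<eta> = ps + pj * avg y (\<lambda>z. occ V {} y (execute V y (Jump z) \<eta>))"
proof -
  have "occ V {} y \<eta> = ev y (\<lambda>i. occ V {} y (execute V y i \<eta>))"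
    using assms(2) by (intro occ_step[OF assms(1)]) simp
  then show ?thesis
    unfolding ev_def execute_Sleep_lone[of \<eta> y, OF assms(2)] using assms(3)
    by (simp add: occ_stable)
qed

lemma execute_Jump_not_Sleeping:
  assumes "\<eta> y \<noteq> Sleeping"
  shows "execute V x (Jump z) \<eta> y \<noteq> Sleeping"
  using assms by (cases "\<eta> y") (auto simp: execute.simps Let_def)

text \<open>
  The left side counts lone topplings at \<open>y\<close> that end in sleep. With an extra particle held at
  \<open>y\<close>, every lone particle is forced to jump.
\<close>

lemma occ_le_loss:
  assumes "finite V" "y \<in> V" "\<eta> y \<noteq> Sleeping"
  shows "occ V {} y \<eta> \<le> ps * loss V {y} y (add_at y \<eta>)"
proof -
  let ?L = "loss V {y} y"
  have L0: "0 \<le> ?L \<zeta>" for \<zeta> by (rule loss_nonneg[OF assms(1)])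
  let ?F = "\<lambda>\<eta>. occ V {} y \<eta> - ps * ?L (add_at y \<eta>)"
  have "?F \<eta> \<le> 0"
  proof (rule maximum_principle_config[where Inv = "\<lambda>\<eta>. \<eta> y \<noteq> Sleeping" and F = ?F, OF assms(1)])
    have "?F \<eta> \<le> 1 - 0" for \<eta> using L0 ps_pos by (intro diff_mono) auto
    then show "\<exists>B. \<forall>\<eta>. \<eta> y \<noteq> Sleeping \<longrightarrow> mass V \<eta> \<le> C \<longrightarrow> ?F \<eta> \<le> B" for C by blast
    fix \<eta> :: "int ^ 'a \<Rightarrow> site_state"
    assume ns: "\<eta> y \<noteq> Sleeping"
    show "?F \<eta> \<le> 0 \<or> (\<exists>x\<in>V. act {} \<eta> x \<and>
        ?F \<eta> \<le> ev x (\<lambda>i. if execute V x i \<eta> y \<noteq> Sleeping then ?F (execute V x i \<eta>) else 0))"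
    proof (cases "stable V {y} \<eta>")
      case False
      then obtain x where x: "x \<in> V" "act {y} \<eta> x" by (rule not_stableE)
      then have xy: "x \<noteq> y \<or> act {y} \<eta> y" by auto
      have n: "\<And>i. execute V x i \<eta> y \<noteq> Sleeping"
        using execute_not_Sleeping[of \<eta> y x V] ns xy by blast
      have "?F \<eta> = ev x (\<lambda>i. ?F (execute V x i \<eta>)) - ps * (pj * of_bool (x = y))"
        by (simp only: ev_diff ev_cmult occ_step_hold[OF x, of y, symmetric]
            loss_step_add_at[OF assms(1) x(1) act_mono_hold[OF x(2)] xy])
          (simp add: algebra_simps)
      also have "\<dots> \<le> ev x (\<lambda>i. ?F (execute V x i \<eta>))" using ps_pos pj_pos by simp
      finally show ?thesis
        using n by (intro submartingale_step[OF x, where F = ?F and Inv = "\<lambda>\<eta>. \<eta> y \<noteq> Sleeping"])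
    next
      case True
      show ?thesis
      proof (cases "stable V {} \<eta>")
        case True
        have "\<eta> y = Active 0" using stableD[OF True assms(2)] ns by simp
        then show ?thesis using L0 ps_pos by (simp add: occ_stable[OF True])
      next
        case False
        note y = stable_hold_cases[OF \<open>stable V {y} \<eta>\<close> False]
        let ?A = "avg y (\<lambda>z. ?L (add_at y (execute V y (Jump z) \<eta>)))"
        have "0 \<le> ?A" by (rule avg_nonneg) (rule L0)
        then have "ps * pj * ?A \<le> ps * ?A"
          using ps_pos pj_pos ps_pj by (intro mult_right_mono) auto
        \<comment> \<open>The \<open>ps\<close> from falling asleep cancels against
          \<open>ps\<close> times the forced jump. Sleep leaves the invariant and is counted as 0,
          so only the jump branches remain, with weight \<open>pj\<close>.\<close>
        then have "?F \<eta> \<le> pj * avg y (\<lambda>z. occ V {} y (execute V y (Jump z) \<eta>)) - ps * pj * ?A"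
          by (simp add: occ_step_lone[OF y] loss_add_at_lone[of V y \<eta>, OF assms(1) y(1,2)] algebra_simps)
        also have "\<dots> = pj * avg y (\<lambda>z. ?F (execute V y (Jump z) \<eta>))"
          by (simp add: avg_diff avg_cmult algebra_simps)
        also have "\<dots> = ev y (\<lambda>i. if execute V y i \<eta> y \<noteq> Sleeping then ?F (execute V y i \<eta>) else 0)"
          using execute_Sleep_lone[of \<eta> y V, OF y(2)] execute_Jump_not_Sleeping[of \<eta> y V y] ns
          by (simp add: ev_def)
        finally show ?thesis using y(1,2) by (intro disjI2 bexI[of _ y] conjI) auto
      qed
    qed
  qed (use assms in auto)
  then show ?thesis by simp
qed

text \<open>Stabilize with \<open>y\<close> held. The particle left at \<open>y\<close> sleeps with
  probability \<open>ps\<close> or jumps, and after the jump \<open>occ_le_loss\<close> applies. The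
  difference of losses counts the forced jumps from that moment on, and 1 is subtracted for the jump
  just made.\<close>

lemma occ_upper:
  assumes "finite V" "y \<in> V" "\<eta> y \<noteq> Sleeping" "\<eta> y \<noteq> Active 0"
  shows "occ V {} y \<eta>
    \<le> ps + ps * pj * (loss V {y} y (add_at y \<eta>) - loss V {y} y \<eta> - 1)"
proof -
  let ?L = "loss V {y} y"
  have L0: "0 \<le> ?L \<zeta>" for \<zeta> by (rule loss_nonneg[OF assms(1)])
  let ?F = "\<lambda>\<eta>. occ V {} y \<eta> - ps - ps * pj * (?L (add_at y \<eta>) - ?L \<eta> - 1)"
  have p1: "ps * pj \<le> 1 * 1" using ps_pos pj_pos ps_pj by (intro mult_mono) auto
  have p0: "0 \<le> ps * pj" using ps_pos pj_pos by simp
  have "?F \<eta> \<le> 0"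
  proof (rule maximum_principle_config[where Inv = "\<lambda>\<eta>. \<eta> y \<noteq> Sleeping \<and> \<eta> y \<noteq> Active 0"
        and F = ?F, OF assms(1)])
    have "?F \<eta> \<le> 2 + (\<Sum>z\<in>V. \<bar>green V y z\<bar>) * real C" if "mass V \<eta> \<le> C" for \<eta> C
    proof -
      have "ps * pj * (?L \<eta> + 1) \<le> 1 * (?L \<eta> + 1)"
        using p1 L0[of \<eta>] by (intro mult_right_mono) auto
      moreover have "0 \<le> ps * pj * ?L (add_at y \<eta>)" using p0 L0 by simp
      moreover have "?F \<eta> = occ V {} y \<eta> - ps - ps * pj * ?L (add_at y \<eta>) + ps * pj * (?L \<eta> + 1)"
        by (simp add: algebra_simps)
      ultimately have "?F \<eta> \<le> 1 - 0 - 0 + 1 * (?L \<eta> + 1)"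
        using ps_pos by (simp only:) (intro add_mono diff_mono occ_bounds, auto)
      also have "\<dots> \<le> 2 + (\<Sum>z\<in>V. \<bar>green V y z\<bar>) * real C"
        using loss_le_mass[OF assms(1) that, of "{y}" y] by simp
      finally show ?thesis .
    qed
    then show "\<exists>B. \<forall>\<eta>. \<eta> y \<noteq> Sleeping \<and> \<eta> y \<noteq> Active 0 \<longrightarrow> mass V \<eta> \<le> C \<longrightarrow> ?F \<eta> \<le> B" for C
      by blast
    fix \<eta> :: "int ^ 'a \<Rightarrow> site_state"
    assume ne: "\<eta> y \<noteq> Sleeping \<and> \<eta> y \<noteq> Active 0"
    show "?F \<eta> \<le> 0 \<or> (\<exists>x\<in>V. act {} \<eta> x \<and> ?F \<eta> \<le> ev x (\<lambda>i.
        if execute V x i \<eta> y \<noteq> Sleeping \<and> execute V x i \<eta> y \<noteq> Active 0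
        then ?F (execute V x i \<eta>) else 0))"
    proof (cases "stable V {y} \<eta>")
      case False
      then obtain x where x: "x \<in> V" "act {y} \<eta> x" by (rule not_stableE)
      then have xy: "x \<noteq> y \<or> act {y} \<eta> y" by auto
      have n: "\<And>i. execute V x i \<eta> y \<noteq> Sleeping \<and> execute V x i \<eta> y \<noteq> Active 0"
        using execute_not_Sleeping[of \<eta> y x V] execute_nonempty[of \<eta> y x V] ne xy by blast
      have "?F \<eta> \<le> ev x (\<lambda>i. ?F (execute V x i \<eta>))"
        by (simp only: ev_diff ev_cmult ev_const occ_step_hold[OF x, of y, symmetric]
            loss_step_add_at[OF assms(1) x(1) act_mono_hold[OF x(2)] xy]
            loss_step[OF assms(1) x, of y]) simp
      then show ?thesis
        using n by (intro submartingale_step[OF x, where F = ?F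
            and Inv = "\<lambda>\<eta>. \<eta> y \<noteq> Sleeping \<and> \<eta> y \<noteq> Active 0"])
    next
      case True
      have "\<not> stable V {} \<eta>" using ne stableD[of V "{}" \<eta> y] assms(2) by auto
      note y = stable_hold_cases[OF True this]
      let ?A = "avg y (\<lambda>z. ?L (add_at y (execute V y (Jump z) \<eta>)))"
      have "avg y (\<lambda>z. occ V {} y (execute V y (Jump z) \<eta>)) \<le> ps * ?A"
        unfolding avg_cmult[symmetric]
        using execute_Jump_not_Sleeping[of \<eta> y V y] ne
        by (intro avg_mono occ_le_loss assms(1,2)) blast
      then have "pj * avg y (\<lambda>z. occ V {} y (execute V y (Jump z) \<eta>)) \<le> pj * (ps * ?A)"
        using pj_pos by (intro mult_left_mono) auto
      then have "?F \<eta> \<le> 0"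
        by (simp add: occ_step_lone[OF y] loss_add_at_lone[of V y \<eta>, OF assms(1) y(1,2)]
            loss_stable[OF True] algebra_simps)
      then show ?thesis by blast
    qed
  qed (use assms in auto)
  then show ?thesis by simp
qed

section \<open>Full configurations and monotonicity of the weighted final mass\<close>

lemma execute_add_at_same:
  assumes "\<eta> u = Active n"
  shows "execute V u (Jump z) (add_at u \<eta>) = (if z \<in> V then add_at z \<eta> else \<eta>)"
  using assms by (auto simp: execute.simps add_at_def Let_def fun_eq_iff)

text \<open>As a function of the site \<open>u\<close> of the extra particle, the difference
  \<open>K\<close> is harmonic on \<open>V\<close>, since sleep does nothing at a site with at least
  two active particles. It vanishes outside, where the particle is killed, and hence
  everywhere.\<close>

lemma occ_add_at_full:
  assumes "finite V" "u \<in> V" "\<And>z. z \<in> V \<Longrightarrow> \<eta> z \<noteq> Sleeping \<and> \<eta> z \<noteq> Active 0"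
  shows "occ V H z (add_at u \<eta>) = occ V H z \<eta>"
proof -
  define K where "K u = (if u \<in> V then occ V H z (add_at u \<eta>) - occ V H z \<eta> else 0)" for u
  have harm: "K u = avg u K" if u: "u \<in> V" for u
  proof -
    obtain n where n: "\<eta> u = Active (Suc n)"
      using assms(3)[OF u] by (cases "\<eta> u") (auto simp: gr0_conv_Suc)
    then have a: "act H (add_at u \<eta>) u" "act {u} (add_at u \<eta>) u" by (auto simp: act_def)
    have "occ V H z (add_at u \<eta>) = ev u (\<lambda>i. occ V H z (execute V u i (add_at u \<eta>)))"
      by (rule occ_step[OF u a(1)])
    also have "\<dots> = ps * occ V H z (add_at u \<eta>)
        + pj * avg u (\<lambda>y. occ V H z \<eta> + K y)"
      unfolding ev_def execute_Sleep_many[OF a(2)] execute_add_at_same[of \<eta> u, OF n]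
      by (intro arg_cong2[where f = "(+)"] arg_cong2[where f = "(*)"] avg_cong refl) (simp add: K_def)
    finally have "pj * K u = pj * avg u K"
      using u by (simp add: K_def[of u] avg_add pj_eq algebra_simps)
    then show ?thesis using pj_pos by simp
  qed
  have "K u \<le> 0"
  proof (rule walk_maximum_principle[OF assms(1)])
    show "K x \<le> avg x K" if "x \<in> V" for x using harm[OF that] by simp
  qed (simp add: K_def)
  moreover have "- 1 * K u \<le> 0"
  proof (rule walk_maximum_principle[OF assms(1), where E = "\<lambda>u. - 1 * K u"])
    show "- 1 * K x \<le> avg x (\<lambda>u. - 1 * K u)" if "x \<in> V" for x
      unfolding avg_cmult by (subst harm[OF that]) simp
  qed (simp add: K_def)
  ultimately show ?thesis using assms(2) by (simp add: K_def)
qed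

text \<open>The final occupation probabilities agree with and without the extra particle, so the
  losses differ by its weight \<open>green V y y\<close> alone.\<close>

lemma occ_full_upper:
  assumes "finite V" "y \<in> V" "\<And>z. z \<in> V \<Longrightarrow> \<eta> z \<noteq> Sleeping \<and> \<eta> z \<noteq> Active 0"
  shows "occ V {} y \<eta> \<le> ps + ps * pj * (green V y y - 1)"
proof -
  have "loss V {y} y (add_at y \<eta>) - loss V {y} y \<eta> = green V y y"
    by (simp add: loss_def occ_add_at_full[OF assms] wt_add_at[OF assms(1,2)])
  then show ?thesis using occ_upper[of V y \<eta>] assms by simp
qed

text \<open>Run both configurations with the same topplings, which avoid the sleeper at
  \<open>z\<close>. They coincide as soon as a particle jumps to \<open>z\<close>, since both then
  have two active particles there. If the sleeping version becomes stable first, its remaining loss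
  is 0.\<close>

lemma loss_asleep:
  assumes "finite V" "z \<in> V" "\<eta> z = Active 1"
  shows "loss V {} w (\<eta>(z := Sleeping)) \<le> loss V {} w \<eta>"
proof -
  let ?F = "\<lambda>\<eta>. loss V {} w (\<eta>(z := Sleeping)) - loss V {} w \<eta>"
  have "?F \<eta> \<le> 0"
  proof (rule maximum_principle_config[where Inv = "\<lambda>\<eta>. \<eta> z = Active 1" and F = ?F, OF assms(1)])
    have "?F \<eta> \<le> (\<Sum>z\<in>V. \<bar>green V w z\<bar>) * real C" if "\<eta> z = Active 1" "mass V \<eta> \<le> C" for \<eta> C
    proof -
      have "mass V (\<eta>(z := Sleeping)) = mass V \<eta>"
        unfolding mass_def using that(1) by (intro sum.cong) auto
      then show ?thesis
        using loss_le_mass[OF assms(1), of "\<eta>(z := Sleeping)" C "{}" w] that(2)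
          loss_nonneg[OF assms(1), of "{}" w \<eta>] by linarith
    qed
    then show "\<exists>B. \<forall>\<eta>. \<eta> z = Active 1 \<longrightarrow> mass V \<eta> \<le> C \<longrightarrow> ?F \<eta> \<le> B" for C by blast
    fix \<eta> :: "int ^ 'a \<Rightarrow> site_state"
    assume z: "\<eta> z = Active 1"
    show "?F \<eta> \<le> 0 \<or> (\<exists>x\<in>V. act {} \<eta> x \<and> ?F \<eta> \<le> ev x (\<lambda>i.
        if execute V x i \<eta> z = Active 1 then ?F (execute V x i \<eta>) else 0))"
    proof (cases "stable V {} (\<eta>(z := Sleeping))")
      case True
      then show ?thesis using loss_nonneg[OF assms(1), of "{}" w \<eta>] by (simp add: loss_stable)
    next
      case False
      then obtain x where x: "x \<in> V" "act {} (\<eta>(z := Sleeping)) x" by (rule not_stableE)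
      then have xz: "x \<noteq> z" by auto
      then have x': "act {} \<eta> x" using x(2) by simp
      have pt: "loss V {} w (execute V x i (\<eta>(z := Sleeping))) - loss V {} w (execute V x i \<eta>)
          = (if execute V x i \<eta> z = Active 1 then ?F (execute V x i \<eta>) else 0)" for i
      proof (cases "i = Jump z")
        case True
        have "execute V x i (\<eta>(z := Sleeping)) = execute V x i \<eta>"
          using True z xz assms(2) by (auto simp: execute.simps Let_def fun_eq_iff numeral_2_eq_2)
        moreover have "execute V x i \<eta> z \<noteq> Active 1"
          using True z xz assms(2) by (auto simp: execute.simps Let_def)
        ultimately show ?thesis by simp
      next
        case False
        have "execute V x i (\<eta>(z := Sleeping)) = (execute V x i \<eta>)(z := Sleeping)"
          using False xz by (cases i) (auto simp: execute.simps Let_def fun_eq_iff)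
        moreover have "execute V x i \<eta> z = Active 1"
          using False z xz by (cases i) (auto simp: execute.simps Let_def)
        ultimately show ?thesis by simp
      qed
      have "?F \<eta> = ev x (\<lambda>i. loss V {} w (execute V x i (\<eta>(z := Sleeping))))
          - ev x (\<lambda>i. loss V {} w (execute V x i \<eta>))"
        using loss_step[OF assms(1) x, of w] loss_step[OF assms(1) x(1) x', of w] by linarith
      also have "\<dots> = ev x (\<lambda>i. if execute V x i \<eta> z = Active 1 then ?F (execute V x i \<eta>) else 0)"
        unfolding ev_diff[symmetric] by (simp only: pt)
      finally show ?thesis using x(1) x' by (intro disjI2 bexI[of _ x] conjI) auto
    qed
  qed (use assms in auto)
  then show ?thesis by simp
qed

text \<open>The added particle is moved alone, and \<open>green V w u\<close> accounts for its own
  expected departures from \<open>w\<close>. Its only deviation from a free walk is falling asleep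
  at an otherwise empty site, which cannot raise the loss by \<open>loss_asleep\<close>.\<close>

lemma loss_add_at_le:
  assumes "finite V" "u \<in> V" "\<And>z. z \<in> V \<Longrightarrow> \<eta> z \<noteq> Sleeping"
  shows "loss V {} w (add_at u \<eta>) \<le> loss V {} w \<eta> + green V w u"
proof -
  let ?L = "loss V {} w"
  define K where "K u = (if u \<in> V then ?L (add_at u \<eta>) - ?L \<eta> else 0)" for u
  have sub: "K u - green V w u \<le> avg u (\<lambda>u. K u - green V w u)" if u: "u \<in> V" for u
  proof -
    obtain n where n: "\<eta> u = Active n" using assms(3)[OF u] by (cases "\<eta> u") auto
    have a: "act {} (add_at u \<eta>) u" using n by simp
    have sl: "?L (execute V u Sleep (add_at u \<eta>)) \<le> ?L (add_at u \<eta>)"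
    proof (cases "n = 0")
      case True
      then have "add_at u \<eta> u = Active 1" using n by simp
      then show ?thesis
        using loss_asleep[OF assms(1) u, of "add_at u \<eta>" w] execute_Sleep_lone[of "add_at u \<eta>" u V]
        by simp
    next
      case False
      then have "act {u} (add_at u \<eta>) u" using n by (simp add: act_def)
      then show ?thesis by (simp add: execute_Sleep_many)
    qed
    have "?L (add_at u \<eta>) = ps * ?L (execute V u Sleep (add_at u \<eta>))
        + pj * avg u (\<lambda>z. ?L (execute V u (Jump z) (add_at u \<eta>))) + pj * of_bool (u = w)"
      using loss_step[OF assms(1) u a, of w] by (simp add: ev_def)
    also have "avg u (\<lambda>z. ?L (execute V u (Jump z) (add_at u \<eta>))) = avg u (\<lambda>z. ?L \<eta> + K z)"
      unfolding execute_add_at_same[of \<eta> u, OF n] by (intro avg_cong) (simp add: K_def)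
    finally have "?L (add_at u \<eta>) \<le> ps * ?L (add_at u \<eta>)
        + pj * avg u (\<lambda>z. ?L \<eta> + K z) + pj * of_bool (u = w)"
      using mult_left_mono[OF sl, of ps] ps_pos by linarith
    then have "pj * K u \<le> pj * (avg u K + of_bool (u = w))"
      using u by (simp add: K_def[of u] avg_add pj_eq algebra_simps)
    then have "K u \<le> avg u K + of_bool (u = w)" using pj_pos by simp
    then show ?thesis
      using green_eq[OF assms(1) u, of w] by (simp add: avg_diff)
  qed
  have "K u - green V w u \<le> 0"
    by (rule walk_maximum_principle[OF assms(1), where E = "\<lambda>u. K u - green V w u"])
      (use sub in \<open>auto simp: K_def green_outside\<close>)
  then show ?thesis using assms(2) by (simp add: K_def)
qed

lemma restrict_config_add:
  "u \<in> V \<Longrightarrow> restrict_config V (\<sigma>(u := Suc (\<sigma> u))) = add_at u (restrict_config V \<sigma>)"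
  by (auto simp: restrict_config_def add_at_def fun_eq_iff)

lemma config_increase_induct:
  fixes \<sigma> \<sigma>' :: "'s \<Rightarrow> nat"
  assumes "finite V" "\<And>z. z \<in> V \<Longrightarrow> \<sigma> z \<le> \<sigma>' z"
    and base: "P (restrict_config V \<sigma>)"
    and step: "\<And>\<tau> u. u \<in> V \<Longrightarrow> (\<And>z. z \<in> V \<Longrightarrow> \<sigma> z \<le> \<tau> z) \<Longrightarrow> P (restrict_config V \<tau>)
      \<Longrightarrow> P (add_at u (restrict_config V \<tau>))"
  shows "P (restrict_config V \<sigma>')"
  using assms(2)
proof (induction "\<Sum>z\<in>V. \<sigma>' z - \<sigma> z" arbitrary: \<sigma>')
  case 0
  then have "\<sigma>' z = \<sigma> z" if "z \<in> V" for z
    using that assms(1) by (force intro: antisym)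
  then have "restrict_config V \<sigma>' = restrict_config V \<sigma>" by (auto simp: restrict_config_def)
  then show ?case using base by simp
next
  case (Suc k)
  have "\<exists>u\<in>V. \<sigma>' u - \<sigma> u \<noteq> 0"
  proof (rule ccontr)
    assume "\<not> (\<exists>u\<in>V. \<sigma>' u - \<sigma> u \<noteq> 0)"
    then have "(\<Sum>z\<in>V. \<sigma>' z - \<sigma> z) = 0" by (intro sum.neutral) blast
    then show False using Suc.hyps(2) by simp
  qed
  then obtain u where u: "u \<in> V" "\<sigma> u < \<sigma>' u" by force
  define \<tau> where "\<tau> = \<sigma>'(u := \<sigma>' u - 1)"
  have "(\<Sum>z\<in>V. \<sigma>' z - \<sigma> z) = (\<sigma>' u - \<sigma> u) + (\<Sum>z\<in>V - {u}. \<sigma>' z - \<sigma> z)"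
    by (rule sum.remove[OF assms(1) u(1)])
  moreover have "(\<Sum>z\<in>V. \<tau> z - \<sigma> z) = (\<tau> u - \<sigma> u) + (\<Sum>z\<in>V - {u}. \<tau> z - \<sigma> z)"
    by (rule sum.remove[OF assms(1) u(1)])
  moreover have "(\<Sum>z\<in>V - {u}. \<tau> z - \<sigma> z) = (\<Sum>z\<in>V - {u}. \<sigma>' z - \<sigma> z)"
    by (rule sum.cong) (auto simp: \<tau>_def)
  ultimately have "k = (\<Sum>z\<in>V. \<tau> z - \<sigma> z)" using Suc.hyps(2) u(2) by (simp add: \<tau>_def)
  moreover have le: "\<sigma> z \<le> \<tau> z" if "z \<in> V" for z using Suc.prems[OF that] u by (auto simp: \<tau>_def)
  ultimately have "P (restrict_config V \<tau>)" using Suc.hyps(1)[of \<tau>] by blast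
  then have "P (add_at u (restrict_config V \<tau>))" using step[OF u(1) le] by blast
  moreover have "\<tau>(u := Suc (\<tau> u)) = \<sigma>'" using u(2) by (auto simp: \<tau>_def fun_eq_iff)
  ultimately show ?case using restrict_config_add[OF u(1), of \<tau>] by simp
qed

text \<open>Each added particle contributes \<open>green V w u\<close> to the initial weight and, by
  \<open>loss_add_at_le\<close>, at most that to the loss.\<close>

lemma occ_green_mono:
  fixes \<sigma> :: "int ^ 'd::finite \<Rightarrow> nat"
  assumes "finite V" "\<And>z. z \<in> V \<Longrightarrow> \<sigma> z \<le> \<sigma>' z"
  shows "(\<Sum>z\<in>V. green V w z * occ V {} z (restrict_config V \<sigma>))
    \<le> (\<Sum>z\<in>V. green V w z * occ V {} z (restrict_config V \<sigma>'))" (is "?S (restrict_config V \<sigma>) \<le> _")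
proof (rule config_increase_induct[where P = "\<lambda>\<eta>. ?S (restrict_config V \<sigma>) \<le> ?S \<eta>"
      and \<sigma> = \<sigma>, OF assms])
  fix \<tau> u assume u: "u \<in> V" and IH: "?S (restrict_config V \<sigma>) \<le> ?S (restrict_config V \<tau>)"
  have "loss V {} w (add_at u (restrict_config V \<tau>)) \<le> loss V {} w (restrict_config V \<tau>) + green V w u"
    by (rule loss_add_at_le[OF assms(1) u]) (simp add: restrict_config_def)
  then show "?S (restrict_config V \<sigma>) \<le> ?S (add_at u (restrict_config V \<tau>))"
    using IH by (simp add: loss_def wt_add_at[OF assms(1) u])
qed auto

text \<open>Add one particle at every site: the sum can only grow, and \<open>occ_full_upper\<close>
  applies to the full configuration.\<close>

lemma occ_green_upper:
  fixes \<sigma> :: "int ^ 'd::finite \<Rightarrow> nat"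
  assumes "finite V" "\<And>y. y \<in> V \<Longrightarrow> green V y y \<le> 1 + r"
  shows "(\<Sum>z\<in>V. green V w z * occ V {} z (restrict_config V \<sigma>))
    \<le> (ps + ps * pj * r) * (\<Sum>z\<in>V. green V w z)"
proof -
  have "(\<Sum>z\<in>V. green V w z * occ V {} z (restrict_config V \<sigma>))
      \<le> (\<Sum>z\<in>V. green V w z * occ V {} z (restrict_config V (\<lambda>z. Suc (\<sigma> z))))"
    by (rule occ_green_mono[OF assms(1)]) simp
  also have "\<dots> \<le> (\<Sum>z\<in>V. green V w z * (ps + ps * pj * r))"
  proof (intro sum_mono mult_left_mono green_nonneg assms(1))
    fix z assume z: "z \<in> V"
    have "occ V {} z (restrict_config V (\<lambda>z. Suc (\<sigma> z))) \<le> ps + ps * pj * (green V z z - 1)"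
      by (rule occ_full_upper[OF assms(1) z]) (simp add: restrict_config_def)
    also have "\<dots> \<le> ps + ps * pj * r"
      using assms(2)[OF z] ps_pos pj_pos by (intro add_left_mono mult_left_mono) auto
    finally show "occ V {} z (restrict_config V (\<lambda>z. Suc (\<sigma> z))) \<le> ps + ps * pj * r" .
  qed
  finally show ?thesis by (simp add: sum_distrib_right mult.commute)
qed

end

section \<open>Uniform integrability of the odometer at a site\<close>

context arw
begin

text \<open>
  Let \<open>h w\<close> be the number of topplings at \<open>w\<close>. The potential \<open>G\<close> below is a supermartingale
  that dominates the square of \<open>h w\<close>, and Young's inequality
  \<open>j \<le> j\<^sup>2 / (2 \<theta>) + \<theta> / 2\<close> on \<open>{j > K}\<close> turns this second moment bound into uniform
  integrability. The weight \<open>f\<^sup>2\<close> in \<open>G\<close> compensates the quadratic variation of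
  \<open>wt V f\<close>.
\<close>

lemma loss_tail:
  fixes w :: "int ^ 'd::finite" and \<eta> :: "int ^ 'd \<Rightarrow> site_state" and K :: nat
  assumes fin: "finite V" and \<theta>: "\<theta> > 0"
  defines "c \<equiv> wt V (green V w) \<eta> / pj"
  shows "loss V {} w \<eta> / pj \<le> real K + (c\<^sup>2 + 2 * green V w w / pj * c) / (2 * \<theta>)
    + \<theta> / 2 * pr V {} (\<lambda>h _. K < h w) \<eta>"
proof -
  let ?f = "green V w"
  let ?f2 = "\<lambda>z. (?f z)\<^sup>2"
  \<comment> \<open>A toppling is a jump with probability \<open>pj\<close>, so dividing a loss by
    \<open>pj\<close> gives expected topplings in place of jumps.\<close>
  define a where "a = 1 / pj"
  have a0: "0 < a" using pj_pos by (simp add: a_def)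
  have apj: "a * pj = 1" using pj_pos by (simp add: a_def)
  have f0: "0 \<le> ?f z" for z by (rule green_nonneg[OF fin])
  define G where "G j \<eta> = j\<^sup>2 + 2 * j * a * wt V ?f \<eta> + a\<^sup>2 * (wt V ?f \<eta>)\<^sup>2 - a\<^sup>2 * wt V ?f2 \<eta>
      + 2 * ?f w * a\<^sup>2 * wt V ?f \<eta>" for j \<eta>
  let ?p = "\<lambda>j \<eta>. pr V {} (\<lambda>h' _. K < j + h' w) \<eta>"
  let ?F = "\<lambda>\<eta> h. real (h w) + a * loss V {} w \<eta> - real K - G (real (h w)) \<eta> / (2 * \<theta>)
      - \<theta> / 2 * ?p (h w) \<eta>"
  have wt0: "0 \<le> wt V ?f \<eta>" for \<eta> by (rule wt_nonneg) (rule f0)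
  \<comment> \<open>Counts are integers, so \<open>cnt \<le> cnt\<^sup>2\<close>; this keeps the
    compensated square in \<open>G\<close> nonnegative.\<close>
  have sq: "wt V ?f2 \<eta> \<le> (wt V ?f \<eta>)\<^sup>2" for \<eta>
  proof -
    let ?a = "\<lambda>z. ?f z * real (cnt (\<eta> z))"
    have a: "0 \<le> ?a z" for z using f0 by simp
    have "wt V ?f2 \<eta> \<le> (\<Sum>z\<in>V. ?a z * ?a z)"
      unfolding wt_def
    proof (rule sum_mono)
      fix z
      have "real (cnt (\<eta> z)) \<le> real (cnt (\<eta> z) * cnt (\<eta> z))"
        by (subst of_nat_le_iff) simp
      then have "?f2 z * real (cnt (\<eta> z)) \<le> ?f2 z * real (cnt (\<eta> z) * cnt (\<eta> z))"
        by (rule mult_left_mono) simp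
      then show "?f2 z * real (cnt (\<eta> z)) \<le> ?a z * ?a z"
        by (simp add: power2_eq_square mult_ac)
    qed
    also have "\<dots> \<le> (\<Sum>z\<in>V. ?a z * wt V ?f \<eta>)"
      unfolding wt_def using fin a by (intro sum_mono mult_left_mono member_le_sum) auto
    also have "\<dots> = (wt V ?f \<eta>)\<^sup>2" by (simp add: wt_def power2_eq_square sum_distrib_right)
    finally show ?thesis .
  qed
  have Gj: "j\<^sup>2 \<le> G j \<eta>" if "0 \<le> j" for j \<eta>
  proof -
    have "0 \<le> 2 * j * a * wt V ?f \<eta>" "0 \<le> 2 * ?f w * a\<^sup>2 * wt V ?f \<eta>"
      using that a0 wt0 f0 by auto
    moreover have "a\<^sup>2 * wt V ?f2 \<eta> \<le> a\<^sup>2 * (wt V ?f \<eta>)\<^sup>2" using sq by (intro mult_left_mono) auto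
    ultimately show ?thesis unfolding G_def by linarith
  qed
  have young: "j \<le> j\<^sup>2 / (2 * \<theta>) + \<theta> / 2" for j
  proof -
    have "0 \<le> (j - \<theta>)\<^sup>2" by simp
    then show ?thesis using \<theta> by (simp add: field_simps power2_eq_square)
  qed
  have main: "?F \<eta> (\<lambda>_. 0) \<le> 0"
  proof (rule maximum_principle[where Inv = "\<lambda>_. True" and F = ?F, OF fin])
    have "?F \<eta> h \<le> \<theta> / 2 + a * ((\<Sum>z\<in>V. \<bar>?f z\<bar>) * real C)" if m: "mass V \<eta> \<le> C" for \<eta> h C
    proof -
      have "a * loss V {} w \<eta> \<le> a * ((\<Sum>z\<in>V. \<bar>?f z\<bar>) * real C)"
        using loss_le_mass[OF fin m] a0 by (intro mult_left_mono) auto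
      moreover have "real (h w) - G (real (h w)) \<eta> / (2 * \<theta>) \<le> \<theta> / 2"
      proof -
        have "(real (h w))\<^sup>2 / (2 * \<theta>) \<le> G (real (h w)) \<eta> / (2 * \<theta>)"
          using Gj[of "real (h w)" \<eta>] \<theta> by (intro divide_right_mono) auto
        then show ?thesis using young[of "real (h w)"] by linarith
      qed
      moreover have "0 \<le> \<theta> / 2 * ?p (h w) \<eta>" using \<theta> by simp
      ultimately show ?thesis by (smt (verit) of_nat_0_le_iff)
    qed
    then show "\<exists>B. \<forall>\<eta> h. True \<longrightarrow> mass V \<eta> \<le> C \<longrightarrow> ?F \<eta> h \<le> B" for C by blast
    fix \<eta> :: "int ^ 'd \<Rightarrow> site_state" and h :: "int ^ 'd \<Rightarrow> nat"
    show "?F \<eta> h \<le> 0 \<or> (\<exists>x\<in>V. act {} \<eta> x \<and> ?F \<eta> h \<le> ev x (\<lambda>i. if True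
        then ?F (execute V x i \<eta>) (h(x := Suc (h x))) else 0))"
    proof (cases "stable V {} \<eta>")
      case True
      define g where "g = G (real (h w)) \<eta> / (2 * \<theta>)"
      have g: "(real (h w))\<^sup>2 / (2 * \<theta>) \<le> g"
        unfolding g_def using Gj[of "real (h w)" \<eta>] \<theta> by (intro divide_right_mono) auto
      have "0 \<le> (real (h w))\<^sup>2 / (2 * \<theta>)" using \<theta> by simp
      then have g0: "0 \<le> g" using g by linarith
      have "real (h w) \<le> g + \<theta> / 2" using g young[of "real (h w)"] by linarith
      \<comment> \<open>Up to the threshold \<open>K\<close> the left side is nonpositive anyway;
        above it the tail term pays for Young's inequality.\<close>
      then have "real (h w) - real K - g - \<theta> / 2 * of_bool (K < h w) \<le> 0"
        using g0 by (cases "K < h w") auto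
      then have "?F \<eta> h \<le> 0"
        by (simp only: loss_stable[OF True] pr_stable[OF True] g_def add_0_right mult_zero_right)
      then show ?thesis by blast
    next
      case False
      then obtain x where x: "x \<in> V" "act {} \<eta> x" by (rule not_stableE)
      define j j' where "j = real (h w)" and "j' = real ((h(x := Suc (h x))) w)"
      have j': "j' = j + of_bool (x = w)" by (simp add: j_def j'_def)
      have L: "j + a * loss V {} w \<eta> = ev x (\<lambda>i. j' + a * loss V {} w (execute V x i \<eta>))"
      proof -
        have "a * loss V {} w \<eta> = a * ev x (\<lambda>i. loss V {} w (execute V x i \<eta>)) + a * pj * of_bool (x = w)"
          by (subst loss_step[OF fin x]) (simp add: algebra_simps)
        then show ?thesis by (simp add: ev_add ev_cmult j' apj)
      qed
      have P: "?p (h w) \<eta> = ev x (\<lambda>i. ?p ((h(x := Suc (h x))) w) (execute V x i \<eta>))"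
      proof -
        have "(\<lambda>h' (_ :: int ^ 'd \<Rightarrow> site_state). K < h w + (h'(x := Suc (h' x))) w)
            = (\<lambda>h' _. K < (h(x := Suc (h x))) w + h' w)"
          by (cases "x = w") auto
        then show ?thesis
          using pr_step[OF x, of "\<lambda>h' _. K < h w + h' w"] by (simp only:)
      qed
      have GG: "ev x (\<lambda>i. G j' (execute V x i \<eta>)) \<le> G j \<eta>"
      proof -
        define b where "b = G j' \<eta>"
        define m where "m = 2 * j' * a + 2 * a\<^sup>2 * wt V ?f \<eta> - 2 * a\<^sup>2 * ?f x + 2 * ?f w * a\<^sup>2"
        have out: "z \<notin> V \<Longrightarrow> ?f2 z = 0" for z by (simp add: green_outside)
        have S: "G j' (execute V x Sleep \<eta>) = b"
          by (simp add: b_def G_def wt_Sleep[OF fin x])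
        have J1: "wt V ?f (execute V x (Jump y) \<eta>) = wt V ?f \<eta> - ?f x + ?f y" for y
          using fin x green_outside by (rule wt_Jump)
        have J2: "wt V ?f2 (execute V x (Jump y) \<eta>) = wt V ?f2 \<eta> - ?f2 x + ?f2 y" for y
          using fin x out by (rule wt_Jump)
        \<comment> \<open>The terms quadratic in \<open>?f y\<close> cancel against
          \<open>?f2\<close>, so the change of \<open>G\<close> is linear in
          \<open>?f y - ?f x\<close>.\<close>
        have J: "G j' (execute V x (Jump y) \<eta>) = b + m * (?f y - ?f x)" for y
          unfolding b_def m_def G_def J1 J2
          by (simp add: power2_eq_square algebra_simps)
        have "ev x (\<lambda>i. G j' (execute V x i \<eta>)) = b + pj * m * (avg x ?f - ?f x)"
          unfolding ev_def S J avg_add avg_const avg_cmult avg_diff by (simp add: pj_eq algebra_simps)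
        also have "\<dots> = b - pj * m * of_bool (x = w)" by (simp add: green_avg_diff[OF fin x(1)])
        also have "\<dots> \<le> G j \<eta>"
        proof (cases "x = w")
          case True
          \<comment> \<open>At \<open>w\<close> the last term of \<open>G\<close> cancels
            \<open>- 2 * a\<^sup>2 * ?f x\<close> in \<open>m\<close>, and the remaining drop
            exceeds the growth from \<open>j\<close> to \<open>j + 1\<close> by 1.\<close>
          have "pj * m = (a * pj) * (2 * j' + 2 * a * wt V ?f \<eta>)"
            by (simp add: m_def True power2_eq_square algebra_simps)
          also have "\<dots> = 2 * j' + 2 * a * wt V ?f \<eta>" by (simp add: apj)
          finally have "b - pj * m = G j \<eta> - 1"
            using True by (simp add: b_def G_def j' power2_eq_square algebra_simps)
          then show ?thesis using True by simp
        next
          case False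
          then show ?thesis by (simp add: b_def j')
        qed
        finally show ?thesis .
      qed
      have "?F \<eta> h \<le> ev x (\<lambda>i. j' + a * loss V {} w (execute V x i \<eta>)) - real K
          - ev x (\<lambda>i. G j' (execute V x i \<eta>)) / (2 * \<theta>)
          - \<theta> / 2 * ev x (\<lambda>i. ?p ((h(x := Suc (h x))) w) (execute V x i \<eta>))"
        unfolding L[symmetric] P[symmetric] j_def[symmetric]
        using GG \<theta> by (intro diff_mono divide_right_mono) auto
      also have "\<dots> = ev x (\<lambda>i. ?F (execute V x i \<eta>) (h(x := Suc (h x))))"
        unfolding j'_def[symmetric]
        by (simp only: ev_diff ev_cmult ev_const divide_inverse mult.commute[of _ "inverse _"])
      finally show ?thesis using x unfolding if_True by blast
    qed
  qed auto
  have "G 0 \<eta> \<le> c\<^sup>2 + 2 * green V w w / pj * c"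
  proof -
    have "0 \<le> a\<^sup>2 * wt V ?f2 \<eta>" by (intro mult_nonneg_nonneg wt_nonneg) auto
    then show ?thesis by (simp add: G_def c_def a_def power2_eq_square)
  qed
  then have "G 0 \<eta> / (2 * \<theta>) \<le> (c\<^sup>2 + 2 * green V w w / pj * c) / (2 * \<theta>)"
    using \<theta> by (intro divide_right_mono) auto
  moreover have "loss V {} w \<eta> / pj - real K - G 0 \<eta> / (2 * \<theta>)
      - \<theta> / 2 * pr V {} (\<lambda>h _. K < h w) \<eta> \<le> 0"
    using main by (simp add: a_def)
  ultimately show ?thesis by linarith
qed

section \<open>The odometer in infinite volume\<close>

lemma limit_odometer_eq: "limit_odometer \<sigma> I x = (SUP n. odometer (box n) \<sigma> I x)"
proof -
  have "incseq (\<lambda>n. odometer (box n) \<sigma> I x)"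
    by (intro incseq_SucI odometer_mono box_mono) simp
  then show ?thesis unfolding limit_odometer_def by (intro limI LIMSEQ_SUP)
qed

lemma outcome_odometer:
  "outcome V {} (\<lambda>h _. Q (h w)) (restrict_config V \<sigma>) = {I. \<exists>k. odometer V \<sigma> I w = enat k \<and> Q k}"
proof (intro set_eqI iffI)
  fix I assume "I \<in> outcome V {} (\<lambda>h _. Q (h w)) (restrict_config V \<sigma>)"
  then obtain xs where xs: "ends V {} (restrict_config V \<sigma>) I xs" "Q (count_list xs w)"
    by (auto simp: outcome_def)
  then show "I \<in> {I. \<exists>k. odometer V \<sigma> I w = enat k \<and> Q k}"
    using odometer_eq[OF xs(1), of w] by simp
next
  fix I assume "I \<in> {I. \<exists>k. odometer V \<sigma> I w = enat k \<and> Q k}"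
  then obtain k where k: "odometer V \<sigma> I w = enat k" "Q k" by auto
  then obtain xs where xs: "ends V {} (restrict_config V \<sigma>) I xs"
    using odometer_infinite[of V \<sigma> I w] by fastforce
  then have "Q (count_list xs w)" using k odometer_eq[OF xs, of w] by simp
  then show "I \<in> outcome V {} (\<lambda>h _. Q (h w)) (restrict_config V \<sigma>)"
    using xs by (auto simp: outcome_def)
qed

text \<open>The union over \<open>n\<close> of the events that the odometer in \<open>box n\<close>
  exceeds \<open>K\<close> decreases in \<open>K\<close> to an event on which the limit is infinite.
  Hence one \<open>K\<close> serves all boxes at once.\<close>

lemma tail_small:
  fixes \<sigma> :: "int ^ 'd::finite \<Rightarrow> nat"
  assumes "AE I in law. limit_odometer \<sigma> I w < \<infinity>" and "\<delta> > 0"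
  shows "\<forall>\<^sub>F K in sequentially. \<forall>n. pr (box n) {} (\<lambda>h _. K < h w) (restrict_config (box n) \<sigma>) \<le> \<delta>"
proof -
  define A where "A n K = outcome (box n) {} (\<lambda>h _. K < h w) (restrict_config (box n) \<sigma>)" for n K
  have A: "A n K = {I. \<exists>k. odometer (box n) \<sigma> I w = enat k \<and> K < k}" for n K
    unfolding A_def by (rule outcome_odometer)
  define B where "B K = (\<Union>n. A n K)" for K
  have [measurable]: "A n K \<in> sets law" for n K unfolding A_def by (rule sets_outcome)
  then have [measurable]: "B K \<in> sets law" for K unfolding B_def by auto
  have "decseq B" by (intro decseq_SucI) (force simp: B_def A)
  then have lim: "(\<lambda>K. measure law (B K)) \<longlonglongrightarrow> measure law (\<Inter>K. B K)"
    by (intro law.finite_Lim_measure_decseq) auto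
  have "AE I in law. I \<notin> (\<Inter>K. B K)"
    using assms(1)
  proof eventually_elim
    case (elim I)
    show ?case
    proof
      assume I: "I \<in> (\<Inter>K. B K)"
      obtain m where m: "limit_odometer \<sigma> I w = enat m" using elim by auto
      from I have "I \<in> B m" by blast
      then obtain n k where "odometer (box n) \<sigma> I w = enat k" "m < k" by (auto simp: B_def A)
      moreover have "odometer (box n) \<sigma> I w \<le> limit_odometer \<sigma> I w"
        unfolding limit_odometer_eq by (rule SUP_upper) simp
      ultimately show False using m by simp
    qed
  qed
  then have "measure law (\<Inter>K. B K) = 0" by (subst law.prob_eq_0) auto
  with lim have "\<forall>\<^sub>F K in sequentially. measure law (B K) < \<delta>"
    using assms(2) by (simp add: order_tendstoD)
  then show ?thesis
  proof eventually_elim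
    case (elim K)
    have "measure law (A n K) \<le> measure law (B K)" for n
      by (rule law.finite_measure_mono) (auto simp: B_def)
    then show ?case using elim by (auto simp: pr_def A_def intro: order_trans less_imp_le)
  qed
qed

lemma unused_small:
  fixes \<sigma> :: "int ^ 'd::finite \<Rightarrow> nat"
  assumes "AE I in law. \<not> limit_odometer \<sigma> I w < \<infinity>" and "\<delta> > 0"
  shows "\<forall>\<^sub>F k in sequentially. unused (box k) {} w (restrict_config (box k) \<sigma>) \<le> \<delta>"
proof -
  define A where "A n = outcome (box n) {} (\<lambda>h _. h w = 0) (restrict_config (box n) \<sigma>)" for n
  have A: "A n = {I. odometer (box n) \<sigma> I w = 0}" for n
    unfolding A_def outcome_odometer[of "box n" "\<lambda>k. k = 0" w] by (auto simp: zero_enat_def)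
  have [measurable]: "A n \<in> sets law" for n unfolding A_def by (rule sets_outcome)
  have m: "odometer (box n) \<sigma> I w \<le> odometer (box (Suc n)) \<sigma> I w" for n I
    by (intro odometer_mono box_mono) simp
  have "decseq A"
  proof (intro decseq_SucI subsetI)
    fix n I assume "I \<in> A (Suc n)"
    then show "I \<in> A n" using m[of n I] by (simp add: A)
  qed
  then have lim: "(\<lambda>n. measure law (A n)) \<longlonglongrightarrow> measure law (\<Inter>n. A n)"
    by (intro law.finite_Lim_measure_decseq) auto
  have "AE I in law. I \<notin> (\<Inter>n. A n)"
    using assms(1)
  proof eventually_elim
    case (elim I)
    show ?case
    proof
      assume "I \<in> (\<Inter>n. A n)"
      then have "odometer (box n) \<sigma> I w = 0" for n by (auto simp: A)
      then have "limit_odometer \<sigma> I w = 0" by (simp add: limit_odometer_eq)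
      then show False using elim by simp
    qed
  qed
  then have "measure law (\<Inter>n. A n) = 0" by (subst law.prob_eq_0) auto
  with lim have "\<forall>\<^sub>F n in sequentially. measure law (A n) < \<delta>"
    using assms(2) by (simp add: order_tendstoD)
  then show ?thesis by eventually_elim (simp add: unused_def pr_def A_def)
qed

lemma unused_antimono:
  assumes "V \<subseteq> V'"
  shows "unused V' {} w (restrict_config V' \<sigma>) \<le> unused V {} w (restrict_config V \<sigma>)"
  unfolding unused_def pr_def
proof (rule law.finite_measure_mono[OF _ sets_outcome], rule subsetI)
  fix I assume "I \<in> outcome V' {} (\<lambda>h _. h w = 0) (restrict_config V' \<sigma>)"
  then obtain ys where ys: "ends V' {} (restrict_config V' \<sigma>) I ys" "count_list ys w = 0"
    by (auto simp: outcome_def)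
  note b = below_restrict_config[OF assms, of \<sigma>]
  obtain xs where xs: "ends V {} (restrict_config V \<sigma>) I xs"
    using finite_legal_extends[OF ys(1) b assms] by blast
  have "count_list xs w = 0" using ends_le[OF xs ys(1) b assms, of w] ys(2) by simp
  then show "I \<in> outcome V {} (\<lambda>h _. h w = 0) (restrict_config V \<sigma>)"
    using xs by (auto simp: outcome_def)
qed

section \<open>Translation invariance\<close>

lemma execute_translate:
  fixes v x y :: "int ^ 'd::finite"
  shows "(\<lambda>z. execute ((+) v ` V) (v + x) Sleep \<eta> (v + z)) = execute V x Sleep (\<lambda>z. \<eta> (v + z))"
    and "(\<lambda>z. execute ((+) v ` V) (v + x) (Jump (v + y)) \<eta> (v + z))
      = execute V x (Jump y) (\<lambda>z. \<eta> (v + z))"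
  by (auto simp: execute.simps Let_def fun_eq_iff)

text \<open>No measure is transported: both sides satisfy the same toppling recursion, so the
  maximum principle for their difference, with both signs, gives equality.\<close>

lemma unused_translate:
  fixes v w :: "int ^ 'd::finite"
  assumes "finite V"
  shows "unused ((+) v ` V) {} (v + w) \<eta> = unused V {} w (\<lambda>z. \<eta> (v + z))"
proof -
  let ?V = "(+) v ` V"
  have fin: "finite ?V" using assms by simp
  have signed: "c * (unused ?V {} (v + w) \<eta> - unused V {} w (\<lambda>z. \<eta> (v + z))) \<le> 0"
    if c: "c = 1 \<or> c = -1" for c :: real
  proof (rule maximum_principle_config[where Inv = "\<lambda>_. True" and V = ?V
        and F = "\<lambda>\<eta>. c * (unused ?V {} (v + w) \<eta> - unused V {} w (\<lambda>z. \<eta> (v + z)))", OF fin])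
    let ?F = "\<lambda>\<eta>. c * (unused ?V {} (v + w) \<eta> - unused V {} w (\<lambda>z. \<eta> (v + z)))"
    have "?F \<eta> \<le> 1" for \<eta>
    proof -
      have "unused ?V {} (v + w) \<eta> - unused V {} w (\<lambda>z. \<eta> (v + z)) \<le> 1 - 0"
        "unused V {} w (\<lambda>z. \<eta> (v + z)) - unused ?V {} (v + w) \<eta> \<le> 1 - 0"
        by (intro diff_mono unused_bounds)+
      then show ?thesis using c by auto
    qed
    then show "\<exists>B. \<forall>\<eta>. True \<longrightarrow> mass ?V \<eta> \<le> C \<longrightarrow> ?F \<eta> \<le> B" for C by blast
    fix \<eta> :: "int ^ 'd \<Rightarrow> site_state"
    show "?F \<eta> \<le> 0 \<or> (\<exists>x\<in>?V. act {} \<eta> x \<and> ?F \<eta> \<le> ev x (\<lambda>i. if True then ?F (execute ?V x i \<eta>) else 0))"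
    proof (cases "stable ?V {} \<eta>")
      case True
      then have "stable V {} (\<lambda>z. \<eta> (v + z))" by (auto simp: stable_def)
      then show ?thesis using True by (simp add: unused_stable)
    next
      case False
      then obtain x where x: "x \<in> V" "act {} \<eta> (v + x)" by (auto simp: stable_def)
      then have x1: "v + x \<in> ?V" and x2: "act {} (\<lambda>z. \<eta> (v + z)) x" by auto
      show ?thesis
      proof (cases "x = w")
        case True
        then show ?thesis using unused_same[OF x1 x(2)] unused_same[OF x(1) x2] by simp
      next
        case False
        then have ne: "v + x \<noteq> v + w" by simp
        let ?u = "\<lambda>\<zeta>. unused V {} w (\<lambda>z. \<zeta> (v + z))"
        have "ev (v + x) (\<lambda>i. ?u (execute ?V (v + x) i \<eta>))
            = ev x (\<lambda>i. unused V {} w (execute V x i (\<lambda>z. \<eta> (v + z))))"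
        proof -
          have "avg (v + x) (\<lambda>y. ?u (execute ?V (v + x) (Jump y) \<eta>))
              = avg x (\<lambda>y. unused V {} w (execute V x (Jump y) (\<lambda>z. \<eta> (v + z))))"
            unfolding avg_translate[of "v + x"] avg_translate[of x] add.assoc execute_translate(2) ..
          then show ?thesis by (simp only: ev_def execute_translate(1))
        qed
        also have "\<dots> = ?u \<eta>" by (rule unused_step[OF x(1) x2 False, symmetric])
        finally have "?F \<eta> = ev (v + x) (\<lambda>i. ?F (execute ?V (v + x) i \<eta>))"
          by (simp only: ev_cmult ev_diff unused_step[OF x1 x(2) ne, symmetric])
        then show ?thesis
          by (intro submartingale_step[OF x1 x(2) TrueI, where F = ?F]) simp
      qed
    qed
  qed auto
  show ?thesis using signed[of 1] signed[of "-1"] by simp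
qed

text \<open>The box of radius \<open>k\<close> around \<open>y\<close> lies inside
  \<open>box m\<close>, and a larger volume can only use \<open>y\<close> more.\<close>

lemma unused_box_shift:
  fixes y :: "int ^ 'd::finite"
  assumes "y \<in> box n" "n + k \<le> m"
  shows "unused (box m) {} y (restrict_config (box m) \<sigma>)
    \<le> unused (box k) {} 0 (restrict_config (box k) (shift y \<sigma>))"
proof -
  let ?V = "(+) y ` box k"
  have "?V \<subseteq> box m"
  proof
    fix x assume "x \<in> ?V"
    then obtain z where z: "z \<in> box k" "x = y + z" by auto
    have "\<bar>x $ i\<bar> \<le> int m" for i
    proof -
      have "\<bar>z $ i\<bar> \<le> int k" "\<bar>y $ i\<bar> \<le> int n" using z(1) assms(1) by (auto simp: box_def)
      then show ?thesis using z(2) assms(2) by simp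
    qed
    then show "x \<in> box m" by (simp add: box_def)
  qed
  then have "unused (box m) {} y (restrict_config (box m) \<sigma>)
      \<le> unused ?V {} y (restrict_config ?V \<sigma>)"
    by (rule unused_antimono)
  also have "\<dots> = unused (box k) {} 0 (\<lambda>z. restrict_config ?V \<sigma> (y + z))"
    using unused_translate[of "box k" y 0] by simp
  also have "(\<lambda>z. restrict_config ?V \<sigma> (y + z)) = restrict_config (box k) (shift y \<sigma>)"
    by (auto simp: restrict_config_def shift_def fun_eq_iff add.commute)
  finally show ?thesis .
qed

end

section \<open>Periodic initial laws\<close>

text \<open>
  A uniformly shifted periodic configuration has a translation-ergodic law, since its support is a
  single finite orbit. The density \<open>a / N\<close> can be any nonnegative rational number. The
  coordinate \<open>undefined\<close> is an arbitrary one.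
\<close>

definition comb :: "nat \<Rightarrow> nat \<Rightarrow> int \<Rightarrow> int ^ 'd::finite \<Rightarrow> nat" where
  "comb a N s x = (if int N dvd x $ undefined + s then a else 0)"

definition comb_law :: "nat \<Rightarrow> nat \<Rightarrow> (int ^ 'd::finite \<Rightarrow> nat) measure" where
  "comb_law a N = distr (measure_pmf (pmf_of_set {0..<int N})) config_space (comb a N)"

lemma comb_le: "comb a N s x \<le> a"
  by (simp add: comb_def)

lemma comb_mod: "comb a N (s mod int N) = comb a N s"
  by (simp add: comb_def fun_eq_iff dvd_eq_mod_eq_0 mod_add_right_eq)

lemma shift_comb: "shift v (comb a N s) = comb a N (s + v $ undefined)"
  by (simp add: shift_def comb_def fun_eq_iff add_ac)

lemma comb_sum:
  assumes "N > 0"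
  shows "(\<Sum>s\<in>{0..<int N}. real (comb a N s x)) = real a"
proof -
  have "int N dvd x $ undefined + s \<longleftrightarrow> s = (- (x $ undefined)) mod int N" if "s \<in> {0..<int N}" for s
  proof -
    have "int N dvd x $ undefined + s \<longleftrightarrow> s mod int N = (- (x $ undefined)) mod int N"
      by (simp add: mod_eq_dvd_iff add.commute)
    then show ?thesis using that by simp
  qed
  then have "(\<Sum>s\<in>{0..<int N}. real (comb a N s x))
      = (\<Sum>s\<in>{0..<int N}. if s = (- (x $ undefined)) mod int N then real a else 0)"
    by (intro sum.cong) (auto simp: comb_def)
  also have "\<dots> = real a" using assms by simp
  finally show ?thesis .
qed

lemma space_config_space [simp]: "space config_space = UNIV"
  by (simp add: config_space_def space_PiM)

lemma measurable_comb [measurable]: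
  "comb a N \<in> measure_pmf p \<rightarrow>\<^sub>M (config_space :: (int ^ 'd::finite \<Rightarrow> nat) measure)"
  by simp

lemma measurable_site [measurable]: "(\<lambda>\<sigma>. \<sigma> x) \<in> config_space \<rightarrow>\<^sub>M count_space UNIV"
  unfolding config_space_def by (rule measurable_component_singleton) simp

lemma measurable_shift [measurable]: "shift v \<in> config_space \<rightarrow>\<^sub>M config_space"
proof -
  have "(\<lambda>\<sigma> x. \<sigma> (x + v)) \<in> config_space \<rightarrow>\<^sub>M PiM UNIV (\<lambda>_. count_space UNIV)"
    by (rule measurable_PiM_single') auto
  then show ?thesis by (simp add: shift_def[abs_def] config_space_def)
qed

lemma comb_law_prob_space: "prob_space (comb_law a N)"
  unfolding comb_law_def
  by (rule prob_space.prob_space_distr[OF prob_space_measure_pmf measurable_comb])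

text \<open>A shift moves the phase \<open>s\<close> by a constant, which permutes the residues
  modulo \<open>N\<close>.\<close>

lemma comb_law_shift:
  assumes "N > 0"
  shows "distr (comb_law a N) config_space (shift v) = comb_law a N"
proof -
  let ?S = "{0..<int N}" and ?c = "v $ undefined"
  let ?f = "\<lambda>s. (s + ?c) mod int N"
  have "bij_betw ?f ?S ?S"
    by (rule bij_betwI[where g = "\<lambda>s. (s - ?c) mod int N"]) (use assms in \<open>auto simp: mod_simps\<close>)
  then have m: "map_pmf ?f (pmf_of_set ?S) = pmf_of_set ?S"
    using assms by (intro map_pmf_of_set_bij_betw) auto
  have "distr (comb_law a N) config_space (shift v)
      = distr (measure_pmf (pmf_of_set ?S)) config_space (shift v \<circ> comb a N)"
    unfolding comb_law_def by (rule distr_distr) measurable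
  also have "shift v \<circ> comb a N = comb a N \<circ> ?f"
    by (rule ext) (simp only: o_apply shift_comb comb_mod)
  also have "distr (measure_pmf (pmf_of_set ?S)) config_space (comb a N \<circ> ?f)
      = distr (measure_pmf (map_pmf ?f (pmf_of_set ?S))) config_space (comb a N)"
    unfolding map_pmf_rep_eq by (rule distr_distr[symmetric]) auto
  finally show ?thesis by (simp add: m comb_law_def)
qed

text \<open>All combs are translates of \<open>comb a N 0\<close>, so an invariant event contains
  every one of them or none.\<close>

lemma comb_law_ergodic:
  assumes "N > 0"
  shows "translation_ergodic (comb_law a N :: (int ^ 'd::finite \<Rightarrow> nat) measure)"
  unfolding translation_ergodic_def
proof (intro conjI allI ballI impI)
  let ?M = "comb_law a N :: (int ^ 'd \<Rightarrow> nat) measure"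
  show "prob_space ?M" by (rule comb_law_prob_space)
  show "sets ?M = sets config_space" by (simp add: comb_law_def)
  show "distr ?M config_space (shift v) = ?M" for v by (rule comb_law_shift[OF assms])
  fix A assume A: "A \<in> sets ?M" and inv: "\<forall>v. shift v -` A = A"
  have "A \<in> sets config_space" using A by (simp add: comb_law_def)
  then have m: "measure ?M A = measure (measure_pmf (pmf_of_set {0..<int N})) (comb a N -` A)"
    unfolding comb_law_def by (subst measure_distr[OF measurable_comb]) auto
  have "comb a N s \<in> A \<longleftrightarrow> comb a N 0 \<in> A" for s
  proof -
    have "shift (axis undefined s) (comb a N 0) = (comb a N s :: int ^ 'd \<Rightarrow> nat)"
      by (simp add: shift_comb axis_def)
    then show ?thesis using inv by (metis vimage_eq)
  qed
  then have "comb a N -` A = {} \<or> comb a N -` A = UNIV" by blast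
  then show "measure ?M A = 0 \<or> measure ?M A = 1"
    unfolding m using measure_pmf.prob_space by fastforce
qed

lemma comb_law_density:
  assumes "N > 0"
  shows "has_density (comb_law a N :: (int ^ 'd::finite \<Rightarrow> nat) measure) (real a / real N)"
proof -
  let ?p = "pmf_of_set {0..<int N}"
  have f: "(\<lambda>\<sigma>. real (\<sigma> 0)) \<in> borel_measurable (config_space :: (int ^ 'd \<Rightarrow> nat) measure)"
    by (rule measurable_compose[OF measurable_site]) simp
  have fin: "finite (set_pmf ?p)" using assms by (subst set_pmf_of_set) auto
  have "integrable (comb_law a N :: (int ^ 'd \<Rightarrow> nat) measure) (\<lambda>\<sigma>. real (\<sigma> 0))"
    unfolding comb_law_def integrable_distr_eq[OF measurable_comb f]
    by (rule integrable_measure_pmf_finite[OF fin])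
  moreover have "(\<integral>\<sigma>. real (\<sigma> 0) \<partial>(comb_law a N :: (int ^ 'd \<Rightarrow> nat) measure)) = real a / real N"
  proof -
    have "(\<integral>\<sigma>. real (\<sigma> 0) \<partial>(comb_law a N :: (int ^ 'd \<Rightarrow> nat) measure))
        = (\<integral>s. real (comb a N s (0 :: int ^ 'd)) \<partial>measure_pmf ?p)"
      unfolding comb_law_def by (rule integral_distr[OF measurable_comb f])
    also have "\<dots> = (\<Sum>s\<in>{0..<int N}. real (comb a N s (0 :: int ^ 'd))) / real N"
      using assms by (subst integral_pmf_of_set) auto
    finally show ?thesis by (simp add: comb_sum[OF assms])
  qed
  ultimately show ?thesis by (simp add: has_density_def)
qed

lemma card_box: "card (box n :: (int ^ 'd::finite) set) = (2 * n + 1) ^ CARD('d)"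
proof -
  have "bij_betw vec_lambda (PiE (UNIV :: 'd set) (\<lambda>_. {- int n..int n})) (box n)"
  proof (rule bij_betwI[where g = "\<lambda>x i. x $ i"])
    show "vec_lambda \<in> PiE (UNIV :: 'd set) (\<lambda>_. {- int n..int n}) \<rightarrow> box n"
      by (auto simp: box_def PiE_UNIV_domain Pi_iff abs_le_iff) (metis minus_le_iff)
    show "(\<lambda>x i. x $ i) \<in> box n \<rightarrow> PiE (UNIV :: 'd set) (\<lambda>_. {- int n..int n})"
      by (auto simp: box_def abs_le_iff minus_le_iff)
  qed auto
  then have "card (box n :: (int ^ 'd) set) = card (PiE (UNIV :: 'd set) (\<lambda>_. {- int n..int n}))"
    by (simp add: bij_betw_same_card)
  also have "\<dots> = (2 * n + 1) ^ CARD('d)"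
    by (simp add: card_PiE nat_add_distrib nat_mult_distrib)
  finally show ?thesis .
qed

section \<open>Density bounds for periodic laws\<close>

context arw
begin

text \<open>The law charges each of the \<open>N\<close> phases, so an almost sure property holds
  for every phase; \<open>comb_mod\<close> reduces a general integer \<open>s\<close> to
  these.\<close>

lemma AE_comb:
  fixes P :: "(int ^ 'd::finite \<Rightarrow> nat) \<Rightarrow> ((int ^ 'd) \<times> nat \<Rightarrow> (int ^ 'd) instruction) \<Rightarrow> bool"
  assumes "N > 0" and "AE (\<sigma>, I) in (comb_law a N :: (int ^ 'd \<Rightarrow> nat) measure)
      \<Otimes>\<^sub>M instruction_measure lam. P \<sigma> I"
  shows "AE I in law. P (comb a N s) I"
proof -
  let ?M = "comb_law a N :: (int ^ 'd \<Rightarrow> nat) measure"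
  interpret M: prob_space ?M by (rule comb_law_prob_space)
  interpret L: prob_space "law :: ((int ^ 'd) \<times> nat \<Rightarrow> (int ^ 'd) instruction) measure"
    by (rule prob_space_law)
  interpret pair_prob_space ?M "law :: ((int ^ 'd) \<times> nat \<Rightarrow> (int ^ 'd) instruction) measure" ..
  have "AE \<sigma> in ?M. AE I in law. P \<sigma> I" using AE_pair[OF assms(2)] by simp
  then have "AE s in measure_pmf (pmf_of_set {0..<int N}). AE I in law. P (comb a N s) I"
    unfolding comb_law_def by (rule AE_distrD[OF measurable_comb])
  then have *: "AE I in law. P (comb a N s) I" if "s \<in> {0..<int N}" for s
    using that assms(1) by (simp add: AE_measure_pmf_iff set_pmf_of_set)
  have "s mod int N \<in> {0..<int N}" using assms(1) by simp
  from *[OF this] show ?thesis by (simp add: comb_mod)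
qed

lemma mass_restrict_config:
  "finite V \<Longrightarrow> mass V (restrict_config V \<sigma>) = (\<Sum>z\<in>V. \<sigma> z)"
  unfolding mass_def by (rule sum.cong) (auto simp: restrict_config_def)

text \<open>Averaging over the phases replaces each site count by its mean \<open>a / N\<close>. The
  weights may have either sign.\<close>

lemma sum_periods:
  assumes "N > 0" "\<And>s. s \<in> {0..<int N} \<Longrightarrow> c \<le> (\<Sum>z\<in>V. f z * real (comb a N s z)) + e"
  shows "c \<le> real a / real N * (\<Sum>z\<in>V. f z) + e"
proof -
  have "real N * c = (\<Sum>s\<in>{0..<int N}. c)" by simp
  also have "\<dots> \<le> (\<Sum>s\<in>{0..<int N}. (\<Sum>z\<in>V. f z * real (comb a N s z)) + e)"
    by (rule sum_mono) (rule assms(2))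
  also have "\<dots> = (\<Sum>z\<in>V. f z * (\<Sum>s\<in>{0..<int N}. real (comb a N s z))) + real N * e"
    by (simp add: sum.distrib sum_distrib_left) (rule sum.swap)
  also have "\<dots> = real a * (\<Sum>z\<in>V. f z) + real N * e"
    by (simp add: comb_sum[OF assms(1)] sum_distrib_left mult.commute)
  finally show ?thesis using assms(1) by (simp add: field_simps)
qed

text \<open>Deep in a large box every site is used with probability near 1, so
  \<open>occ_lower\<close> bounds its final occupation from below. Summed over the sites, this is at
  most the initial number of particles, which is then averaged over the phases.\<close>

lemma active_density_ge:
  assumes N: "N > 0"
    and active: "stays_active_as lam (comb_law a N :: (int ^ 'd::finite \<Rightarrow> nat) measure)"
  shows "ps + ps * pj / (2 * real CARD('d)) * (1 - ps * pj / (2 * real CARD('d)))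
    \<le> real a / real N"
proof -
  define L where "L = ps + ps * pj / (2 * real CARD('d)) * (1 - ps * pj / (2 * real CARD('d)))"
  let ?\<sigma> = "\<lambda>s. comb a N s :: int ^ 'd \<Rightarrow> nat"
  have main: "L - 4 * \<delta> \<le> real a / real N" if \<delta>: "\<delta> > 0" for \<delta>
  proof -
    \<comment> \<open>Finitely many phases admit a common radius \<open>k\<close>; by shifting it
      serves every site.\<close>
    have ev: "\<forall>\<^sub>F k in sequentially. \<forall>s\<in>{0..<int N}.
        unused (box k) {} 0 (restrict_config (box k) (?\<sigma> s)) \<le> \<delta>"
      using AE_comb[OF N active[unfolded stays_active_as_def]] \<delta>
      by (intro eventually_ball_finite ballI unused_small) auto
    then obtain k where k: "\<And>s. s \<in> {0..<int N} \<Longrightarrow>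
        unused (box k) {} 0 (restrict_config (box k) (?\<sigma> s)) \<le> \<delta>"
      using eventually_happens'[OF sequentially_bot ev] by blast
    have un: "unused (box k) {} 0 (restrict_config (box k) (?\<sigma> s)) \<le> \<delta>" for s
      using k[of "s mod int N"] N by (simp add: comb_mod)
    have bound: "(L - 4 * \<delta>) * card (box n :: (int ^ 'd) set)
        \<le> real a / real N * card (box (Suc n + k) :: (int ^ 'd) set)" for n
    proof -
      \<comment> \<open>\<open>n + 1\<close> covers the neighbors of \<open>box n\<close>, and
        \<open>k\<close> more leaves room for a box of radius \<open>k\<close> around each of
        them.\<close>
      let ?V = "box (Suc n + k) :: (int ^ 'd) set"
      have o: "L - 4 * \<delta> \<le> occ ?V {} z (restrict_config ?V (?\<sigma> s))" if z: "z \<in> box n" for z s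
        unfolding L_def
      proof (rule occ_lower)
        show "z \<in> ?V" using z box_mono[of n "Suc n + k"] by auto
        show "neighbors z \<subseteq> ?V" using neighbor_box[OF z] box_mono[of "Suc n" "Suc n + k"] by auto
        show "restrict_config ?V (?\<sigma> s) z \<noteq> Sleeping" by (simp add: restrict_config_def)
        fix y assume "y \<in> insert z (neighbors z)"
        then have "y \<in> box (Suc n)" using z neighbor_box[OF z] box_mono[of n "Suc n"] by auto
        then show "unused ?V {} y (restrict_config ?V (?\<sigma> s)) \<le> \<delta>"
          using unused_box_shift[of y "Suc n" k "Suc n + k" "?\<sigma> s"] un by (simp add: shift_comb order_trans)
      qed simp
      have "(L - 4 * \<delta>) * card (box n :: (int ^ 'd) set)
          \<le> (\<Sum>z\<in>?V. 1 * real (?\<sigma> s z)) + 0" for s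
      proof -
        have "(L - 4 * \<delta>) * card (box n :: (int ^ 'd) set) = (\<Sum>z\<in>(box n :: (int ^ 'd) set). L - 4 * \<delta>)"
          by simp
        also have "\<dots> \<le> (\<Sum>z\<in>box n. occ ?V {} z (restrict_config ?V (?\<sigma> s)))"
          by (intro sum_mono o)
        also have "\<dots> \<le> (\<Sum>z\<in>?V. occ ?V {} z (restrict_config ?V (?\<sigma> s)))"
          by (intro sum_mono2 box_mono) auto
        also have "\<dots> \<le> mass ?V (restrict_config ?V (?\<sigma> s))" by (rule occ_sum_le_mass) simp
        finally show ?thesis by (simp add: mass_restrict_config)
      qed
      then show ?thesis using sum_periods[where f = "\<lambda>_. 1" and V = ?V and a = a and e = 0, OF N] by simp
    qed
    \<comment> \<open>The volumes of the two boxes are asymptotically equal, as \<open>k\<close> is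
      fixed.\<close>
    let ?q = "\<lambda>n. ((2 * real (Suc n + k) + 1) / (2 * real n + 1)) ^ CARD('d)"
    have "(\<lambda>n. (2 * real (Suc n + k) + 1) / (2 * real n + 1)) \<longlonglongrightarrow> 1"
      by real_asymp
    then have "(\<lambda>n. real a / real N * ?q n) \<longlonglongrightarrow> real a / real N * 1 ^ CARD('d)"
      by (intro tendsto_mult tendsto_const tendsto_power)
    moreover have "L - 4 * \<delta> \<le> real a / real N * ?q n" for n
    proof -
      have "(L - 4 * \<delta>) * (2 * real n + 1) ^ CARD('d)
          \<le> real a / real N * (2 * real (Suc n + k) + 1) ^ CARD('d)"
        using bound[of n] by (simp add: card_box add_ac)
      moreover have "0 < (2 * real n + 1) ^ CARD('d)" by simp
      ultimately have "L - 4 * \<delta> \<le> real a / real N * (2 * real (Suc n + k) + 1) ^ CARD('d)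
          / (2 * real n + 1) ^ CARD('d)"
        by (simp only: pos_le_divide_eq)
      then show ?thesis by (simp only: power_divide times_divide_eq_right)
    qed
    ultimately show ?thesis by (intro LIMSEQ_le_const[where a = "L - 4 * \<delta>"]) auto
  qed
  have "L \<le> real a / real N"
  proof (rule field_le_epsilon)
    fix e :: real assume "e > 0"
    then show "L \<le> real a / real N + e" using main[of "e / 4"] by simp
  qed
  then show ?thesis by (simp add: L_def)
qed

text \<open>The initial weight splits into the final weight, at most \<open>U\<close> times the
  total \<open>T\<close> of the Green function, and the loss, at most
  \<open>C * \<delta> * T\<close> up to a constant independent of the box. Since
  \<open>T \<ge> n\<close>, dividing by \<open>T\<close> gives the bound as the box grows.\<close>

lemma fixating_density_le:
  assumes N: "N > 0"
    and fixates: "fixates_as lam (comb_law a N :: (int ^ 'd::finite \<Rightarrow> nat) measure)"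
    and r: "expected_returns TYPE('d) = ennreal r" "0 \<le> r"
  shows "real a / real N \<le> ps + ps * pj * r"
proof -
  let ?\<sigma> = "\<lambda>s. comb a N s :: int ^ 'd \<Rightarrow> nat"
  define U where "U = ps + ps * pj * r"
  define C where "C = ((real a)\<^sup>2 / pj + 2 * real a / pj) / 2 + pj / 2"
  have C0: "0 \<le> C" using pj_pos by (simp add: C_def)
  have main: "real a / real N \<le> U + C * \<delta>" if \<delta>: "\<delta> > 0" for \<delta>
  proof -
    \<comment> \<open>The tail probability is taken as \<open>\<delta>\<^sup>2\<close> because
      \<open>loss_tail\<close> will multiply it by a parameter proportional to
      \<open>1 / \<delta>\<close>.\<close>
    have ev: "\<forall>\<^sub>F K in sequentially. \<forall>s\<in>{0..<int N}. \<forall>n.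
        pr (box n) {} (\<lambda>h _. K < h 0) (restrict_config (box n) (?\<sigma> s)) \<le> \<delta>\<^sup>2"
      using AE_comb[OF N fixates[unfolded fixates_as_def]] \<delta>
      by (intro eventually_ball_finite ballI tail_small) auto
    then obtain K where K: "\<And>s n. s \<in> {0..<int N} \<Longrightarrow>
        pr (box n) {} (\<lambda>h _. K < h 0) (restrict_config (box n) (?\<sigma> s)) \<le> \<delta>\<^sup>2"
      using eventually_happens'[OF sequentially_bot ev] by blast
    have step: "real a / real N \<le> U + C * \<delta> + pj * real K / real n" if n: "n \<ge> 1" for n
    proof -
      let ?V = "box n :: (int ^ 'd) set"
      let ?f = "green ?V 0"
      define T where "T = (\<Sum>z\<in>?V. ?f z)"
      have T: "real n \<le> T" unfolding T_def by (rule sum_green_ge)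
      have T0: "0 < T" using T n by linarith
      \<comment> \<open>Crude, but enough for a second moment of order
        \<open>T\<^sup>2\<close>.\<close>
      have f0: "?f 0 \<le> T"
        unfolding T_def by (rule member_le_sum) (auto intro: green_nonneg)
      have up: "(\<Sum>z\<in>?V. ?f z * real (?\<sigma> s z)) \<le> U * T + (pj * real K + C * \<delta> * T)"
        if s: "s \<in> {0..<int N}" for s
      proof -
        let ?\<eta> = "restrict_config ?V (?\<sigma> s)"
        define c where "c = wt ?V ?f ?\<eta> / pj"
        have w: "wt ?V ?f ?\<eta> = (\<Sum>z\<in>?V. ?f z * real (?\<sigma> s z))"
          unfolding wt_def by (rule sum.cong) (auto simp: restrict_config_def)
        have "wt ?V ?f ?\<eta> \<le> (\<Sum>z\<in>?V. ?f z * real a)"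
          unfolding w by (intro sum_mono mult_left_mono) (auto intro: green_nonneg simp: comb_le)
        then have "wt ?V ?f ?\<eta> \<le> real a * T" by (simp add: T_def sum_distrib_left mult.commute)
        then have c1: "c \<le> real a * T / pj" using pj_pos by (simp add: c_def divide_right_mono)
        have c0: "0 \<le> c"
          unfolding c_def using pj_pos by (intro divide_nonneg_pos wt_nonneg green_nonneg) auto
        have "c\<^sup>2 + 2 * ?f 0 / pj * c \<le> (real a * T / pj)\<^sup>2 + 2 * T / pj * (real a * T / pj)"
          using c1 c0 f0 pj_pos T0
          by (intro add_mono power_mono mult_mono divide_right_mono mult_left_mono) auto
        also have "\<dots> = T\<^sup>2 * ((real a)\<^sup>2 / pj + 2 * real a / pj) / pj"
          by (simp add: power2_eq_square field_simps add_divide_distrib)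
        finally have Q: "c\<^sup>2 + 2 * ?f 0 / pj * c
            \<le> T\<^sup>2 * ((real a)\<^sup>2 / pj + 2 * real a / pj) / pj" .
        \<comment> \<open>With \<open>\<theta> = T / \<delta>\<close> the two error terms balance:
          \<open>T\<^sup>2 / \<theta>\<close> and \<open>\<theta> * \<delta>\<^sup>2\<close> both
          equal \<open>\<delta> * T\<close>.\<close>
        have \<theta>: "T / \<delta> > 0" using T0 \<delta> by simp
        have "loss ?V {} 0 ?\<eta> / pj \<le> real K + (c\<^sup>2 + 2 * ?f 0 / pj * c) / (2 * (T / \<delta>))
            + T / \<delta> / 2 * pr ?V {} (\<lambda>h _. K < h 0) ?\<eta>"
          unfolding c_def by (rule loss_tail[OF _ \<theta>]) simp
        also have "\<dots> \<le> real K + (T\<^sup>2 * ((real a)\<^sup>2 / pj + 2 * real a / pj) / pj) / (2 * (T / \<delta>))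
            + T / \<delta> / 2 * \<delta>\<^sup>2"
          using Q K[OF s, of n] \<theta> by (intro add_mono divide_right_mono mult_left_mono) auto
        also have "\<dots> = real K + C * \<delta> * T / pj"
          using T0 \<delta> pj_pos by (simp add: C_def field_simps power2_eq_square)
        finally have "loss ?V {} 0 ?\<eta> \<le> pj * real K + C * \<delta> * T"
          using pj_pos by (simp add: field_simps)
        moreover have "(\<Sum>z\<in>?V. ?f z * occ ?V {} z ?\<eta>) \<le> U * T"
          unfolding U_def T_def
        proof (rule occ_green_upper)
          fix y :: "int ^ 'd"
          have "ennreal (green ?V y y) \<le> ennreal (1 + r)"
            using green_le_expected_returns[of ?V y] r by (simp add: ennreal_plus)
          then show "green ?V y y \<le> 1 + r" using r(2) by (subst (asm) ennreal_le_iff) auto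
        qed simp
        ultimately show ?thesis unfolding w[symmetric] by (simp add: loss_def)
      qed
      \<comment> \<open>\<open>sum_periods\<close> is stated for lower bounds on a weighted count,
        so it is applied to the negated weights.\<close>
      have "- (U * T + (pj * real K + C * \<delta> * T))
          \<le> (\<Sum>z\<in>?V. - ?f z * real (?\<sigma> s z)) + 0" if "s \<in> {0..<int N}" for s
      proof -
        have "(\<Sum>z\<in>?V. - ?f z * real (?\<sigma> s z)) = - (\<Sum>z\<in>?V. ?f z * real (?\<sigma> s z))"
          by (simp add: sum_negf)
        then show ?thesis using up[OF that] by linarith
      qed
      then have "- (U * T + (pj * real K + C * \<delta> * T)) \<le> real a / real N * (\<Sum>z\<in>?V. - ?f z) + 0"
        by (rule sum_periods[OF N])
      then have "real a / real N * T \<le> U * T + (pj * real K + C * \<delta> * T)"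
        by (simp add: sum_negf T_def)
      then have "real a / real N \<le> (U * T + (pj * real K + C * \<delta> * T)) / T"
        using T0 by (simp add: pos_le_divide_eq)
      also have "\<dots> = U + C * \<delta> + pj * real K / T" using T0 by (simp add: field_simps)
      also have "pj * real K / T \<le> pj * real K / real n"
        using T n pj_pos by (intro divide_left_mono mult_pos_pos) auto
      finally show ?thesis by simp
    qed
    have "(\<lambda>n. U + C * \<delta> + pj * real K / real n) \<longlonglongrightarrow> U + C * \<delta> + 0"
      by (intro tendsto_add tendsto_const lim_const_over_n)
    then show ?thesis using step by (intro LIMSEQ_le_const[where a = "real a / real N"]) auto
  qed
  have "real a / real N \<le> U"
  proof (rule field_le_epsilon)
    fix e :: real assume e: "e > 0"
    have "C * (e / (C + 1)) \<le> e" using C0 e by (simp add: field_simps)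
    then show "real a / real N \<le> U + e" using main[of "e / (C + 1)"] C0 e by simp
  qed
  then show ?thesis by (simp add: U_def)
qed

end

section \<open>Passage to the critical density\<close>

lemma rational_between:
  assumes "0 \<le> x" "x < y"
  obtains a N :: nat where "N > 0" "x < real a / real N" "real a / real N < y"
proof -
  obtain q where q: "q \<in> \<rat>" "x < q" "q < y" using Rats_dense_in_real[OF assms(2)] by blast
  have "0 \<le> q" using q(2) assms(1) by linarith
  then obtain a N :: nat where "N \<noteq> 0" "\<bar>q\<bar> = real a / real N"
    using Rats_abs_nat_div_natE[OF q(1)] by blast
  then show thesis using that[of N a] q \<open>0 \<le> q\<close> by simp
qed

text \<open>If a bound failed, a rational density would lie strictly between it and
  \<open>\<rho>c\<close>. The comb law of that density behaves as the definition of
  \<open>\<rho>c\<close> prescribes, which contradicts \<open>active_density_ge\<close> or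
  \<open>fixating_density_le\<close>.\<close>

theorem proposition2:
  fixes lam \<rho>c ps pj :: real
  assumes "lam > 0"
    and "ps = lam / (1 + lam)"
    and "pj = 1 - ps"
    and "is_critical_density TYPE('d::finite) lam \<rho>c"
  shows "ps + ps * pj / (2 * real CARD('d)) * (1 - ps * pj / (2 * real CARD('d))) \<le> \<rho>c
       \<and> ennreal \<rho>c \<le> ennreal ps + ennreal (ps * pj) * expected_returns TYPE('d)"
proof -
  interpret arw lam by unfold_locales (rule assms(1))
  have p: "ps = sleep_prob lam" "pj = jump_prob lam"
    using assms(2,3) by (simp_all add: sleep_prob_def jump_prob_def)
  have p0: "0 < ps" "0 < pj" "ps + pj = 1" using ps_pos pj_pos ps_pj by (simp_all add: p)
  have crit: "fixates_as lam M" if "translation_ergodic M" "has_density M \<rho>" "\<rho> < \<rho>c"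
    for M :: "(int ^ 'd \<Rightarrow> nat) measure" and \<rho>
    using assms(4) that unfolding is_critical_density_def by blast
  have crit': "stays_active_as lam M" if "translation_ergodic M" "has_density M \<rho>" "\<rho>c < \<rho>"
    for M :: "(int ^ 'd \<Rightarrow> nat) measure" and \<rho>
    using assms(4) that unfolding is_critical_density_def by blast
  let ?L = "ps + ps * pj / (2 * real CARD('d)) * (1 - ps * pj / (2 * real CARD('d)))"
  have "?L \<le> \<rho>c"
  proof (rule ccontr)
    assume "\<not> ?L \<le> \<rho>c"
    have "ps * pj \<le> 1 * 1" using p0 by (intro mult_mono) auto
    moreover have "2 \<le> 2 * real CARD('d)" by (simp add: Suc_le_eq)
    ultimately have "ps * pj \<le> 2 * real CARD('d)" by linarith
    then have "ps * pj / (2 * real CARD('d)) \<le> 1" by (simp add: divide_le_eq)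
    then have "0 \<le> ps * pj / (2 * real CARD('d)) * (1 - ps * pj / (2 * real CARD('d)))"
      using p0 by (intro mult_nonneg_nonneg) auto
    then have "0 < ?L" using p0 by linarith
    \<comment> \<open>Densities cannot be negative, and \<open>\<rho>c\<close> is not known to be
      nonnegative at this point.\<close>
    then have "max 0 \<rho>c < ?L" using \<open>\<not> ?L \<le> \<rho>c\<close> by linarith
    then obtain a N :: nat where "N > 0" "max 0 \<rho>c < real a / real N" "real a / real N < ?L"
      using rational_between[OF max.cobounded1] by blast
    then show False
      using active_density_ge[of N a, where 'd = 'd]
        crit'[OF comb_law_ergodic[of N a] comb_law_density[of N a]]
      by (simp add: p)
  qed
  moreover have "ennreal \<rho>c \<le> ennreal ps + ennreal (ps * pj) * expected_returns TYPE('d)"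
  proof (cases "expected_returns TYPE('d)")
    case (real r)
    have "\<rho>c \<le> ps + ps * pj * r"
    proof (rule ccontr)
      assume "\<not> \<rho>c \<le> ps + ps * pj * r"
      moreover have "0 \<le> ps + ps * pj * r" using p0 real(1) by simp
      ultimately obtain a N :: nat where "N > 0" "ps + ps * pj * r < real a / real N"
        "real a / real N < \<rho>c"
        using rational_between[of "ps + ps * pj * r" \<rho>c] unfolding not_le by blast
      then show False
        using fixating_density_le[of N a r, where 'd = 'd] real
          crit[OF comb_law_ergodic[of N a] comb_law_density[of N a]]
        by (simp add: p)
    qed
    then have "ennreal \<rho>c \<le> ennreal (ps + ps * pj * r)" by (rule ennreal_leI)
    then show ?thesis using p0 real by (simp add: ennreal_plus ennreal_mult')
  next
    \<comment> \<open>The right side is infinite, since \<open>ps * pj\<close> is positive.\<close>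
    case top
    then show ?thesis using p0 by (simp add: ennreal_mult_top)
  qed
  ultimately show ?thesis ..
qed

end
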